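(* Let $\mathcal A$ be an essential arrangement of lines in $\mathbb P^2_k$, let $H\in\mathcal A$, and let $(\mathcal A',\mathcal A,\mathcal A'')$ be the triple with respect to $H$. Then $$\mathrm{reg}(\mathcal D)\le\max\{\mathrm{reg}(\mathcal D')+1,\ |\mathcal A''|-1\}.$$
   Context: $k$ is a field of characteristic $0$, $R=k[x_0,x_1,x_2]$. An arrangement $\mathcal A$ of $d$ lines in $\mathbb P^2_k$ is a set of $d$ distinct lines, with defining polynomial $Q\in R_d$ the product of the $d$ linear forms; it is essential if the lines do not all pass through one point. $D_0=D_0(\mathcal A)=\{\theta=\sum f_i\,\partial/\partial x_i\in\mathrm{Der}_k(R):\theta(Q)=0\}$ is the module of syzygies on the partial derivatives of $Q$, graded by $\deg\theta=\deg f_i$, and $\mathcal D$ is the associated sheaf on $\mathbb P^2$ (a rank two vector bundle). For $H\in\mathcal A$, the triple is: $\mathcal A'=\mathcal A\setminus\{H\}$, and $\mathcal A''=\mathcal A|_H$, the set of distinct points $\{H\cap H':H'\in\mathcal A'\}$ on $H$ (multiplicities ignored). $\mathcal D'$ is the sheaf constructed in the same way from $\mathcal A'$. A coherent sheaf $\mathcal F$ on $\mathbb P^n$ is $m$-regular if $H^i(\mathcal F(m-i))=0$ for all $i\ge1$; $\mathrm{reg}(\mathcal F)$ is the least $m$ such that $\mathcal F$ is $m$-regular. *)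

theory Defs
  imports
    "HOL-Analysis.Finite_Cartesian_Product"
    "HOL-Library.Numeral_Type"
    "HOL-Library.Poly_Mapping"
    "HOL-Computational_Algebra.Fraction_Field"
begin

section \<open>The polynomial ring in three variables\<close>

text \<open>The variables are indexed by the three-element type \<^typ>\<open>3\<close>; a monomial is its
  exponent vector.\<close>

type_synonym 'k poly3 = "(3 \<Rightarrow>\<^sub>0 nat) \<Rightarrow>\<^sub>0 'k"

definition var :: "3 \<Rightarrow> 'k::field_char_0 poly3" where
  "var i = Poly_Mapping.single (Poly_Mapping.single i 1) 1"

definition const :: "'k::field_char_0 \<Rightarrow> 'k poly3" where
  "const c = Poly_Mapping.single 0 c"

definition partial :: "3 \<Rightarrow> 'k::field_char_0 poly3 \<Rightarrow> 'k poly3" where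
  "partial i p =
     (\<Sum>e\<in>Poly_Mapping.keys p.
        Poly_Mapping.single (e - Poly_Mapping.single i 1)
          (of_nat (Poly_Mapping.lookup e i) * Poly_Mapping.lookup p e))"

text \<open>The degree is an integer because of the twists below; the zero polynomial is homogeneous
  of every degree, and it is the only homogeneous polynomial of a given negative degree.\<close>

definition homogeneous :: "int \<Rightarrow> 'k::field_char_0 poly3 \<Rightarrow> bool" where
  "homogeneous m p \<longleftrightarrow>
     (\<forall>e\<in>Poly_Mapping.keys p. int (\<Sum>i\<in>UNIV. Poly_Mapping.lookup e i) = m)"

section \<open>Coherent sheaves on the projective plane and their regularity\<close>

text \<open>A graded submodule \<open>M\<close> of a free module \<open>R\<^sup>r\<close> over \<open>R = k[x\<^sub>0, x\<^sub>1, x\<^sub>2]\<close>, with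
  grading given by the common degree of the components, represents its associated coherent sheaf
  \<open>F\<close> on the projective plane.  For a nonempty set \<open>S\<close> of indices, the sections of the twist
  \<open>F(m)\<close> over the basic open set where \<open>\<Prod>i\<in>S. x\<^sub>i\<close> does not vanish form the degree \<open>m\<close> part of
  the localization of \<open>M\<close> at \<open>\<Prod>i\<in>S. x\<^sub>i\<close>.  As \<open>M\<close> lies in \<open>R\<^sup>r\<close>, this localization is a
  submodule of \<open>K\<^sup>r\<close>, where \<open>K\<close> is the fraction field of \<open>R\<close>, and the restriction maps are
  inclusions.\<close>

definition twisted_sections ::
    "('k::field_char_0 poly3 ^ 'r) set \<Rightarrow> int \<Rightarrow> 3 set \<Rightarrow> ('k poly3 fract ^ 'r) set" where
  "twisted_sections M m S =
     {(\<chi> j. Fract (g $ j) ((\<Prod>i\<in>S. var i) ^ N)) | g N.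
        g \<in> M \<and> (\<forall>j. homogeneous (m + int (N * card S)) (g $ j))}"

text \<open>Sheaf cohomology is computed by the ordered Cech complex of the standard affine open cover.
  The intersections of \<open>p + 1\<close> distinct members of the cover correspond to the index sets with
  \<open>p + 1\<close> elements; cochains are extended by zero to all other index sets.\<close>

definition cech_cochains ::
    "('k::field_char_0 poly3 ^ 'r) set \<Rightarrow> int \<Rightarrow> nat \<Rightarrow> (3 set \<Rightarrow> 'k poly3 fract ^ 'r) set" where
  "cech_cochains M m p =
     {c. \<forall>S. if card S = p + 1 then c S \<in> twisted_sections M m S else c S = 0}"

text \<open>If \<open>i\<close> is the \<open>j\<close>-th element of \<open>S\<close> in increasing order, counted from \<open>0\<close>, then its
  sign is \<open>(-1)^j\<close>.\<close>

definition cech_differential ::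
    "(3 set \<Rightarrow> 'k::field_char_0 poly3 fract ^ 'r) \<Rightarrow> (3 set \<Rightarrow> 'k poly3 fract ^ 'r)" where
  "cech_differential c = (\<lambda>S. \<Sum>i\<in>S. (- 1) ^ card {j\<in>S. j < i} *s c (S - {i}))"

definition cech_cocycles ::
    "('k::field_char_0 poly3 ^ 'r) set \<Rightarrow> int \<Rightarrow> nat \<Rightarrow> (3 set \<Rightarrow> 'k poly3 fract ^ 'r) set" where
  "cech_cocycles M m p = {c \<in> cech_cochains M m p. \<forall>S. cech_differential c S = 0}"

definition cech_coboundaries ::
    "('k::field_char_0 poly3 ^ 'r) set \<Rightarrow> int \<Rightarrow> nat \<Rightarrow> (3 set \<Rightarrow> 'k poly3 fract ^ 'r) set" where
  "cech_coboundaries M m p =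
     (if p = 0 then {\<lambda>S. 0} else cech_differential ` cech_cochains M m (p - 1))"

definition cohomology_vanishes ::
    "('k::field_char_0 poly3 ^ 'r) set \<Rightarrow> int \<Rightarrow> nat \<Rightarrow> bool" where
  "cohomology_vanishes M m p \<longleftrightarrow> cech_cocycles M m p = cech_coboundaries M m p"

definition regular_sheaf :: "('k::field_char_0 poly3 ^ 'r) set \<Rightarrow> int \<Rightarrow> bool" where
  "regular_sheaf M m \<longleftrightarrow> (\<forall>i\<ge>1. cohomology_vanishes M (m - int i) i)"

definition reg :: "('k::field_char_0 poly3 ^ 'r) set \<Rightarrow> int" where
  "reg M = (LEAST m. regular_sheaf M m)"

section \<open>Line arrangements\<close>

text \<open>Points and lines of the projective plane are the subspaces of \<open>k\<^sup>3\<close> of dimension 1 and 2;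
  a line is the zero set of a nonzero linear form, which is given by its coefficient vector.\<close>

definition zero_plane :: "'k::field_char_0 ^ 3 \<Rightarrow> ('k ^ 3) set" where
  "zero_plane a = {v. (\<Sum>i\<in>UNIV. a $ i * v $ i) = 0}"

definition is_line :: "('k::field_char_0 ^ 3) set \<Rightarrow> bool" where
  "is_line H \<longleftrightarrow> (\<exists>a. a \<noteq> 0 \<and> H = zero_plane a)"

definition line_arrangement :: "('k::field_char_0 ^ 3) set set \<Rightarrow> bool" where
  "line_arrangement A \<longleftrightarrow> finite A \<and> (\<forall>H\<in>A. is_line H)"

definition essential :: "('k::field_char_0 ^ 3) set set \<Rightarrow> bool" where
  "essential A \<longleftrightarrow> \<not> (\<exists>v. v \<noteq> 0 \<and> (\<forall>H\<in>A. v \<in> H))"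

text \<open>The linear form of a line is unique up to a nonzero scalar; one is chosen.  This determines
  the defining polynomial up to a nonzero scalar, and the module \<open>D0\<close> below does not depend on
  that scalar.\<close>

definition line_coeffs :: "('k::field_char_0 ^ 3) set \<Rightarrow> 'k ^ 3" where
  "line_coeffs H = (SOME a. a \<noteq> 0 \<and> H = zero_plane a)"

definition linear_form :: "'k::field_char_0 ^ 3 \<Rightarrow> 'k poly3" where
  "linear_form a = (\<Sum>i\<in>UNIV. const (a $ i) * var i)"

definition defining_poly :: "('k::field_char_0 ^ 3) set set \<Rightarrow> 'k poly3" where
  "defining_poly A = (\<Prod>H\<in>A. linear_form (line_coeffs H))"

text \<open>The derivation \<open>\<Sum>i. f\<^sub>i \<partial>/\<partial>x\<^sub>i\<close> is given by its coefficient vector \<open>f\<close>.\<close>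

definition D0 :: "('k::field_char_0 ^ 3) set set \<Rightarrow> ('k poly3 ^ 3) set" where
  "D0 A = {f. (\<Sum>i\<in>UNIV. f $ i * partial i (defining_poly A)) = 0}"

text \<open>Distinct lines meet in a one-dimensional subspace, that is, in a projective point.\<close>

definition restriction ::
    "('k::field_char_0 ^ 3) set set \<Rightarrow> ('k ^ 3) set \<Rightarrow> ('k ^ 3) set set" where
  "restriction A H = {H \<inter> H' | H'. H' \<in> A - {H}}"

end

(*
Let l be the form of H. The map f |-> l f - (f(l)/d) E, with E the Euler field, embeds D'(-1) into D,
and its cokernel is recovered on H: for f in D the cross product of f and E is, modulo l, a multiple
of the coefficient vector of l, and this multiple w(f) is divisible modulo l by the product of the
linear forms of the points of A''. This gives 0 -> D'(-1) -> D -> O_H(-a) -> 0 with a = |A''| - 1.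
The last map is onto as a map of sheaves: the constant field in the direction of a point p of A'',
times the forms of all lines that miss p, hits the product of the remaining forms, and the ideal
generated by these products contains a power of each coordinate.

The Cech long exact sequence bounds the regularity of D by max(m + 1, a) for every m for which D' is
m-regular. As reg is a least element of a set of integers, one also needs that m-regularity is
preserved by increasing m, that some m exists (induction on the lines, by the same bound), and that
the set of such m is bounded below (the second cohomology is nonzero in very negative degrees).
*)

theory Submission
  imports Defs "HOL-Analysis.Cartesian_Space" "HOL-Computational_Algebra.Polynomial_Factorial"
begin

section \<open>Polynomials in three variables\<close>

text \<open>Neither a quotient ring nor a sheaf on the line is ever formed. Reduction modulo one
  linear form, or modulo two, is a substitution endomorphism of the polynomial ring with the ideal
  as its kernel. Cochains on the line are represented by rational functions on the plane whose
  cocycle identities hold modulo \<open>l\<close>. Accordingly the vanishing of H^1(O_H(j)) for j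
  \<ge> -1 is obtained from H^1(O(j)) = 0 and H^2(O(j - 1)) = 0. Regularity n asks for H^1 in twist
  n - 1, so j = n - 1 - a, and the condition j \<ge> -1 is the bound n \<ge> a. For H^2 a shortcut
  is taken: multiplication by \<open>l\<close> from D(-1) to D factors through D'(-1), and it is
  onto on H^2 because two charts cover the line. Thus vanishing for D' passes to D without the
  cokernel. The Euler field satisfies E(Q) = d Q. Subtracting a multiple of it turns any field that
  preserves the ideal of Q into one that kills Q; every factor 1/d comes from there.\<close>

abbreviation "lookup \<equiv> Poly_Mapping.lookup"
abbreviation "keys \<equiv> Poly_Mapping.keys"

text \<open>Arithmetic in the index type is modulo three, so its elements can be listed as 0, 1, 2,
  matching the coordinates.\<close>

lemma three_eq_zero: "(3::3) = 0"
  by simp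

lemma UNIV_three: "(UNIV :: 3 set) = {0, 1, 2}"
  using UNIV_3 three_eq_zero by auto

lemma three_distinct [simp]: "(0::3) \<noteq> 1" "(0::3) \<noteq> 2" "(1::3) \<noteq> 2" "(1::3) \<noteq> 0" "(2::3) \<noteq> 0" "(2::3) \<noteq> 1"
  by simp_all

lemma sum_three: "sum f (UNIV :: 3 set) = f 0 + f 1 + f 2"
  unfolding UNIV_three by (subst sum.insert, simp, simp)+ (simp add: add.assoc)

lemma all_three: "(\<forall>i::3. P i) \<longleftrightarrow> P 0 \<and> P 1 \<and> P 2"
  by (metis UNIV_I UNIV_three insertE singletonD)

abbreviation total_degree :: "(3 \<Rightarrow>\<^sub>0 nat) \<Rightarrow> nat" where
  "total_degree e \<equiv> \<Sum>i\<in>UNIV. lookup e i"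

section \<open>Selecting monomials, and induction on polynomials\<close>

definition keep :: "((3 \<Rightarrow>\<^sub>0 nat) \<Rightarrow> bool) \<Rightarrow> 'k::field_char_0 poly3 \<Rightarrow> 'k poly3" where
  "keep P p = Abs_poly_mapping (\<lambda>e. if P e then lookup p e else 0)"

lemma lookup_keep: "lookup (keep P p) e = (if P e then lookup p e else 0)"
proof -
  have "finite {e. (if P e then lookup p e else 0) \<noteq> 0}"
    by (rule finite_subset[OF _ finite_keys[of p]]) (auto simp: in_keys_iff split: if_splits)
  then show ?thesis by (simp add: keep_def)
qed

lemma keep_add: "keep P (p + q) = keep P p + keep P q"
  by (rule poly_mapping_eqI) (simp add: lookup_keep lookup_add)

lemma keys_keep: "keys (keep P p) = {e \<in> keys p. P e}"
  by (auto simp: in_keys_iff lookup_keep split: if_splits)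

lemma keep_split: "p = keep P p + keep (\<lambda>e. \<not> P e) p"
  by (rule poly_mapping_eqI) (simp add: lookup_keep lookup_add)

lemma keep_all: "(\<And>e. e \<in> keys p \<Longrightarrow> P e) \<Longrightarrow> keep P p = p"
  by (rule poly_mapping_eqI) (auto simp: lookup_keep in_keys_iff)

lemma keep_none: "(\<And>e. e \<in> keys p \<Longrightarrow> \<not> P e) \<Longrightarrow> keep P p = 0"
  by (rule poly_mapping_eqI) (auto simp: lookup_keep in_keys_iff)

lemma poly_mapping_sum_single:
  fixes p :: "'a \<Rightarrow>\<^sub>0 'b::comm_monoid_add"
  shows "(\<Sum>e\<in>keys p. Poly_Mapping.single e (lookup p e)) = p"
proof (rule poly_mapping_eqI)
  fix k
  have "(\<Sum>e\<in>keys p. lookup (Poly_Mapping.single e (lookup p e)) k)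
      = (\<Sum>e\<in>keys p. if e = k then lookup p k else 0)"
    by (rule sum.cong) (auto simp: lookup_single when_def)
  then show "lookup (\<Sum>e\<in>keys p. Poly_Mapping.single e (lookup p e)) k = lookup p k"
    by (auto simp: lookup_sum in_keys_iff)
qed

lemma poly_mapping_induct_sum [case_names single add]:
  fixes p :: "'a \<Rightarrow>\<^sub>0 'b::comm_monoid_add"
  assumes single: "\<And>e c. P (Poly_Mapping.single e c)"
    and add: "\<And>p q. P p \<Longrightarrow> P q \<Longrightarrow> P (p + q)"
  shows "P p"
proof -
  have "P (\<Sum>e\<in>S. Poly_Mapping.single e (lookup p e))" if "finite S" for S
    using that
  proof (induction S)
    case empty
    have "P (Poly_Mapping.single undefined 0)" by (rule single)
    then show ?case by simp
  qed (auto intro: single add)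
  from this[OF finite_keys[of p]] show ?thesis by (simp add: poly_mapping_sum_single)
qed

lemma const_add: "const (a + b) = const a + const b"
  by (simp add: const_def single_add)
lemma const_mult: "const (a * b) = const a * const b"
  by (simp add: const_def mult_single)
lemma const_0 [simp]: "const 0 = 0"
  by (simp add: const_def)
lemma const_1 [simp]: "const 1 = 1"
  by (simp add: const_def)
lemma const_uminus: "const (- a) = - const a"
  by (simp add: const_def single_uminus)
lemma const_diff: "const (a - b) = const a - const b"
  by (simp add: const_def single_diff)
lemma const_eq_0_iff [simp]: "const a = 0 \<longleftrightarrow> a = 0"
  by (metis const_0 const_def lookup_single_eq lookup_zero)
lemma const_of_nat: "const (of_nat n) = of_nat n"
  by (simp add: const_def)

lemmas const_simps = const_add const_mult const_uminus const_diff

lemma var_neq_0 [simp]: "var i \<noteq> 0"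
  by (metis var_def lookup_single_eq lookup_zero zero_neq_one)

lemma var_mult_single:
  "var i * Poly_Mapping.single e c = Poly_Mapping.single (Poly_Mapping.single i 1 + e) c"
  by (simp add: var_def mult_single)

lemma monomial_decompose:
  assumes "lookup e i > (0::nat)"
  shows "e = Poly_Mapping.single i 1 + (e - Poly_Mapping.single i 1)"
  using assms by (intro poly_mapping_eqI) (auto simp: lookup_add lookup_minus lookup_single when_def)

text \<open>Made for additive operators: the product rule, multiplicativity of substitution and
  congruences all reduce to multiplication by one variable.\<close>

lemma poly3_induct [case_names const add var]:
  fixes p :: "'k::field_char_0 poly3"
  assumes const: "\<And>c. P (const c)"
    and add: "\<And>p q. P p \<Longrightarrow> P q \<Longrightarrow> P (p + q)"
    and var: "\<And>i p. P p \<Longrightarrow> P (var i * p)"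
  shows "P p"
proof (induction p rule: poly_mapping_induct_sum)
  case (single e c)
  show ?case
  proof (induction "total_degree e" arbitrary: e)
    case 0
    then have "e = 0" by (auto intro: poly_mapping_eqI)
    then show ?case using const by (simp add: const_def)
  next
    case (Suc n)
    then obtain i where i: "lookup e i > 0"
      by (metis gr0I sum.neutral nat.distinct(1))
    define e' where "e' = e - Poly_Mapping.single i 1"
    have e: "e = Poly_Mapping.single i 1 + e'"
      unfolding e'_def by (rule monomial_decompose[OF i])
    have "total_degree e = total_degree (Poly_Mapping.single i 1) + total_degree e'"
      unfolding e by (simp add: lookup_add sum.distrib)
    moreover have "total_degree (Poly_Mapping.single i 1) = 1"
      by (simp add: lookup_single when_def)
    ultimately have "n = total_degree e'" using Suc(2) by simp
    from var[OF Suc(1)[OF this], of i] show ?case by (simp add: var_mult_single e)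
  qed
qed (rule add)

subsection \<open>Homogeneous polynomials\<close>

lemma homogeneous_0 [simp]: "homogeneous m 0"
  by (simp add: homogeneous_def)

lemma homogeneous_add: "homogeneous m p \<Longrightarrow> homogeneous m q \<Longrightarrow> homogeneous m (p + q)"
  unfolding homogeneous_def using keys_add[of p q] by blast

lemma homogeneous_uminus [simp]: "homogeneous m (- p) \<longleftrightarrow> homogeneous m p"
  by (simp add: homogeneous_def in_keys_iff)

lemma homogeneous_diff: "homogeneous m p \<Longrightarrow> homogeneous m q \<Longrightarrow> homogeneous m (p - q)"
  using homogeneous_add[of m p "- q"] by simp

lemma homogeneous_sum: "(\<And>i. i \<in> S \<Longrightarrow> homogeneous m (f i)) \<Longrightarrow> homogeneous m (sum f S)"
  by (induction S rule: infinite_finite_induct) (auto intro: homogeneous_add)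

lemma homogeneous_mult:
  assumes "homogeneous m p" "homogeneous n q"
  shows "homogeneous (m + n) (p * q)"
  unfolding homogeneous_def
proof
  fix e assume "e \<in> keys (p * q)"
  then obtain a b where "a \<in> keys p" "b \<in> keys q" "e = a + b"
    using keys_mult[of p q] by blast
  then show "int (total_degree e) = m + n"
    using assms by (auto simp: homogeneous_def lookup_add sum.distrib)
qed

lemma homogeneous_const [simp]: "homogeneous 0 (const c)"
  by (simp add: homogeneous_def const_def)

lemma homogeneous_const_mult: "homogeneous m p \<Longrightarrow> homogeneous m (const c * p)"
  using homogeneous_mult[OF homogeneous_const] by force

lemma homogeneous_1 [simp]: "homogeneous 0 1"
  using homogeneous_const[of 1] by simp

lemma homogeneous_var [simp]: "homogeneous 1 (var i)"
  by (simp add: homogeneous_def var_def lookup_single when_def)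

lemma homogeneous_power: "homogeneous m p \<Longrightarrow> homogeneous (int n * m) (p ^ n)"
proof (induction n)
  case (Suc n)
  then show ?case using homogeneous_mult[of m p "int n * m" "p ^ n"] by (simp add: algebra_simps)
qed simp

lemma homogeneous_prod:
  "(\<And>i. i \<in> S \<Longrightarrow> homogeneous (m i) (f i)) \<Longrightarrow> homogeneous (sum m S) (prod f S)"
  by (induction S rule: infinite_finite_induct) (auto intro: homogeneous_mult)

lemma homogeneous_keep: "homogeneous m p \<Longrightarrow> homogeneous m (keep P p)"
  by (simp add: homogeneous_def keys_keep)

definition hcomp :: "int \<Rightarrow> 'k::field_char_0 poly3 \<Rightarrow> 'k poly3" where
  "hcomp m = keep (\<lambda>e. int (total_degree e) = m)"

lemma homogeneous_hcomp [simp]: "homogeneous m (hcomp m p)"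
  by (simp add: homogeneous_def hcomp_def keys_keep)

lemma hcomp_homogeneous: "homogeneous m p \<Longrightarrow> hcomp m p = p"
  unfolding hcomp_def by (rule keep_all) (simp add: homogeneous_def)

lemma hcomp_add: "hcomp m (p + q) = hcomp m p + hcomp m q"
  by (simp add: hcomp_def keep_add)

lemma hcomp_0 [simp]: "hcomp m 0 = 0"
  by (simp add: hcomp_homogeneous)

text \<open>A homogeneous factor shifts all degrees by the same amount, so only one component of
  \<open>p\<close> can contribute.\<close>

lemma hcomp_mult:
  assumes "homogeneous n f"
  shows "hcomp m (f * p) = f * hcomp (m - n) p"
proof -
  define r where "r = keep (\<lambda>e. int (total_degree e) \<noteq> m - n) p"
  have p: "p = hcomp (m - n) p + r"
    unfolding r_def hcomp_def by (rule keep_split)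
  have "homogeneous (n + (m - n)) (f * hcomp (m - n) p)"
    by (intro homogeneous_mult assms homogeneous_hcomp)
  then have 1: "hcomp m (f * hcomp (m - n) p) = f * hcomp (m - n) p"
    by (simp add: hcomp_homogeneous)
  have 2: "hcomp m (f * r) = 0"
    unfolding hcomp_def
  proof (rule keep_none)
    fix e assume "e \<in> keys (f * r)"
    then obtain a b where "a \<in> keys f" "b \<in> keys r" "e = a + b"
      using keys_mult[of f r] by blast
    then show "int (total_degree e) \<noteq> m"
      using assms by (auto simp: homogeneous_def lookup_add sum.distrib r_def keys_keep)
  qed
  have "hcomp m (f * p) = hcomp m (f * hcomp (m - n) p) + hcomp m (f * r)"
    by (subst p) (simp add: distrib_left hcomp_add)
  then show ?thesis by (simp add: 1 2)
qed

lemma homogeneous_cancel: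
  assumes "homogeneous n f" "f \<noteq> 0" "homogeneous m (f * p)"
  shows "homogeneous (m - n) p"
proof -
  have "f * p = f * hcomp (m - n) p"
    using assms hcomp_mult[of n f m p] by (simp add: hcomp_homogeneous)
  then show ?thesis using assms(2) by (metis homogeneous_hcomp mult_left_cancel)
qed

text \<open>Cofactors found without regard to degree become homogeneous on passing to the components
  of matching degree.\<close>

lemma homogeneous_combination:
  assumes "homogeneous m f" "homogeneous n g" "homogeneous d h" "h = f * a + g * b"
  obtains a' b' where "homogeneous (d - m) a'" "homogeneous (d - n) b'" "h = f * a' + g * b'"
proof
  show "h = f * hcomp (d - m) a + g * hcomp (d - n) b"
    using assms hcomp_homogeneous[OF assms(3)] by (simp add: hcomp_add hcomp_mult)
qed simp_all

subsection \<open>Substitution\<close>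

text \<open>The evaluation endomorphism sending x_i to \<open>y i\<close>. For suitable
  \<open>y\<close> it plays the role of reduction modulo an ideal, with values in the polynomial
  ring, which is a domain.\<close>

definition subst :: "(3 \<Rightarrow> 'k::field_char_0 poly3) \<Rightarrow> 'k poly3 \<Rightarrow> 'k poly3" where
  "subst y p = (\<Sum>e\<in>keys p. const (lookup p e) * (\<Prod>i\<in>UNIV. y i ^ lookup e i))"

lemma subst_add: "subst y (p + q) = subst y p + subst y q"
  unfolding subst_def
  by (rule setsum_keys_plus_distrib) (auto simp: const_add distrib_right)

lemma subst_single: "subst y (Poly_Mapping.single e c) = const c * (\<Prod>i\<in>UNIV. y i ^ lookup e i)"
  by (simp add: subst_def)

lemma subst_const [simp]: "subst y (const c) = const c"
  by (simp add: const_def[of c] subst_single)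

lemma subst_var_mult: "subst y (var i * p) = y i * subst y p"
proof (induction p rule: poly_mapping_induct_sum)
  case (single e c)
  have "(\<Prod>j\<in>UNIV. y j ^ lookup (Poly_Mapping.single i 1 + e) j)
      = (\<Prod>j\<in>UNIV. y j ^ (if i = j then Suc 0 else 0)) * (\<Prod>j\<in>UNIV. y j ^ lookup e j)"
    by (simp add: lookup_add power_add prod.distrib lookup_single when_def)
  also have "(\<Prod>j\<in>UNIV. y j ^ (if i = j then Suc 0 else 0)) = y i"
    by (simp add: if_distrib[of "\<lambda>n. _ ^ n"] cong: if_cong)
  finally show ?case by (simp add: var_mult_single subst_single)
qed (simp add: subst_add distrib_left)

lemma subst_mult: "subst y (p * q) = subst y p * subst y q"
proof (induction p rule: poly3_induct)
  case (const c)
  show ?case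
    by (induction q rule: poly_mapping_induct_sum)
      (simp_all add: const_def[of c] mult_single subst_single subst_add distrib_left const_mult)
qed (simp_all add: subst_add distrib_right subst_var_mult mult.assoc)

lemma subst_0 [simp]: "subst y 0 = 0"
  by (simp add: subst_def)

lemma subst_1 [simp]: "subst y 1 = 1"
  using subst_const[of y 1] by simp

lemma subst_var [simp]: "subst y (var i) = y i"
  using subst_var_mult[of y i 1] by simp

lemma subst_uminus: "subst y (- p) = - subst y p"
  using subst_add[of y p "- p"] by (simp add: add_eq_0_iff)

lemma subst_diff: "subst y (p - q) = subst y p - subst y q"
  using subst_add[of y p "- q"] by (simp add: subst_uminus)

lemma subst_sum: "subst y (sum f S) = (\<Sum>i\<in>S. subst y (f i))"
  by (induction S rule: infinite_finite_induct) (auto simp: subst_add)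

lemma subst_prod: "subst y (prod f S) = (\<Prod>i\<in>S. subst y (f i))"
  by (induction S rule: infinite_finite_induct) (auto simp: subst_mult)

text \<open>Congruence modulo an ideal is compatible with ring operations, so the variables decide.
  Two generators cover both uses: a point (\<open>l\<close> and a second form) and a line (second
  generator 0).\<close>

lemma subst_congruent:
  fixes y :: "3 \<Rightarrow> 'k::field_char_0 poly3"
  assumes "\<And>i. \<exists>a b. var i - y i = f * a + g * b"
  shows "\<exists>a b. p - subst y p = f * a + g * b"
proof (induction p rule: poly3_induct)
  case (const c)
  show ?case by (intro exI[of _ 0]) simp
next
  case (add p q)
  then obtain a b c d where "p - subst y p = f * a + g * b" "q - subst y q = f * c + g * d"
    by blast
  then show ?case
    by (intro exI[of _ "a + c"] exI[of _ "b + d"]) (simp add: subst_add algebra_simps)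
next
  case (var i p)
  then obtain a b where 1: "p - subst y p = f * a + g * b" by blast
  from assms obtain c d where 2: "var i - y i = f * c + g * d" by blast
  have "var i * p - y i * subst y p = var i * (p - subst y p) + (var i - y i) * subst y p"
    by (simp add: algebra_simps)
  also have "\<dots> = f * (var i * a + c * subst y p) + g * (var i * b + d * subst y p)"
    unfolding 1 2 by (simp add: algebra_simps)
  finally have "var i * p - subst y (var i * p)
      = f * (var i * a + c * subst y p) + g * (var i * b + d * subst y p)"
    by (simp add: subst_var_mult)
  then show ?case by blast
qed

subsection \<open>Partial derivatives\<close>

lemma partial_add: "partial i (p + q) = partial i p + partial i q"
  unfolding partial_def
  by (rule setsum_keys_plus_distrib) (auto simp: distrib_left single_add)

lemma partial_single:
  "partial i (Poly_Mapping.single e c)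
    = Poly_Mapping.single (e - Poly_Mapping.single i 1) (of_nat (lookup e i) * c)"
  by (simp add: partial_def)

lemma partial_const [simp]: "partial i (const c) = 0"
  by (simp add: const_def partial_single)

lemma partial_var_mult:
  "partial i (var j * p) = (if i = j then p else 0) + var j * partial i p"
proof (induction p rule: poly_mapping_induct_sum)
  case (single e c)
  show ?case
  \<comment> \<open>Subtraction of exponents is truncated. If x_i does not occur, the exponent is
    not lowered, but the coefficient is then zero.\<close>
  proof (cases "lookup e i = 0")
    case True
    have "Poly_Mapping.single j 1 + e - Poly_Mapping.single i 1 = e" if "i = j"
      using that by (intro poly_mapping_eqI) (simp add: lookup_add lookup_minus)
    then show ?thesis
      using True
      by (auto simp: var_mult_single partial_single lookup_add lookup_single)
  next
    case False
    then have "Poly_Mapping.single j 1 + e - Poly_Mapping.single i 1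
        = Poly_Mapping.single j 1 + (e - Poly_Mapping.single i 1)"
      by (intro poly_mapping_eqI) (auto simp: lookup_add lookup_minus lookup_single when_def)
    moreover have "Poly_Mapping.single i (1::nat) + (e - Poly_Mapping.single i 1) = e"
      using False monomial_decompose[of e i] by simp
    ultimately show ?thesis
      by (auto simp: var_mult_single partial_single lookup_add lookup_single single_add[symmetric]
          distrib_right)
  qed
qed (auto simp: partial_add distrib_left)

lemma partial_1 [simp]: "partial i 1 = 0"
  using partial_const[of i 1] by simp

lemma partial_var: "partial i (var j) = (if i = j then 1 else 0)"
  using partial_var_mult[of i j 1] by simp

lemma partial_0 [simp]: "partial i 0 = 0"
  by (simp add: partial_def)

lemma partial_const_mult: "partial i (const c * p) = const c * partial i p"
proof (induction p rule: poly_mapping_induct_sum)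
  case (single e a)
  show ?case by (simp add: const_def mult_single partial_single ac_simps)
qed (simp add: partial_add distrib_left)

lemma partial_mult: "partial i (p * q) = partial i p * q + p * partial i q"
  by (induction p rule: poly3_induct)
    (auto simp: partial_add partial_const_mult partial_var_mult distrib_left distrib_right
      mult.assoc add_ac)

lemma partial_sum: "partial i (sum f S) = (\<Sum>j\<in>S. partial i (f j))"
  by (induction S rule: infinite_finite_induct) (auto simp: partial_add)

lemma homogeneous_partial:
  assumes "homogeneous m p"
  shows "homogeneous (m - 1) (partial i p)"
  unfolding partial_def
proof (rule homogeneous_sum)
  fix e assume e: "e \<in> keys p"
  have "int (total_degree (e - Poly_Mapping.single i 1)) = m - 1" if "lookup e i > 0"
  proof -
    have "total_degree e
        = total_degree (Poly_Mapping.single i 1) + total_degree (e - Poly_Mapping.single i 1)"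
      by (subst monomial_decompose[OF that]) (simp add: lookup_add sum.distrib)
    moreover have "total_degree (Poly_Mapping.single i 1) = 1"
      by (simp add: lookup_single when_def)
    moreover have "int (total_degree e) = m"
      using assms e by (simp add: homogeneous_def del: of_nat_sum)
    ultimately show ?thesis by linarith
  qed
  then show "homogeneous (m - 1)
      (Poly_Mapping.single (e - Poly_Mapping.single i 1) (of_nat (lookup e i) * lookup p e))"
    by (cases "lookup e i = 0") (auto simp: homogeneous_def)
qed

lemma euler_identity:
  fixes p :: "'k::field_char_0 poly3"
  assumes "homogeneous (int d) p"
  shows "(\<Sum>i\<in>UNIV. var i * partial i p) = of_nat d * p"
proof -
  have single: "(\<Sum>i\<in>UNIV. var i * partial i (Poly_Mapping.single e c))
      = Poly_Mapping.single e (of_nat (total_degree e) * c)" for e and c :: 'k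
  proof -
    have "var i * partial i (Poly_Mapping.single e c)
        = Poly_Mapping.single e (of_nat (lookup e i) * c)" for i
    proof (cases "lookup e i = 0")
      case False
      then have "Poly_Mapping.single i (1::nat) + (e - Poly_Mapping.single i 1) = e"
        using monomial_decompose[of e i] by simp
      then show ?thesis by (simp add: partial_single var_mult_single)
    qed (simp add: partial_single)
    then show ?thesis by (simp add: sum_three single_add[symmetric] distrib_right)
  qed
  have "lookup (\<Sum>i\<in>UNIV. var i * partial i q) e = of_nat (total_degree e) * lookup q e"
    for q :: "'k poly3" and e
    by (induction q rule: poly_mapping_induct_sum)
      (simp_all add: single partial_add distrib_left sum.distrib lookup_add
        lookup_single when_def)
  moreover have "lookup (of_nat d * p) e = of_nat d * lookup p e" for e
    by (induction d) (simp_all add: distrib_right lookup_add)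
  moreover have "of_nat (total_degree e) * lookup p e = of_nat d * lookup p e" for e
    using assms by (cases "e \<in> keys p") (auto simp: homogeneous_def in_keys_iff simp del: of_nat_sum)
  ultimately show ?thesis by (intro poly_mapping_eqI) simp
qed

section \<open>Sections over the basic open sets\<close>

lemma homogeneous_cong: "homogeneous m p \<Longrightarrow> m = n \<Longrightarrow> homogeneous n p"
  by simp

lemma to_fract_power: "to_fract (p ^ n) = to_fract p ^ n"
  by (induction n) simp_all

definition embv :: "'a::idom ^ 'r \<Rightarrow> 'a fract ^ 'r" where
  "embv g = (\<chi> j. to_fract (g $ j))"

lemma embv_nth [simp]: "embv g $ j = to_fract (g $ j)"
  by (simp add: embv_def)

lemma embv_add: "embv (f + g) = embv f + embv g"
  by (simp add: vec_eq_iff)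

lemma embv_diff: "embv (f - g) = embv f - embv g"
  by (simp add: vec_eq_iff)

lemma embv_smult: "embv (p *s f) = to_fract p *s embv f"
  by (simp add: vec_eq_iff)

lemma embv_0 [simp]: "embv 0 = 0"
  by (simp add: vec_eq_iff)

lemma card_three_le: "card (S :: 3 set) \<le> 3"
  using card_mono[OF finite subset_UNIV, of S] by simp

definition denom :: "3 set \<Rightarrow> 'k::field_char_0 poly3" where
  "denom S = (\<Prod>i\<in>S. var i)"

lemma denom_neq_0 [simp]: "denom S \<noteq> 0"
  by (simp add: denom_def)

lemma homogeneous_denom_power: "homogeneous (int (N * card S)) (denom S ^ N)"
proof -
  have "homogeneous (\<Sum>i\<in>S. 1) (denom S)"
    unfolding denom_def by (rule homogeneous_prod) simp
  from homogeneous_power[OF this, of N] show ?thesis by simp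
qed

lemma denom_subset: "S \<subseteq> S' \<Longrightarrow> denom S' = denom S * denom (S' - S)"
  unfolding denom_def by (subst mult.commute) (rule prod.subset_diff, simp_all)

definition submodule :: "('k::field_char_0 poly3 ^ 'r) set \<Rightarrow> bool" where
  "submodule M \<longleftrightarrow> 0 \<in> M \<and> (\<forall>f\<in>M. \<forall>g\<in>M. f + g \<in> M) \<and> (\<forall>p. \<forall>f\<in>M. p *s f \<in> M)"

lemma submodule_0: "submodule M \<Longrightarrow> 0 \<in> M"
  and submodule_add: "submodule M \<Longrightarrow> f \<in> M \<Longrightarrow> g \<in> M \<Longrightarrow> f + g \<in> M"
  and submodule_smult: "submodule M \<Longrightarrow> f \<in> M \<Longrightarrow> p *s f \<in> M"
  by (simp_all add: submodule_def)

lemma submodule_UNIV [simp]: "submodule UNIV"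
  by (simp add: submodule_def)

definition homogeneous_vec :: "int \<Rightarrow> 'k::field_char_0 poly3 ^ 'r \<Rightarrow> bool" where
  "homogeneous_vec m g \<longleftrightarrow> (\<forall>j. homogeneous m (g $ j))"

lemma homogeneous_vec_add:
  "homogeneous_vec m f \<Longrightarrow> homogeneous_vec m g \<Longrightarrow> homogeneous_vec m (f + g)"
  by (simp add: homogeneous_vec_def homogeneous_add)

lemma homogeneous_vec_smult:
  "homogeneous n p \<Longrightarrow> homogeneous_vec m g \<Longrightarrow> m + n = k \<Longrightarrow> homogeneous_vec k (p *s g)"
  unfolding homogeneous_vec_def using homogeneous_mult[of n p m] by (auto simp: add.commute)

lemma homogeneous_vec_0 [simp]: "homogeneous_vec m 0"
  by (simp add: homogeneous_vec_def)

text \<open>With the denominator cleared, membership is an equation between vectors over the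
  fraction field, to which linear maps can be applied.\<close>

lemma twisted_sections_iff:
  "v \<in> twisted_sections M m S \<longleftrightarrow>
    (\<exists>g N. g \<in> M \<and> homogeneous_vec (m + int (N * card S)) g
      \<and> to_fract (denom S ^ N) *s v = embv g)"
proof -
  have "v = (\<chi> j. Fract (g $ j) ((\<Prod>i\<in>S. var i) ^ N))
      \<longleftrightarrow> to_fract (denom S ^ N) *s v = embv g" for g :: "'a poly3 ^ 'b" and N
  proof -
    have h: "Fraction_Field.Fract (g $ j) (denom S ^ N) = to_fract (g $ j) / to_fract (denom S ^ N)" for j
      by (simp add: to_fract_def)
    show ?thesis
      by (simp add: vec_eq_iff denom_def[symmetric] h nonzero_eq_divide_eq ac_simps)
  qed
  then show ?thesis
    unfolding twisted_sections_def homogeneous_vec_def by blast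
qed

lemma twisted_sectionsI:
  "g \<in> M \<Longrightarrow> homogeneous_vec (m + int (N * card S)) g \<Longrightarrow> to_fract (denom S ^ N) *s v = embv g
    \<Longrightarrow> v \<in> twisted_sections M m S"
  by (auto simp: twisted_sections_iff)

text \<open>All large exponents are admissible, so finitely many sections can be brought to a common
  denominator.\<close>

lemma twisted_sections_raise:
  assumes "submodule M" "v \<in> twisted_sections M m S"
  obtains N where "\<And>n. n \<ge> N \<Longrightarrow> \<exists>g\<in>M. homogeneous_vec (m + int (n * card S)) g
      \<and> to_fract (denom S ^ n) *s v = embv g"
proof -
  obtain g N where g: "g \<in> M" "homogeneous_vec (m + int (N * card S)) g"
      "to_fract (denom S ^ N) *s v = embv g"
    using assms(2) unfolding twisted_sections_iff by blast
  show ?thesis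
  proof (rule that[of N])
    fix n assume n: "n \<ge> N"
    let ?p = "denom S ^ (n - N) :: 'a poly3"
    have "denom S ^ n = ?p * denom S ^ N"
      using n by (simp add: power_add[symmetric])
    then have "to_fract (denom S ^ n) *s v = to_fract ?p *s (to_fract (denom S ^ N) *s v)"
      by (simp only: to_fract_mult vector_smult_assoc)
    also have "\<dots> = embv (?p *s g)"
      by (simp add: g(3) embv_smult)
    finally have "to_fract (denom S ^ n) *s v = embv (?p *s g)" .
    moreover have "homogeneous_vec (m + int (n * card S)) (?p *s g)"
      by (rule homogeneous_vec_smult[OF homogeneous_denom_power g(2)])
        (use n in \<open>simp add: algebra_simps of_nat_diff\<close>)
    ultimately show "\<exists>g\<in>M. homogeneous_vec (m + int (n * card S)) g
      \<and> to_fract (denom S ^ n) *s v = embv g"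
      using submodule_smult[OF assms(1) g(1)] by blast
  qed
qed

lemma twisted_sections_0:
  "submodule M \<Longrightarrow> 0 \<in> twisted_sections M m S"
  by (rule twisted_sectionsI[of 0 _ _ 0]) (auto simp: submodule_0)

lemma twisted_sections_add:
  assumes "submodule M" "v \<in> twisted_sections M m S" "w \<in> twisted_sections M m S"
  shows "v + w \<in> twisted_sections M m S"
proof -
  obtain N1 where 1: "\<And>n. n \<ge> N1 \<Longrightarrow> \<exists>g\<in>M. homogeneous_vec (m + int (n * card S)) g
      \<and> to_fract (denom S ^ n) *s v = embv g"
    using twisted_sections_raise[OF assms(1,2)] by blast
  obtain N2 where 2: "\<And>n. n \<ge> N2 \<Longrightarrow> \<exists>g\<in>M. homogeneous_vec (m + int (n * card S)) g
      \<and> to_fract (denom S ^ n) *s w = embv g"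
    using twisted_sections_raise[OF assms(1,3)] by blast
  define n where "n = max N1 N2"
  obtain g where g: "g \<in> M" "homogeneous_vec (m + int (n * card S)) g"
      "to_fract (denom S ^ n) *s v = embv g"
    using 1[of n] by (auto simp: n_def)
  obtain h where h: "h \<in> M" "homogeneous_vec (m + int (n * card S)) h"
      "to_fract (denom S ^ n) *s w = embv h"
    using 2[of n] by (auto simp: n_def)
  show ?thesis
    by (rule twisted_sectionsI[of "g + h" _ _ n])
      (simp_all add: g h submodule_add[OF assms(1)] homogeneous_vec_add embv_add vector_add_ldistrib
        del: of_nat_mult)
qed

lemma twisted_sections_sum:
  assumes "submodule M" "\<And>i. i \<in> I \<Longrightarrow> f i \<in> twisted_sections M m S"
  shows "sum f I \<in> twisted_sections M m S"
  using assms(2)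
  by (induction I rule: infinite_finite_induct)
    (auto intro: twisted_sections_0 twisted_sections_add assms(1))

text \<open>Localization of a graded map of degree k: \<open>F\<close> commutes with division by
  monomials, so it is enough to know it on homogeneous elements of \<open>M\<close>.\<close>

lemma twisted_sections_map:
  assumes "v \<in> twisted_sections M m S"
    and map: "\<And>g n. g \<in> M \<Longrightarrow> homogeneous_vec n g \<Longrightarrow>
      \<exists>g'\<in>M'. homogeneous_vec (n + k) g' \<and> F (embv g) = embv g'"
    and linear: "\<And>c. F (c *s v) = c *s F v"
  shows "F v \<in> twisted_sections M' (m + k) S"
proof -
  obtain g N where g: "g \<in> M" "homogeneous_vec (m + int (N * card S)) g"
      "to_fract (denom S ^ N) *s v = embv g"
    using assms(1) unfolding twisted_sections_iff by blast
  from map[OF g(1,2)] obtain g' where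
    g': "g' \<in> M'" "homogeneous_vec (m + int (N * card S) + k) g'" "F (embv g) = embv g'"
    by blast
  show ?thesis
  proof (rule twisted_sectionsI[OF g'(1)])
    show "homogeneous_vec (m + k + int (N * card S)) g'"
      using g'(2) by (simp add: algebra_simps)
    show "to_fract (denom S ^ N) *s F v = embv g'"
      by (metis g(3) g'(3) linear)
  qed
qed

lemma twisted_sections_smult:
  assumes "submodule M" "v \<in> twisted_sections M m S" "homogeneous n p"
  shows "to_fract p *s v \<in> twisted_sections M (m + n) S"
proof (rule twisted_sections_map[OF assms(2)])
  fix g k assume "g \<in> M" "homogeneous_vec k g"
  then show "\<exists>g'\<in>M. homogeneous_vec (k + n) g' \<and> to_fract p *s embv g = embv g'"
    using submodule_smult[OF assms(1)] homogeneous_vec_smult[OF assms(3) _ refl]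
    by (intro bexI[of _ "p *s g"]) (auto simp: embv_smult)
qed (simp add: vector_smult_assoc mult.commute)

lemma twisted_sections_uminus:
  assumes "submodule M" "v \<in> twisted_sections M m S"
  shows "- v \<in> twisted_sections M m S"
  using twisted_sections_smult[OF assms, of 0 "- 1"] by simp

lemma twisted_sections_diff:
  assumes "submodule M" "v \<in> twisted_sections M m S" "w \<in> twisted_sections M m S"
  shows "v - w \<in> twisted_sections M m S"
  using twisted_sections_add[OF assms(1,2) twisted_sections_uminus[OF assms(1,3)]] by simp

lemma twisted_sections_const_smult:
  assumes "submodule M" "v \<in> twisted_sections M m S"
  shows "to_fract (const c) *s v \<in> twisted_sections M m S"
  using twisted_sections_smult[OF assms, of 0 "const c"] by simp

lemma twisted_sections_var_smult:
  assumes "submodule M" "v \<in> twisted_sections M m S"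
  shows "to_fract (var i) *s v \<in> twisted_sections M (m + 1) S"
  using twisted_sections_smult[OF assms, of 1 "var i"] by simp

lemma twisted_sections_mono:
  assumes "submodule M" "S \<subseteq> S'"
  shows "twisted_sections M m S \<subseteq> twisted_sections M m S'"
proof
  fix v assume "v \<in> twisted_sections M m S"
  then obtain g N where g: "g \<in> M" "homogeneous_vec (m + int (N * card S)) g"
      "to_fract (denom S ^ N) *s v = embv g"
    unfolding twisted_sections_iff by blast
  let ?p = "denom (S' - S) ^ N :: 'a poly3"
  have "denom S' ^ N = ?p * denom S ^ N"
    by (simp add: denom_subset[OF assms(2)] power_mult_distrib mult.commute)
  then have "to_fract (denom S' ^ N) *s v = to_fract ?p *s (to_fract (denom S ^ N) *s v)"
    by (simp only: to_fract_mult vector_smult_assoc)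
  also have "\<dots> = embv (?p *s g)"
    by (simp add: g(3) embv_smult)
  finally have 1: "to_fract (denom S' ^ N) *s v = embv (?p *s g)" .
  have "card S' = card S + card (S' - S)"
    using assms(2) by (metis card_Diff_subset card_mono finite le_add_diff_inverse)
  then have "homogeneous_vec (m + int (N * card S')) (?p *s g)"
    by (intro homogeneous_vec_smult[OF homogeneous_denom_power g(2)]) (simp add: algebra_simps)
  with 1 show "v \<in> twisted_sections M m S'"
    using submodule_smult[OF assms(1) g(1)] twisted_sectionsI by blast
qed

text \<open>Where x_i does not vanish it is a unit: 1 / x_i is the product of the other variables of
  \<open>S\<close> over \<open>denom S\<close>, at the cost of one more power of the
  denominator.\<close>

lemma twisted_sections_divide_var:
  assumes "submodule M" "v \<in> twisted_sections M m S" "i \<in> S"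
  shows "inverse (to_fract (var i)) *s v \<in> twisted_sections M (m - 1) S"
proof -
  obtain g N where g: "g \<in> M" "homogeneous_vec (m + int (N * card S)) g"
      "to_fract (denom S ^ N) *s v = embv g"
    using assms(2) unfolding twisted_sections_iff by blast
  let ?p = "denom (S - {i}) :: 'a poly3"
  have d: "denom S = var i * ?p"
    using assms(3) denom_subset[of "{i}" S] by (simp add: denom_def)
  have "to_fract (denom S ^ Suc N) *s (inverse (to_fract (var i)) *s v)
      = to_fract ?p *s (to_fract (denom S ^ N) *s v)"
    using to_fract_eq_0_iff[of "var i"]
    by (simp only: vector_smult_assoc power_Suc to_fract_mult)
      (simp add: d vec_eq_iff to_fract_power)
  also have "\<dots> = embv (?p *s g)"
    by (simp add: g(3) embv_smult)
  finally have 1: "to_fract (denom S ^ Suc N) *s (inverse (to_fract (var i)) *s v)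
      = embv (?p *s g)" .
  have "card S = Suc (card (S - {i}))"
    using assms(3) by (metis card.remove finite)
  then have "homogeneous_vec (m - 1 + int (Suc N * card S)) (?p *s g)"
    using homogeneous_denom_power[of 1 "S - {i}"]
    by (intro homogeneous_vec_smult[OF _ g(2)]) (auto simp: algebra_simps)
  with 1 show ?thesis
    using submodule_smult[OF assms(1) g(1)] twisted_sectionsI by blast
qed

section \<open>Cech cohomology in coordinates\<close>

lemma subsets_three:
  fixes S :: "3 set"
  obtains "S = {}" | "S = {0}" | "S = {1}" | "S = {2}" | "S = {0,1}" | "S = {0,2}" | "S = {1,2}"
    | "S = {0,1,2}"
proof -
  have "S \<in> Pow {0,1,2}" using UNIV_three by auto
  then show ?thesis using that by (simp add: Pow_insert) blast
qed

lemma triple_neq [simp]: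
  "{0,1,2::3} \<noteq> {0,1}" "{0,1,2::3} \<noteq> {0,2}" "{0,1,2::3} \<noteq> {1,2}" "{0,1::3} \<noteq> {0,2}"
  "{0,1::3} \<noteq> {1,2}" "{0,2::3} \<noteq> {1,2}" "{0,2::3} \<noteq> {0,1}" "{1,2::3} \<noteq> {0,1}"
  "{1,2::3} \<noteq> {0,2}" "{i} \<noteq> {0,1,2::3}" "{i} \<noteq> {0,1::3}" "{i} \<noteq> {0,2::3}" "{i} \<noteq> {1,2::3}"
  by (auto simp: set_eq_iff all_three)

text \<open>The order of the index type fixes the Cech signs; it is that of the representatives 0,
  1, 2.\<close>

lemma less_three [simp]:
  "(0::3) < 1" "(0::3) < 2" "(1::3) < 2"
  "\<not> (1::3) < 0" "\<not> (2::3) < 0" "\<not> (2::3) < 1"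
  by (simp_all add: less_bit1_def bit1.Rep_0 bit1.Rep_1 bit1.Rep_numeral)

lemma cech_differential_simps:
  "cech_differential c {} = 0"
  "cech_differential c {i} = c {}"
  "cech_differential c {0,1} = c {1} - c {0}"
  "cech_differential c {0,2} = c {2} - c {0}"
  "cech_differential c {1,2} = c {2} - c {1}"
  "cech_differential c {0,1,2} = c {1,2} - c {0,2} + c {0,1}"
proof -
  have s: "{j. j = i \<and> j < i} = {}" "{j. (j = 0 \<or> j = 1) \<and> j < (0::3)} = {}"
    "{j. (j = 0 \<or> j = 1) \<and> j < (1::3)} = {0}" "{j. (j = 0 \<or> j = 2) \<and> j < (0::3)} = {}"
    "{j. (j = 0 \<or> j = 2) \<and> j < (2::3)} = {0}" "{j. (j = 1 \<or> j = 2) \<and> j < (1::3)} = {}"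
    "{j. (j = 1 \<or> j = 2) \<and> j < (2::3)} = {1}"
    "{j. (j = 0 \<or> j = 1 \<or> j = 2) \<and> j < (0::3)} = {}"
    "{j. (j = 0 \<or> j = 1 \<or> j = 2) \<and> j < (1::3)} = {0}"
    "{j. (j = 0 \<or> j = 1 \<or> j = 2) \<and> j < (2::3)} = {0,1}" for i :: 3
    by auto
  have d: "{0,1::3} - {0} = {1}" "{0,1::3} - {1} = {0}" "{0,2::3} - {0} = {2}" "{0,2::3} - {2} = {0}"
    "{1,2::3} - {1} = {2}" "{1,2::3} - {2} = {1}" "{0,1,2::3} - {0} = {1,2}"
    "{0,1,2::3} - {1} = {0,2}" "{0,1,2::3} - {2} = {0,1}"
    by auto
  show "cech_differential c {} = 0" "cech_differential c {i} = c {}"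
    by (simp_all add: cech_differential_def s)
  show "cech_differential c {0,1} = c {1} - c {0}"
    by (simp add: cech_differential_def s d vector_smult_lneg)
  show "cech_differential c {0,2} = c {2} - c {0}"
    by (simp add: cech_differential_def s d vector_smult_lneg)
  show "cech_differential c {1,2} = c {2} - c {1}"
    by (simp add: cech_differential_def s d vector_smult_lneg)
  show "cech_differential c {0,1,2} = c {1,2} - c {0,2} + c {0,1}"
    by (simp add: cech_differential_def s d vector_smult_lneg)
qed

text \<open>Here a, b, c are the values of a 1-cochain on \<open>{0,1}\<close>,
  \<open>{0,2}\<close>, \<open>{1,2}\<close>. Its differential on \<open>{0,1,2}\<close> is c - b +
  a, whence the cocycle condition a + c = b.\<close>

definition H1_vanishes :: "('k::field_char_0 poly3 ^ 'r) set \<Rightarrow> int \<Rightarrow> bool" where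
  "H1_vanishes M m \<longleftrightarrow>
    (\<forall>a\<in>twisted_sections M m {0,1}. \<forall>b\<in>twisted_sections M m {0,2}.
     \<forall>c\<in>twisted_sections M m {1,2}. a + c = b \<longrightarrow>
      (\<exists>u\<in>twisted_sections M m {0}. \<exists>v\<in>twisted_sections M m {1}. \<exists>w\<in>twisted_sections M m {2}.
        a = v - u \<and> b = w - u \<and> c = w - v))"

text \<open>Over three charts every 2-cochain is a cocycle. The sign of the middle term is dropped,
  since sections of a submodule are closed under negation.\<close>

definition H2_vanishes :: "('k::field_char_0 poly3 ^ 'r) set \<Rightarrow> int \<Rightarrow> bool" where
  "H2_vanishes M m \<longleftrightarrow>
    (\<forall>v\<in>twisted_sections M m {0,1,2}. \<exists>a\<in>twisted_sections M m {0,1}.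
      \<exists>b\<in>twisted_sections M m {0,2}. \<exists>c\<in>twisted_sections M m {1,2}. v = a + b + c)"

lemma cech_differential_square: "cech_differential (cech_differential c) S = 0" if "c {} = 0"
  by (cases S rule: subsets_three) (simp_all add: cech_differential_simps that)

lemma cech_differential_cochain:
  assumes M: "submodule M" and c: "c \<in> cech_cochains M m p"
  shows "cech_differential c \<in> cech_cochains M m (Suc p)"
proof -
  have "if card S = Suc p + 1 then cech_differential c S \<in> twisted_sections M m S
    else cech_differential c S = 0" for S
  proof (cases "card S = Suc p + 1")
    case True
    have "cech_differential c S \<in> twisted_sections M m S"
      unfolding cech_differential_def
    proof (rule twisted_sections_sum[OF M])
      fix i assume i: "i \<in> S"
      then have "card (S - {i}) = p + 1" using True by simp
      then have "c (S - {i}) \<in> twisted_sections M m (S - {i})"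
        using c unfolding cech_cochains_def by (auto dest: spec[of _ "S - {i}"])
      then have 1: "c (S - {i}) \<in> twisted_sections M m S"
        using twisted_sections_mono[OF M, of "S - {i}" S] by blast
      show "(- 1) ^ card {j \<in> S. j < i} *s c (S - {i}) \<in> twisted_sections M m S"
        using twisted_sections_uminus[OF M 1] 1
        by (cases "even (card {j \<in> S. j < i})") (simp_all add: vector_smult_lneg)
    qed
    then show ?thesis using True by simp
  next
    case False
    have "c (S - {i}) = 0" if "i \<in> S" for i
    proof -
      have "card (S - {i}) \<noteq> p + 1" using False that by (metis Suc_eq_plus1 card.remove finite)
      then show ?thesis using c unfolding cech_cochains_def by (auto dest: spec[of _ "S - {i}"])
    qed
    then show ?thesis using False by (simp add: cech_differential_def)
  qed
  then show ?thesis unfolding cech_cochains_def by blast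
qed

lemma cech_coboundaries_subset:
  assumes M: "submodule M"
  shows "cech_coboundaries M m (Suc p) \<subseteq> cech_cocycles M m (Suc p)"
proof
  fix d assume "d \<in> cech_coboundaries M m (Suc p)"
  then obtain c where c: "c \<in> cech_cochains M m p" "d = cech_differential c"
    by (auto simp: cech_coboundaries_def)
  have "c {} = 0" using c(1) by (auto simp: cech_cochains_def dest: spec[of _ "{}"])
  then show "d \<in> cech_cocycles M m (Suc p)"
    using cech_differential_cochain[OF M c(1)] cech_differential_square[of c]
    by (simp add: cech_cocycles_def c(2))
qed

lemma cohomology_vanishes_1_iff:
  assumes M: "submodule M"
  shows "cohomology_vanishes M m 1 \<longleftrightarrow> H1_vanishes M m"
proof
  assume van: "cohomology_vanishes M m 1"
  show "H1_vanishes M m"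
    unfolding H1_vanishes_def
  proof (intro ballI impI)
    fix a b c assume abc: "a \<in> twisted_sections M m {0,1}" "b \<in> twisted_sections M m {0,2}"
      "c \<in> twisted_sections M m {1,2}" and eq: "a + c = b"
    define z where "z = (\<lambda>S. if S = {0,1::3} then a else if S = {0,2} then b
      else if S = {1,2} then c else 0)"
    have z: "z {0,1} = a" "z {0,2} = b" "z {1,2} = c" "z {} = 0" "z {i} = 0" "z {0,1,2} = 0" for i
      by (auto simp: z_def)
    have "z \<in> cech_cochains M m 1"
      unfolding cech_cochains_def
    proof (intro CollectI allI)
      fix S show "if card S = 1 + 1 then z S \<in> twisted_sections M m S else z S = 0"
        by (cases S rule: subsets_three) (simp_all add: z abc)
    qed
    moreover have "cech_differential z S = 0" for S
      using eq by (cases S rule: subsets_three) (auto simp: cech_differential_simps z)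
    ultimately have "z \<in> cech_cocycles M m 1"
      by (simp add: cech_cocycles_def)
    then obtain y where y: "y \<in> cech_cochains M m 0" "z = cech_differential y"
      using van by (auto simp: cohomology_vanishes_def cech_coboundaries_def)
    have "y {i} \<in> twisted_sections M m {i}" for i
      using y(1) by (auto simp: cech_cochains_def dest: spec[of _ "{i}"])
    moreover have "a = y {1} - y {0}" "b = y {2} - y {0}" "c = y {2} - y {1}"
      using z(1-3) by (simp_all add: y(2) cech_differential_simps)
    ultimately show "\<exists>u\<in>twisted_sections M m {0}. \<exists>v\<in>twisted_sections M m {1}.
        \<exists>w\<in>twisted_sections M m {2}. a = v - u \<and> b = w - u \<and> c = w - v"
      by blast
  qed
next
  assume van: "H1_vanishes M m"
  have "z \<in> cech_coboundaries M m 1" if "z \<in> cech_cocycles M m 1" for z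
  proof -
    have z: "if card S = 2 then z S \<in> twisted_sections M m S else z S = 0" for S
      using that by (auto simp: cech_cocycles_def cech_cochains_def)
    have "cech_differential z {0,1,2} = 0"
      using that by (simp add: cech_cocycles_def)
    then have "z {0,1} + z {1,2} = z {0,2}"
      by (simp add: cech_differential_simps algebra_simps)
    moreover have "z {0,1} \<in> twisted_sections M m {0,1}" "z {0,2} \<in> twisted_sections M m {0,2}"
      "z {1,2} \<in> twisted_sections M m {1,2}"
      using z[of "{0,1}"] z[of "{0,2}"] z[of "{1,2}"] by simp_all
    ultimately obtain u v w where uvw: "u \<in> twisted_sections M m {0}" "v \<in> twisted_sections M m {1}"
      "w \<in> twisted_sections M m {2}" "z {0,1} = v - u" "z {0,2} = w - u" "z {1,2} = w - v"
      using van unfolding H1_vanishes_def by meson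
    define y where "y = (\<lambda>S. if S = {0::3} then u else if S = {1} then v
      else if S = {2} then w else 0)"
    have y: "y {0} = u" "y {1} = v" "y {2} = w" "y {} = 0" "y {0,1} = 0" "y {0,2} = 0"
      "y {1,2} = 0" "y {0,1,2} = 0"
      by (auto simp: y_def)
    have "y \<in> cech_cochains M m 0"
      unfolding cech_cochains_def
    proof (intro CollectI allI)
      fix S show "if card S = 0 + 1 then y S \<in> twisted_sections M m S else y S = 0"
        by (cases S rule: subsets_three) (simp_all add: y uvw)
    qed
    moreover have "cech_differential y = z"
    proof
      fix S show "cech_differential y S = z S"
        using z[of S]
        by (cases S rule: subsets_three) (simp_all add: cech_differential_simps y uvw)
    qed
    ultimately show ?thesis by (auto simp: cech_coboundaries_def)
  qed
  then show "cohomology_vanishes M m 1"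
    using cech_coboundaries_subset[OF M, of m 0] by (auto simp: cohomology_vanishes_def)
qed

lemma cohomology_vanishes_2_iff:
  assumes M: "submodule M"
  shows "cohomology_vanishes M m 2 \<longleftrightarrow> H2_vanishes M m"
proof
  assume van: "cohomology_vanishes M m 2"
  show "H2_vanishes M m"
    unfolding H2_vanishes_def
  proof
    fix v assume v: "v \<in> twisted_sections M m {0,1,2}"
    define z where "z = (\<lambda>S. if S = {0,1,2::3} then v else 0)"
    have z: "z {0,1,2} = v" "z {0,1} = 0" "z {0,2} = 0" "z {1,2} = 0" "z {} = 0" "z {i} = 0" for i
      by (auto simp: z_def dest: triple_neq[THEN notE, OF sym])
    have "z \<in> cech_cochains M m 2"
      unfolding cech_cochains_def
    proof (intro CollectI allI)
      fix S show "if card S = 2 + 1 then z S \<in> twisted_sections M m S else z S = 0"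
        by (cases S rule: subsets_three) (simp_all add: z v)
    qed
    moreover have "cech_differential z S = 0" for S
      by (cases S rule: subsets_three) (auto simp: cech_differential_simps z)
    ultimately have "z \<in> cech_cocycles M m 2"
      by (simp add: cech_cocycles_def)
    then obtain y where y: "y \<in> cech_cochains M m 1" "z = cech_differential y"
      using van by (auto simp: cohomology_vanishes_def cech_coboundaries_def)
    have "y S \<in> twisted_sections M m S" if "card S = 2" for S
      using y(1) that by (auto simp: cech_cochains_def dest: spec[of _ S])
    then have "y {0,1} \<in> twisted_sections M m {0,1}" "- y {0,2} \<in> twisted_sections M m {0,2}"
      "y {1,2} \<in> twisted_sections M m {1,2}"
      by (auto intro: twisted_sections_uminus[OF M])
    moreover have yv: "y {1,2} - y {0,2} + y {0,1} = v"
      using z(1) by (simp add: y(2) cech_differential_simps)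
    have "v = y {0,1} + - y {0,2} + y {1,2}"
      by (simp add: algebra_simps yv[symmetric])
    ultimately show "\<exists>a\<in>twisted_sections M m {0,1}.
      \<exists>b\<in>twisted_sections M m {0,2}. \<exists>c\<in>twisted_sections M m {1,2}. v = a + b + c"
      by blast
  qed
next
  assume van: "H2_vanishes M m"
  have "z \<in> cech_coboundaries M m 2" if "z \<in> cech_cocycles M m 2" for z
  proof -
    have z: "if card S = 3 then z S \<in> twisted_sections M m S else z S = 0" for S
      using that by (auto simp: cech_cocycles_def cech_cochains_def)
    have "z {0,1,2} \<in> twisted_sections M m {0,1,2}"
      using z[of "{0,1,2}"] by simp
    then obtain a b c where abc: "a \<in> twisted_sections M m {0,1}"
      "b \<in> twisted_sections M m {0,2}" "c \<in> twisted_sections M m {1,2}" "z {0,1,2} = a + b + c"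
      using van unfolding H2_vanishes_def by meson
    have b: "- b \<in> twisted_sections M m {0,2}"
      by (rule twisted_sections_uminus[OF M abc(2)])
    define y where "y = (\<lambda>S. if S = {0,1::3} then a else if S = {0,2} then - b
      else if S = {1,2} then c else 0)"
    have y: "y {0,1} = a" "y {0,2} = - b" "y {1,2} = c" "y {} = 0" "y {i} = 0" "y {0,1,2} = 0" for i
      by (auto simp: y_def)
    have "y \<in> cech_cochains M m 1"
      unfolding cech_cochains_def
    proof (intro CollectI allI)
      fix S show "if card S = 1 + 1 then y S \<in> twisted_sections M m S else y S = 0"
        by (cases S rule: subsets_three) (simp_all add: y abc b)
    qed
    moreover have "cech_differential y = z"
    proof
      fix S show "cech_differential y S = z S"
        using z[of S]
        by (cases S rule: subsets_three) (simp_all add: cech_differential_simps y abc)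
    qed
    ultimately show ?thesis by (auto simp: cech_coboundaries_def)
  qed
  then show "cohomology_vanishes M m 2"
    using cech_coboundaries_subset[OF M, of m 1]
    by (auto simp: cohomology_vanishes_def numeral_2_eq_2)
qed

text \<open>Three charts provide no index set with four or more elements.\<close>

lemma cohomology_vanishes_ge_3:
  assumes M: "submodule M" and "p \<ge> 3"
  shows "cohomology_vanishes M m p"
proof -
  have "cech_cocycles M m p \<subseteq> {\<lambda>S. 0}"
  proof
    fix c assume "c \<in> cech_cocycles M m p"
    moreover have "card S \<noteq> p + 1" for S :: "3 set"
      using card_three_le[of S] assms(2) by linarith
    ultimately show "c \<in> {\<lambda>S. 0}"
      by (auto simp: cech_cocycles_def cech_cochains_def)
  qed
  moreover have "(\<lambda>S. 0) \<in> cech_coboundaries M m p"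
  proof -
    have 1: "(\<lambda>S. 0) \<in> cech_cochains M m (p - 1)"
      using twisted_sections_0[OF M] by (simp add: cech_cochains_def)
    have "cech_differential (\<lambda>S. 0) = (\<lambda>S. 0)"
      by (simp add: cech_differential_def fun_eq_iff)
    from image_eqI[where f = cech_differential and x = "\<lambda>S. 0", OF this[symmetric] 1] show ?thesis
      using assms(2) by (simp add: cech_coboundaries_def)
  qed
  moreover have "cech_coboundaries M m p \<subseteq> cech_cocycles M m p"
    using cech_coboundaries_subset[OF M, of m "p - 1"] assms(2) by simp
  ultimately show ?thesis
    unfolding cohomology_vanishes_def by blast
qed

lemma regular_sheaf_iff:
  assumes M: "submodule M"
  shows "regular_sheaf M m \<longleftrightarrow> H1_vanishes M (m - 1) \<and> H2_vanishes M (m - 2)"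
proof -
  have "regular_sheaf M m
      \<longleftrightarrow> cohomology_vanishes M (m - 1) 1 \<and> cohomology_vanishes M (m - 2) 2"
  proof
    assume "regular_sheaf M m"
    then have "cohomology_vanishes M (m - int i) i" if "i \<ge> 1" for i
      using that by (simp add: regular_sheaf_def)
    from this[of 1] this[of 2]
    show "cohomology_vanishes M (m - 1) 1 \<and> cohomology_vanishes M (m - 2) 2" by simp
  next
    assume van: "cohomology_vanishes M (m - 1) 1 \<and> cohomology_vanishes M (m - 2) 2"
    have "cohomology_vanishes M (m - int i) i" if i: "i \<ge> 1" for i
    proof -
      consider "i = 1" | "i = 2" | "i \<ge> 3" using i by linarith
      then show ?thesis using van cohomology_vanishes_ge_3[OF M] by cases simp_all
    qed
    then show "regular_sheaf M m" by (simp add: regular_sheaf_def)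
  qed
  then show ?thesis
    by (simp only: cohomology_vanishes_1_iff[OF M] cohomology_vanishes_2_iff[OF M])
qed

section \<open>Cohomology of the twists of the structure sheaf\<close>

lemma var_power: "var i ^ n = Poly_Mapping.single (Poly_Mapping.single i n) 1"
  by (induction n) (simp_all add: var_def mult_single single_add[symmetric])

lemma lookup_var_power_mult:
  "lookup (var i ^ n * q) e
    = (if n \<le> lookup e i then lookup q (e - Poly_Mapping.single i n) else 0)"
proof (induction q rule: poly_mapping_induct_sum)
  case (single a c)
  have "Poly_Mapping.single i n + a = e \<longleftrightarrow> n \<le> lookup e i \<and> a = e - Poly_Mapping.single i n"
    by (auto simp: poly_mapping_eq_iff fun_eq_iff lookup_add lookup_minus lookup_single when_def)
  then show ?case
    by (auto simp: var_power mult_single lookup_single when_def)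
qed (simp add: distrib_left lookup_add)

text \<open>The monomials are sorted by their exponent at \<open>i\<close>. The remainder has only
  monomials of \<open>p\<close>, so bounds obtained for other variables survive further
  divisions.\<close>

lemma var_power_split:
  fixes p :: "'k::field_char_0 poly3"
  assumes "homogeneous m p"
  obtains q r where "p = var i ^ n * q + r" "homogeneous (m - int n) q" "homogeneous m r"
    "\<And>e. e \<in> keys r \<Longrightarrow> lookup e i < n \<and> e \<in> keys p"
proof
  let ?p = "keep (\<lambda>e. n \<le> lookup e i) p"
  let ?q = "\<Sum>e\<in>keys ?p. Poly_Mapping.single (e - Poly_Mapping.single i n) (lookup ?p e)"
  let ?r = "keep (\<lambda>e. \<not> n \<le> lookup e i) p"
  have "Poly_Mapping.single i n + (e - Poly_Mapping.single i n) = e" if "n \<le> lookup e i" for e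
    using that by (intro poly_mapping_eqI) (auto simp: lookup_add lookup_minus lookup_single when_def)
  then have "var i ^ n * ?q = (\<Sum>e\<in>keys ?p. Poly_Mapping.single e (lookup ?p e))"
    by (simp add: var_power sum_distrib_left mult_single keys_keep)
  then have q: "var i ^ n * ?q = ?p"
    by (simp add: poly_mapping_sum_single)
  show "p = var i ^ n * ?q + ?r"
    unfolding q by (rule keep_split)
  show "homogeneous (m - int n) ?q"
    using homogeneous_cancel[of "int n" "var i ^ n" m ?q] homogeneous_power[of 1 "var i" n]
      homogeneous_keep[OF assms] q by simp
  show "homogeneous m ?r" by (rule homogeneous_keep[OF assms])
  show "lookup e i < n \<and> e \<in> keys p" if "e \<in> keys ?r" for e
    using that by (simp add: keys_keep)
qed

lemma keys_var_power_mult: "e \<in> keys r \<Longrightarrow> Poly_Mapping.single i n + e \<in> keys (var i ^ n * r)"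
  by (simp add: in_keys_iff lookup_var_power_mult lookup_add)

text \<open>Every monomial of the right side is divisible by x_j^n or x_k^n, while multiplication by
  x_i^n leaves the exponents of x_j and x_k alone. This is the regular sequence property of powers
  of variables; j = k is allowed.\<close>

lemma remainder_eq_0:
  assumes "var i ^ n * r = var j ^ n * p + var k ^ n * q"
    and "\<And>e. e \<in> keys r \<Longrightarrow> lookup e j < n \<and> lookup e k < n"
    and "i \<noteq> j" "i \<noteq> k"
  shows "r = 0"
proof (rule ccontr)
  assume "r \<noteq> 0"
  then obtain e where e: "e \<in> keys r"
    by (metis all_not_in_conv in_keys_iff poly_mapping_eqI lookup_zero)
  let ?e = "Poly_Mapping.single i n + e"
  have "lookup (var i ^ n * r) ?e \<noteq> 0"
    using keys_var_power_mult[OF e] by (simp add: in_keys_iff)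
  moreover have "lookup ?e j < n" "lookup ?e k < n"
    using assms(2)[OF e] assms(3,4) by (simp_all add: lookup_add lookup_single when_def)
  ultimately show False
    by (simp add: assms(1) lookup_add lookup_var_power_mult)
qed

text \<open>Sections of O(m) as elements of the fraction field. Taking a free module of rank one
  makes the closure properties special cases of those of \<open>twisted_sections\<close>.\<close>

definition sections :: "int \<Rightarrow> 3 set \<Rightarrow> 'k::field_char_0 poly3 fract set" where
  "sections m S = {c. vec c \<in> twisted_sections (UNIV :: ('k poly3 ^ 1) set) m S}"

lemma sections_iff:
  "c \<in> sections m S \<longleftrightarrow>
    (\<exists>p N. homogeneous (m + int (N * card S)) p \<and> to_fract (denom S ^ N) * c = to_fract p)"
proof
  assume "c \<in> sections m S"
  then show "\<exists>p N. homogeneous (m + int (N * card S)) p \<and> to_fract (denom S ^ N) * c = to_fract p"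
    by (auto simp: sections_def twisted_sections_iff homogeneous_vec_def vec_eq_iff
        simp del: of_nat_mult)
next
  assume "\<exists>p N. homogeneous (m + int (N * card S)) p \<and> to_fract (denom S ^ N) * c = to_fract p"
  then obtain p N where p: "homogeneous (m + int (N * card S)) p"
    "to_fract (denom S ^ N) * c = to_fract p" by blast
  then show "c \<in> sections m S"
    unfolding sections_def
    by (intro CollectI twisted_sectionsI[of "vec p" _ _ N])
      (simp_all add: homogeneous_vec_def vec_eq_iff del: of_nat_mult)
qed

lemma sectionsI:
  "homogeneous (m + int (N * card S)) p \<Longrightarrow> to_fract (denom S ^ N) * c = to_fract p
    \<Longrightarrow> c \<in> sections m S"
  by (auto simp: sections_iff simp del: of_nat_mult)

lemma sections_raise:
  assumes "c \<in> sections m S"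
  obtains N where "\<And>n. n \<ge> N \<Longrightarrow> \<exists>p. homogeneous (m + int (n * card S)) p
      \<and> to_fract (denom S ^ n) * c = to_fract p"
proof -
  obtain N where N: "\<And>n. n \<ge> N \<Longrightarrow> \<exists>g\<in>UNIV. homogeneous_vec (m + int (n * card S)) g
      \<and> to_fract (denom S ^ n) *s (vec c :: _ ^ 1) = embv g"
    using twisted_sections_raise[OF submodule_UNIV] assms unfolding sections_def by blast
  show ?thesis
    by (rule that[of N]) (use N in \<open>auto simp: homogeneous_vec_def vec_eq_iff simp del: of_nat_mult\<close>)
qed

lemma twisted_sections_nth:
  "v \<in> twisted_sections M m S \<Longrightarrow> v $ j \<in> sections m S"
  by (auto simp: sections_iff twisted_sections_iff homogeneous_vec_def vec_eq_iff
        simp del: of_nat_mult)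

lemma sections_add: "a \<in> sections m S \<Longrightarrow> b \<in> sections m S \<Longrightarrow> a + b \<in> sections m S"
  unfolding sections_def using twisted_sections_add[OF submodule_UNIV] by (simp add: vec_add)

lemma sections_uminus: "a \<in> sections m S \<Longrightarrow> - a \<in> sections m S"
  unfolding sections_def using twisted_sections_uminus[OF submodule_UNIV]
  by (metis (no_types, lifting) mem_Collect_eq vec_neg)

lemma sections_diff: "a \<in> sections m S \<Longrightarrow> b \<in> sections m S \<Longrightarrow> a - b \<in> sections m S"
  using sections_add[of a m S "- b"] sections_uminus[of b] by simp

lemma sections_mult: "a \<in> sections m S \<Longrightarrow> homogeneous n p \<Longrightarrow> to_fract p * a \<in> sections (m + n) S"
  unfolding sections_def using twisted_sections_smult[OF submodule_UNIV] by (simp add: vec_cmul)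

lemma sections_mono: "S \<subseteq> S' \<Longrightarrow> sections m S \<subseteq> sections m S'"
  unfolding sections_def using twisted_sections_mono[OF submodule_UNIV] by blast

text \<open>The components may come with different denominators; the index type is finite, so the
  largest exponent serves all of them.\<close>

lemma twisted_sections_UNIV:
  fixes v :: "'k::field_char_0 poly3 fract ^ 'r"
  assumes "\<And>j. v $ j \<in> sections m S"
  shows "v \<in> twisted_sections UNIV m S"
proof -
  have "\<exists>N. \<forall>n\<ge>N. \<exists>p. homogeneous (m + int (n * card S)) p
      \<and> to_fract (denom S ^ n) * v $ j = to_fract p" for j
    using sections_raise[OF assms[of j]] by blast
  then obtain N where N: "\<And>j n. n \<ge> N j \<Longrightarrow> \<exists>p. homogeneous (m + int (n * card S)) p
      \<and> to_fract (denom S ^ n) * v $ j = to_fract p"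
    by metis
  define n where "n = Max (range N)"
  have "\<exists>p. homogeneous (m + int (n * card S)) p
      \<and> to_fract (denom S ^ n) * v $ j = to_fract p" for j
    by (rule N) (simp add: n_def)
  then obtain p where p: "\<And>j. homogeneous (m + int (n * card S)) (p j)"
      "\<And>j. to_fract (denom S ^ n) * v $ j = to_fract (p j)"
    by metis
  show ?thesis
    by (rule twisted_sectionsI[of "\<chi> j. p j" _ _ n])
      (simp_all add: p homogeneous_vec_def vec_eq_iff del: of_nat_mult)
qed

lemma denom_three:
  "denom {0} = var 0" "denom {1} = var 1" "denom {2} = var 2" "denom {0,1} = var 0 * var 1"
  "denom {0,2} = var 0 * var 2" "denom {1,2} = var 1 * var 2"
  "denom {0,1,2} = var 0 * var 1 * var 2"
  by (simp_all add: denom_def mult.assoc)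

lemma sections_raise_pair:
  assumes c: "c \<in> sections m {i, j}" and "i \<noteq> j"
  obtains N where "\<And>n. n \<ge> N \<Longrightarrow> \<exists>p. homogeneous (m + 2 * int n) p
      \<and> to_fract (var i) ^ n * to_fract (var j) ^ n * c = to_fract p"
proof -
  obtain N where N: "\<And>n. n \<ge> N \<Longrightarrow> \<exists>p. homogeneous (m + int (n * card {i, j})) p
      \<and> to_fract (denom {i, j} ^ n) * c = to_fract p"
    using sections_raise[OF c] by blast
  have d: "denom {i, j} = var i * var j" and n: "int (n * card {i, j}) = 2 * int n" for n
    using assms(2) by (simp_all add: denom_def)
  show ?thesis
    by (rule that[of N]) (use N in \<open>simp only: n d to_fract_power power_mult_distrib to_fract_mult\<close>)
qed

lemma sections_H2_vanishes:
  fixes f :: "'k::field_char_0 poly3 fract"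
  assumes "n \<ge> - 2" and f: "f \<in> sections n {0,1,2}"
  obtains a b c where "a \<in> sections n {0,1}" "b \<in> sections n {0,2}" "c \<in> sections n {1,2}"
    "f = a + b + c"
proof -
  obtain F N where F: "homogeneous (n + int (N * card {0,1,2::3})) F"
    "to_fract (denom {0,1,2} ^ N) * f = to_fract F"
    using f unfolding sections_iff by blast
  have hF: "homogeneous (n + 3 * int N) F"
    using F(1) by (rule homogeneous_cong) simp
  obtain p r0 where p: "F = var 0 ^ N * p + r0" "homogeneous (n + 3 * int N - int N) p"
    "homogeneous (n + 3 * int N) r0" "\<And>e. e \<in> keys r0 \<Longrightarrow> lookup e 0 < N \<and> e \<in> keys F"
    by (rule var_power_split[OF hF, where i = 0 and n = N]) metis
  obtain q r1 where q: "r0 = var 1 ^ N * q + r1" "homogeneous (n + 3 * int N - int N) q"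
    "homogeneous (n + 3 * int N) r1" "\<And>e. e \<in> keys r1 \<Longrightarrow> lookup e 1 < N \<and> e \<in> keys r0"
    by (rule var_power_split[OF p(3), where i = 1 and n = N]) metis
  obtain s r2 where s: "r1 = var 2 ^ N * s + r2" "homogeneous (n + 3 * int N - int N) s"
    "homogeneous (n + 3 * int N) r2" "\<And>e. e \<in> keys r2 \<Longrightarrow> lookup e 2 < N \<and> e \<in> keys r1"
    by (rule var_power_split[OF q(3), where i = 2 and n = N]) metis
  \<comment> \<open>A surviving monomial would have all exponents at most N - 1, hence degree at
    most 3 N - 3, whereas its degree is n + 3 N \<ge> 3 N - 2.\<close>
  have "e \<notin> keys r2" for e
  proof
    assume e: "e \<in> keys r2"
    then have "lookup e 0 < N" "lookup e 1 < N" "lookup e 2 < N"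
      using s(4) q(4) p(4) by blast+
    moreover have "int (total_degree e) = n + 3 * int N"
      using s(3) e unfolding homogeneous_def by blast
    ultimately show False using assms(1) by (simp add: sum_three)
  qed
  then have "r2 = 0" by (metis in_keys_iff poly_mapping_eqI lookup_zero)
  then have eq: "F = var 0 ^ N * p + var 1 ^ N * q + var 2 ^ N * s"
    using p(1) q(1) s(1) by (simp add: add.assoc)
  define X where "X i = to_fract (var i :: 'k poly3) ^ N" for i
  have X: "X i \<noteq> 0" for i by (simp add: X_def)
  have f_eq: "X 0 * X 1 * X 2 * f = X 0 * to_fract p + X 1 * to_fract q + X 2 * to_fract s"
    using F(2) by (simp add: eq denom_three to_fract_power X_def power_mult_distrib)
  have pq: "homogeneous (n + int (N * card {i, j})) p'"
    if "i \<noteq> j" "homogeneous (n + 3 * int N - int N) p'" for i j :: 3 and p' :: "'k poly3"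
    using that(2) by (rule homogeneous_cong) (use that(1) in simp)
  show ?thesis
  proof (rule that[of "to_fract s / (X 0 * X 1)" "to_fract q / (X 0 * X 2)" "to_fract p / (X 1 * X 2)"])
    show "to_fract s / (X 0 * X 1) \<in> sections n {0,1}"
      by (rule sectionsI[OF pq[OF _ s(2)]])
        (use X in \<open>simp_all add: denom_three to_fract_power power_mult_distrib flip: X_def\<close>)
    show "to_fract q / (X 0 * X 2) \<in> sections n {0,2}"
      by (rule sectionsI[OF pq[OF _ q(2)]])
        (use X in \<open>simp_all add: denom_three to_fract_power power_mult_distrib flip: X_def\<close>)
    show "to_fract p / (X 1 * X 2) \<in> sections n {1,2}"
      by (rule sectionsI[OF pq[OF _ p(2)]])
        (use X in \<open>simp_all add: denom_three to_fract_power power_mult_distrib flip: X_def\<close>)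
    have "f = (X 0 * to_fract p + X 1 * to_fract q + X 2 * to_fract s) / (X 0 * X 1 * X 2)"
      using X f_eq by (simp add: nonzero_eq_divide_eq mult.commute)
    then show "f = to_fract s / (X 0 * X 1) + to_fract q / (X 0 * X 2) + to_fract p / (X 1 * X 2)"
      using X by (simp add: field_simps)
  qed
qed

text \<open>With denominators cleared, the cocycle condition is a linear relation among x_0^N,
  x_1^N, x_2^N. These form a regular sequence, so the relation is a combination of Koszul relations;
  its coefficients P, Q, R are the numerators of the bounding cochain.\<close>

lemma sections_H1_vanishes:
  fixes a b c :: "'k::field_char_0 poly3 fract"
  assumes a: "a \<in> sections n {0,1}" and b: "b \<in> sections n {0,2}" and c: "c \<in> sections n {1,2}"
    and eq: "a + c = b"
  obtains u v w where "u \<in> sections n {0}" "v \<in> sections n {1}" "w \<in> sections n {2}"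
    "a = v - u" "b = w - u" "c = w - v"
proof -
  obtain Na where Na: "\<And>N. N \<ge> Na \<Longrightarrow> \<exists>p. homogeneous (n + 2 * int N) p
      \<and> to_fract (var 0) ^ N * to_fract (var 1) ^ N * a = to_fract p"
    using sections_raise_pair[OF a] three_distinct by blast
  obtain Nb where Nb: "\<And>N. N \<ge> Nb \<Longrightarrow> \<exists>p. homogeneous (n + 2 * int N) p
      \<and> to_fract (var 0) ^ N * to_fract (var 2) ^ N * b = to_fract p"
    using sections_raise_pair[OF b] three_distinct by blast
  obtain Nc where Nc: "\<And>N. N \<ge> Nc \<Longrightarrow> \<exists>p. homogeneous (n + 2 * int N) p
      \<and> to_fract (var 1) ^ N * to_fract (var 2) ^ N * c = to_fract p"
    using sections_raise_pair[OF c] three_distinct by blast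
  define N where "N = Na + Nb + Nc"
  define X where "X i = to_fract (var i :: 'k poly3) ^ N" for i
  have X: "X i \<noteq> 0" for i by (simp add: X_def)
  obtain A where A: "homogeneous (n + 2 * int N) A" "X 0 * X 1 * a = to_fract A"
    using Na[of N] unfolding N_def X_def by auto
  obtain B where B: "homogeneous (n + 2 * int N) B" "X 0 * X 2 * b = to_fract B"
    using Nb[of N] unfolding N_def X_def by auto
  obtain C where C: "homogeneous (n + 2 * int N) C" "X 1 * X 2 * c = to_fract C"
    using Nc[of N] unfolding N_def X_def by auto
  have "to_fract (var 2 ^ N * A + var 0 ^ N * C) = to_fract (var 1 ^ N * B)"
    by (simp add: A(2)[symmetric] B(2)[symmetric] C(2)[symmetric] to_fract_power eq[symmetric]
        algebra_simps flip: X_def)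
  then have ABC: "var 2 ^ N * A + var 0 ^ N * C = var 1 ^ N * B"
    by (simp only: to_fract_eq_iff)
  obtain P r0 where P: "A = var 0 ^ N * P + r0" "homogeneous (n + 2 * int N - int N) P"
    "homogeneous (n + 2 * int N) r0" "\<And>e. e \<in> keys r0 \<Longrightarrow> lookup e 0 < N \<and> e \<in> keys A"
    by (rule var_power_split[OF A(1), where i = 0 and n = N]) metis
  obtain Q r1 where Q: "r0 = var 1 ^ N * Q + r1" "homogeneous (n + 2 * int N - int N) Q"
    "homogeneous (n + 2 * int N) r1" "\<And>e. e \<in> keys r1 \<Longrightarrow> lookup e 1 < N \<and> e \<in> keys r0"
    by (rule var_power_split[OF P(3), where i = 1 and n = N]) metis
  \<comment> \<open>Modulo x_0^N and x_1^N the relation says that x_2^N A vanishes, so the reduced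
    remainder of A is zero.\<close>
  have "var 2 ^ N * r1 = var 1 ^ N * (B - var 2 ^ N * Q) + var 0 ^ N * (- C - var 2 ^ N * P)"
    using ABC by (simp add: P(1) Q(1) algebra_simps)
  then have "r1 = 0"
    by (rule remainder_eq_0) (use P(4) Q(4) in auto)
  then have A_eq: "A = var 0 ^ N * P + var 1 ^ N * Q"
    by (simp add: P(1) Q(1))
  have h: "homogeneous (n + 2 * int N) (C + var 2 ^ N * P)"
    using homogeneous_mult[OF homogeneous_power[OF homogeneous_var, of N 2] P(2)]
    by (intro homogeneous_add[OF C(1)]) (simp add: algebra_simps)
  obtain R r2 where R: "C + var 2 ^ N * P = var 1 ^ N * R + r2" "homogeneous (n + 2 * int N - int N) R"
    "\<And>e. e \<in> keys r2 \<Longrightarrow> lookup e 1 < N \<and> e \<in> keys (C + var 2 ^ N * P)"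
    by (rule var_power_split[OF h, where i = 1 and n = N]) metis
  have "var 0 ^ N * r2 = var 0 ^ N * (C + var 2 ^ N * P) - var 0 ^ N * (var 1 ^ N * R)"
    unfolding R(1) by (simp add: algebra_simps)
  also have "\<dots> = var 1 ^ N * (B - var 2 ^ N * Q - var 0 ^ N * R) + var 1 ^ N * 0"
    using ABC by (simp add: A_eq algebra_simps)
  finally have "r2 = 0"
    by (rule remainder_eq_0) (use R(3) in auto)
  then have C_eq: "C = var 1 ^ N * R - var 2 ^ N * P"
    using R(1) by (simp add: algebra_simps)
  have "var 1 ^ N * B = var 1 ^ N * (var 2 ^ N * Q + var 0 ^ N * R)"
    unfolding ABC[symmetric] by (simp add: A_eq C_eq algebra_simps)
  then have B_eq: "B = var 2 ^ N * Q + var 0 ^ N * R" by simp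
  have sec: "to_fract p / X i \<in> sections n {i}" if "homogeneous (n + 2 * int N - int N) p"
    for i and p :: "'k poly3"
    by (rule sectionsI[of _ N _ p])
      (use that X[of i] in \<open>simp_all add: denom_def to_fract_power algebra_simps flip: X_def\<close>)
  show ?thesis
  proof (rule that[of "- (to_fract Q / X 0)" "to_fract P / X 1" "to_fract R / X 2"])
    show "- (to_fract Q / X 0) \<in> sections n {0}" "to_fract P / X 1 \<in> sections n {1}"
      "to_fract R / X 2 \<in> sections n {2}"
      using sec[OF Q(2)] sec[OF P(2)] sec[OF R(2)] by (auto intro!: sections_uminus)
    have "a = to_fract A / (X 0 * X 1)" using A(2) X by (simp add: nonzero_eq_divide_eq mult.commute)
    also have "\<dots> = to_fract P / X 1 - - (to_fract Q / X 0)"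
      using X by (simp add: A_eq to_fract_power field_simps flip: X_def)
    finally show "a = to_fract P / X 1 - - (to_fract Q / X 0)" .
    have "b = to_fract B / (X 0 * X 2)" using B(2) X by (simp add: nonzero_eq_divide_eq mult.commute)
    also have "\<dots> = to_fract R / X 2 - - (to_fract Q / X 0)"
      using X by (simp add: B_eq to_fract_power field_simps flip: X_def)
    finally show "b = to_fract R / X 2 - - (to_fract Q / X 0)" .
    have "c = to_fract C / (X 1 * X 2)" using C(2) X by (simp add: nonzero_eq_divide_eq mult.commute)
    also have "\<dots> = to_fract R / X 2 - to_fract P / X 1"
      using X by (simp add: C_eq to_fract_power field_simps flip: X_def)
    finally show "c = to_fract R / X 2 - to_fract P / X 1" .
  qed
qed

section \<open>Regularity\<close>

lemma H1_vanishesE: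
  assumes "H1_vanishes M m" "a \<in> twisted_sections M m {0,1}" "b \<in> twisted_sections M m {0,2}"
    "c \<in> twisted_sections M m {1,2}" "a + c = b"
  obtains u v w where "u \<in> twisted_sections M m {0}" "v \<in> twisted_sections M m {1}"
    "w \<in> twisted_sections M m {2}" "a = v - u" "b = w - u" "c = w - v"
  using assms(1)[unfolded H1_vanishes_def, rule_format, OF assms(2-5)] that by blast

lemma H2_vanishesE:
  assumes "H2_vanishes M m" "v \<in> twisted_sections M m {0,1,2}"
  obtains a b c where "a \<in> twisted_sections M m {0,1}" "b \<in> twisted_sections M m {0,2}"
    "c \<in> twisted_sections M m {1,2}" "v = a + b + c"
  using assms(1)[unfolded H2_vanishes_def, rule_format, OF assms(2)] that by blast

text \<open>On the triple intersection x_0 is a unit, so a section in twist m + 1 is x_0 times a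
  section in twist m.\<close>

lemma H2_vanishes_Suc:
  assumes M: "submodule M" and van: "H2_vanishes M m"
  shows "H2_vanishes M (m + 1)"
  unfolding H2_vanishes_def
proof
  fix v assume v: "v \<in> twisted_sections M (m + 1) {0,1,2}"
  let ?x = "to_fract (var 0) :: 'a poly3 fract"
  have x: "?x \<noteq> 0" by simp
  have "inverse ?x *s v \<in> twisted_sections M m {0,1,2}"
    using twisted_sections_divide_var[OF M v, of 0] by simp
  then obtain a b c where abc: "a \<in> twisted_sections M m {0,1}" "b \<in> twisted_sections M m {0,2}"
    "c \<in> twisted_sections M m {1,2}" "inverse ?x *s v = a + b + c"
    using van unfolding H2_vanishes_def by meson
  have "v = ?x *s (inverse ?x *s v)"
    using x by (simp add: vector_smult_assoc del: to_fract_eq_0_iff)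
  also have "\<dots> = ?x *s a + ?x *s b + ?x *s c"
    by (simp add: abc(4) vector_add_ldistrib)
  finally show "\<exists>a\<in>twisted_sections M (m + 1) {0,1}. \<exists>b\<in>twisted_sections M (m + 1) {0,2}.
      \<exists>c\<in>twisted_sections M (m + 1) {1,2}. v = a + b + c"
    using twisted_sections_var_smult[OF M] abc(1-3) by blast
qed

text \<open>Restriction to the line \<open>x\<^sub>0 = 0\<close>: the class of \<open>c\<close> in its first cohomology is \<open>x\<^sub>1\<close> times
  the class of \<open>c / x\<^sub>1\<close>, which lifts to degree \<open>m\<close> because the second cohomology vanishes in
  degree \<open>m - 1\<close>.\<close>

lemma H1_vanishes_Suc:
  assumes M: "submodule M" and van1: "H1_vanishes M m" and van2: "H2_vanishes M (m - 1)"
  shows "H1_vanishes M (m + 1)"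
  unfolding H1_vanishes_def
proof (intro ballI impI)
  fix a b c assume a: "a \<in> twisted_sections M (m + 1) {0,1}"
    and b: "b \<in> twisted_sections M (m + 1) {0,2}" and c: "c \<in> twisted_sections M (m + 1) {1,2}"
    and eq: "a + c = b"
  note closure = twisted_sections_add[OF M] twisted_sections_diff[OF M] twisted_sections_uminus[OF M]
  let ?x = "\<lambda>i. to_fract (var i) :: 'a poly3 fract"
  have x: "?x i \<noteq> 0" for i by simp
  have xinv: "?x i *s (inverse (?x i) *s v) = v" for i and v :: "'a poly3 fract ^ 'b"
    by (simp add: vector_smult_assoc)
  define e where "e = inverse (?x 1) *s c"
  have e: "e \<in> twisted_sections M m {1,2}"
    using twisted_sections_divide_var[OF M c, of 1] by (simp add: e_def)
  then have "e \<in> twisted_sections M m {0,1,2}"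
    using twisted_sections_mono[OF M, of "{1,2}" "{0,1,2}"] by blast
  then have "inverse (?x 0) *s e \<in> twisted_sections M (m - 1) {0,1,2}"
    using twisted_sections_divide_var[OF M, of e m _ 0] by simp
  then obtain p q r where pqr: "p \<in> twisted_sections M (m - 1) {0,1}"
    "q \<in> twisted_sections M (m - 1) {0,2}" "r \<in> twisted_sections M (m - 1) {1,2}"
    "inverse (?x 0) *s e = p + q + r"
    using van2 unfolding H2_vanishes_def by meson
  have up: "?x i *s v \<in> twisted_sections M m S" if "v \<in> twisted_sections M (m - 1) S" for i v S
    using twisted_sections_var_smult[OF M that] by simp
  have e_eq: "e = ?x 0 *s p + ?x 0 *s q + ?x 0 *s r"
    using xinv[of 0 e] by (simp add: pqr(4) vector_add_ldistrib)
  \<comment> \<open>Splitting e / x_0 over the pairwise intersections changes \<open>e\<close> by a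
    multiple of x_0 and completes it to a cocycle in twist m.\<close>
  have "- (?x 0 *s p) + (e - ?x 0 *s r) = ?x 0 *s q"
    by (simp add: e_eq)
  moreover have "- (?x 0 *s p) \<in> twisted_sections M m {0,1}"
    "e - ?x 0 *s r \<in> twisted_sections M m {1,2}" "?x 0 *s q \<in> twisted_sections M m {0,2}"
    using pqr e by (auto intro!: closure up)
  ultimately obtain u v w where uvw: "u \<in> twisted_sections M m {0}" "v \<in> twisted_sections M m {1}"
    "w \<in> twisted_sections M m {2}" "e - ?x 0 *s r = w - v"
    using van1 unfolding H1_vanishes_def by meson
  define v' w' where "v' = ?x 1 *s v" and "w' = ?x 1 *s w"
  have v': "v' \<in> twisted_sections M (m + 1) {1}" and w': "w' \<in> twisted_sections M (m + 1) {2}"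
    unfolding v'_def w'_def using uvw twisted_sections_var_smult[OF M] by blast+
  define r' where "r' = ?x 1 *s r"
  have r': "r' \<in> twisted_sections M m {1,2}" unfolding r'_def by (rule up[OF pqr(3)])
  have c_eq: "c = ?x 0 *s r' + w' - v'"
  proof -
    have "c = ?x 1 *s e" by (simp add: e_def xinv)
    also have "e = ?x 0 *s r + (w - v)" using uvw(4) by (simp add: algebra_simps)
    finally show ?thesis
      by (simp add: v'_def w'_def r'_def vector_add_ldistrib vector_ssub_ldistrib vector_smult_assoc
          mult.commute)
  qed
  \<comment> \<open>Once the coboundary of \<open>v'\<close> and \<open>w'\<close> is removed, the
    third component is x_0 times \<open>r'\<close>. The other two can be divided by x_0, a unit on
    their charts, so the whole cocycle is x_0 times one in twist m.\<close>
  define a' b' where "a' = inverse (?x 0) *s (a - v')" and "b' = inverse (?x 0) *s (b - w')"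
  have "v' \<in> twisted_sections M (m + 1) {0,1}" "w' \<in> twisted_sections M (m + 1) {0,2}"
    using v' w' twisted_sections_mono[OF M, of "{1}" "{0,1}"] twisted_sections_mono[OF M, of "{2}" "{0,2}"]
    by blast+
  then have "a - v' \<in> twisted_sections M (m + 1) {0,1}" "b - w' \<in> twisted_sections M (m + 1) {0,2}"
    using a b by (auto intro!: closure)
  then have a': "a' \<in> twisted_sections M m {0,1}" and b': "b' \<in> twisted_sections M m {0,2}"
    unfolding a'_def b'_def using twisted_sections_divide_var[OF M, of _ "m + 1" _ 0] by auto
  have ab': "a' + r' = b'"
  proof -
    have "a' + r' = inverse (?x 0) *s (a - v' + ?x 0 *s r')"
      by (simp add: a'_def vector_add_ldistrib vector_smult_assoc)
    also have "a - v' + ?x 0 *s r' = b - w'"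
      by (simp add: eq[symmetric] c_eq)
    finally show ?thesis by (simp add: b'_def)
  qed
  obtain s t z where stz: "s \<in> twisted_sections M m {0}" "t \<in> twisted_sections M m {1}"
    "z \<in> twisted_sections M m {2}" "a' = t - s" "b' = z - s" "r' = z - t"
    by (rule H1_vanishesE[OF van1 a' b' r' ab'])
  have "a - v' = ?x 0 *s t - ?x 0 *s s"
    unfolding xinv[of 0 "a - v'", folded a'_def, symmetric] by (simp add: stz vector_ssub_ldistrib)
  then have "a = (?x 0 *s t + v') - ?x 0 *s s"
    by (simp add: diff_eq_eq algebra_simps)
  moreover have "b - w' = ?x 0 *s z - ?x 0 *s s"
    unfolding xinv[of 0 "b - w'", folded b'_def, symmetric] by (simp add: stz vector_ssub_ldistrib)
  then have "b = (?x 0 *s z + w') - ?x 0 *s s"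
    by (simp add: diff_eq_eq algebra_simps)
  moreover have "c = (?x 0 *s z + w') - (?x 0 *s t + v')"
    by (simp add: c_eq stz vector_ssub_ldistrib)
  moreover have "?x 0 *s s \<in> twisted_sections M (m + 1) {0}"
    "?x 0 *s t + v' \<in> twisted_sections M (m + 1) {1}" "?x 0 *s z + w' \<in> twisted_sections M (m + 1) {2}"
    using stz v' w' by (auto intro!: closure twisted_sections_var_smult[OF M])
  ultimately show "\<exists>u\<in>twisted_sections M (m + 1) {0}. \<exists>v\<in>twisted_sections M (m + 1) {1}.
      \<exists>w\<in>twisted_sections M (m + 1) {2}. a = v - u \<and> b = w - u \<and> c = w - v"
    by blast
qed

text \<open>Castelnuovo-Mumford regularity: raising the H^1 condition uses both conditions one twist
  lower, so the two are raised together.\<close>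

lemma regular_sheaf_mono:
  assumes M: "submodule M" and "regular_sheaf M m" and "m \<le> n"
  shows "regular_sheaf M n"
  using assms(3)
proof (induction n rule: int_ge_induct)
  case base
  show ?case by (rule assms(2))
next
  case (step n)
  then have van: "H1_vanishes M (n - 1)" "H2_vanishes M (n - 2)"
    by (simp_all add: regular_sheaf_iff[OF M])
  have "H1_vanishes M n" using H1_vanishes_Suc[OF M van(1)] van(2) by simp
  moreover have "H2_vanishes M (n - 1)" using H2_vanishes_Suc[OF M van(2)] by simp
  ultimately show ?case by (simp add: regular_sheaf_iff[OF M])
qed

text \<open>In very negative degrees, a nonzero element of \<open>M\<close> gives a section with a monomial all of
  whose exponents are negative; no sum of sections over the pairwise intersections has one.\<close>

lemma regular_sheaf_bounded_below:
  fixes M :: "('k::field_char_0 poly3 ^ 'r) set"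
  assumes M: "submodule M" and g: "g \<in> M" "homogeneous_vec n g" "g \<noteq> 0"
  obtains t where "\<And>m. regular_sheaf M m \<Longrightarrow> t < m"
proof -
  obtain j where "g $ j \<noteq> 0" using g(3) by (auto simp: vec_eq_iff)
  then obtain e where e: "e \<in> keys (g $ j)"
    by (metis all_not_in_conv in_keys_iff poly_mapping_eqI lookup_zero)
  define B where "B = Suc (total_degree e)"
  have eB: "lookup e i < B" for i
    unfolding B_def by (simp add: le_imp_less_Suc member_le_sum)
  have "n - 3 * int B < m" if van: "H2_vanishes M m" for m
  proof (rule ccontr)
    assume "\<not> n - 3 * int B < m"
    \<comment> \<open>The test section is x_0^r x_1^r g over (x_0 x_1 x_2)^(B + r). Its twist is n +
      2 r - 3 (B + r) = n - 3 B - r, which equals m for this r, and the monomial from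
      \<open>e\<close> acquires negative exponents everywhere since they are below B in
      \<open>e\<close>.\<close>
    define r where "r = nat (n - 3 * int B - m)"
    have r: "int r = n - 3 * int B - m" using \<open>\<not> n - 3 * int B < m\<close> by (simp add: r_def)
    define N where "N = B + r"
    let ?D = "denom {0,1,2} :: 'k poly3"
    define p where "p = (var 0 ^ r * var 1 ^ r :: 'k poly3)"
    define f where "f = inverse (to_fract (?D ^ N)) *s embv (p *s g)"
    have D0: "to_fract (?D ^ N) \<noteq> 0" by simp
    have "homogeneous (int r * 1 + int r * 1) p"
      unfolding p_def by (intro homogeneous_mult homogeneous_power homogeneous_var)
    then have "homogeneous_vec (m + int (N * card {0,1,2::3})) (p *s g)"
      using r by (intro homogeneous_vec_smult[OF _ g(2)]) (auto simp: N_def)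
    moreover have f_eq: "to_fract (?D ^ N) *s f = embv (p *s g)"
      using D0 by (simp add: f_def vector_smult_assoc del: to_fract_eq_0_iff)
    ultimately have "f \<in> twisted_sections M m {0,1,2}"
      using submodule_smult[OF M g(1)] by (blast intro: twisted_sectionsI)
    then obtain a b c where abc: "a \<in> twisted_sections M m {0,1}" "b \<in> twisted_sections M m {0,2}"
      "c \<in> twisted_sections M m {1,2}" "f = a + b + c"
      using van unfolding H2_vanishes_def by meson
    obtain Na where Na: "\<And>N. N \<ge> Na \<Longrightarrow> \<exists>p. homogeneous (m + 2 * int N) p
      \<and> to_fract (var 0) ^ N * to_fract (var 1) ^ N * a $ j = to_fract p"
      using sections_raise_pair[OF twisted_sections_nth[OF abc(1)]] three_distinct by blast
    obtain Nb where Nb: "\<And>N. N \<ge> Nb \<Longrightarrow> \<exists>p. homogeneous (m + 2 * int N) p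
      \<and> to_fract (var 0) ^ N * to_fract (var 2) ^ N * b $ j = to_fract p"
      using sections_raise_pair[OF twisted_sections_nth[OF abc(2)]] three_distinct by blast
    obtain Nc where Nc: "\<And>N. N \<ge> Nc \<Longrightarrow> \<exists>p. homogeneous (m + 2 * int N) p
      \<and> to_fract (var 1) ^ N * to_fract (var 2) ^ N * c $ j = to_fract p"
      using sections_raise_pair[OF twisted_sections_nth[OF abc(3)]] three_distinct by blast
    define K where "K = N + Na + Nb + Nc"
    define X where "X i = to_fract (var i :: 'k poly3) ^ K" for i
    obtain A where A: "X 0 * X 1 * a $ j = to_fract A"
      using Na[of K] unfolding K_def X_def by auto
    obtain B' where B': "X 0 * X 2 * b $ j = to_fract B'"
      using Nb[of K] unfolding K_def X_def by auto
    obtain C where C: "X 1 * X 2 * c $ j = to_fract C"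
      using Nc[of K] unfolding K_def X_def by auto
    let ?s = "K - N"
    have K: "K = ?s + N" by (simp add: K_def)
    have "to_fract (?D ^ ?s * (p * g $ j)) = to_fract (?D ^ ?s) * (to_fract (?D ^ N) *s f) $ j"
      by (simp add: f_eq)
    also have "\<dots> = to_fract (?D ^ ?s * ?D ^ N) * f $ j"
      by simp
    also have "\<dots> = to_fract (?D ^ K) * f $ j"
      by (simp only: power_add[symmetric] K[symmetric])
    also have "\<dots> = X 2 * (X 0 * X 1 * a $ j) + X 1 * (X 0 * X 2 * b $ j) + X 0 * (X 1 * X 2 * c $ j)"
      by (simp add: abc(4) X_def denom_three to_fract_power power_mult_distrib algebra_simps)
    also have "\<dots> = to_fract (var 2 ^ K * A + var 1 ^ K * B' + var 0 ^ K * C)"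
      by (simp only: A B' C) (simp add: X_def to_fract_power)
    finally have eq: "?D ^ ?s * (p * g $ j) = var 2 ^ K * A + var 1 ^ K * B' + var 0 ^ K * C"
      by (simp only: to_fract_eq_iff)
    have Dp: "?D ^ ?s * (p * g $ j)
        = var 0 ^ (?s + r) * (var 1 ^ (?s + r) * (var 2 ^ ?s * g $ j))"
      by (simp add: denom_three p_def power_mult_distrib power_add ac_simps)
    \<comment> \<open>A section over \<open>{i,j}\<close> has no pole along the third coordinate
      line. Clearing by K-th powers therefore leaves the K-th power of the missing variable as a
      factor.\<close>
    have small: "lookup (var 2 ^ K * A + var 1 ^ K * B' + var 0 ^ K * C) e' = 0"
      if "\<And>i. lookup e' i < K" for e'
    proof -
      have "\<not> K \<le> lookup e' i" for i using that[of i] by simp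
      then show ?thesis by (simp add: lookup_add lookup_var_power_mult)
    qed
    let ?e = "Poly_Mapping.single 0 (?s + r) + (Poly_Mapping.single 1 (?s + r)
      + (Poly_Mapping.single 2 ?s + e))"
    have "?e \<in> keys (?D ^ ?s * (p * g $ j))"
      unfolding Dp by (intro keys_var_power_mult e)
    moreover have "lookup ?e i < K" for i
    proof -
      have "lookup ?e i \<le> ?s + r + lookup e i"
        by (simp add: lookup_add lookup_single when_def)
      also have "\<dots> < ?s + r + B" using eB by simp
      also have "\<dots> = K" by (subst K) (simp add: N_def)
      finally show ?thesis .
    qed
    then have "lookup (var 2 ^ K * A + var 1 ^ K * B' + var 0 ^ K * C) ?e = 0"
      by (rule small)
    ultimately show False using eq by (simp add: in_keys_iff)
  qed
  \<comment> \<open>Regularity m concerns H^2 in twist m - 2, hence the shift by 2.\<close>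
  then show ?thesis
    using regular_sheaf_iff[OF M] by (intro that[of "n - 3 * int B + 2"]) force
qed

text \<open>The integers are not well ordered; the lower bound \<open>t\<close> moves the question
  to the naturals.\<close>

lemma Least_int_exists:
  fixes P :: "int \<Rightarrow> bool"
  assumes "P a" and "\<And>m. P m \<Longrightarrow> t < m"
  shows "P (Least P)" and "\<And>m. P m \<Longrightarrow> Least P \<le> m"
proof -
  define k where "k = (LEAST k. P (t + int k))"
  have "P (t + int (nat (a - t)))" using assms(1) assms(2)[OF assms(1)] by simp
  then have k: "P (t + int k)" unfolding k_def by (rule LeastI)
  have le: "t + int k \<le> m" if "P m" for m
  proof -
    have "P (t + int (nat (m - t)))" using that assms(2)[OF that] by simp
    then have "k \<le> nat (m - t)" unfolding k_def by (rule Least_le)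
    then show ?thesis using assms(2)[OF that] by linarith
  qed
  have "Least P = t + int k" by (rule Least_equality) (use k le in auto)
  then show "P (Least P)" "\<And>m. P m \<Longrightarrow> Least P \<le> m" using k le by auto
qed

section \<open>Vectors with three components\<close>

definition dot :: "'a::comm_ring_1 ^ 3 \<Rightarrow> 'a ^ 3 \<Rightarrow> 'a" where
  "dot u v = (\<Sum>i\<in>UNIV. u $ i * v $ i)"

definition cross :: "'a::comm_ring_1 ^ 3 \<Rightarrow> 'a ^ 3 \<Rightarrow> 'a ^ 3" where
  "cross u v = (\<chi> i. if i = 0 then u $ 1 * v $ 2 - u $ 2 * v $ 1
    else if i = 1 then u $ 2 * v $ 0 - u $ 0 * v $ 2 else u $ 0 * v $ 1 - u $ 1 * v $ 0)"

lemma cross_nth [simp]: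
  "cross u v $ 0 = u $ 1 * v $ 2 - u $ 2 * v $ 1"
  "cross u v $ 1 = u $ 2 * v $ 0 - u $ 0 * v $ 2"
  "cross u v $ 2 = u $ 0 * v $ 1 - u $ 1 * v $ 0"
  by (simp_all add: cross_def)

lemma vec3_eq_iff: "(u :: 'a ^ 3) = v \<longleftrightarrow> u $ 0 = v $ 0 \<and> u $ 1 = v $ 1 \<and> u $ 2 = v $ 2"
  by (simp add: vec_eq_iff all_three)

lemma dot_three: "dot u v = u $ 0 * v $ 0 + u $ 1 * v $ 1 + u $ 2 * v $ 2"
  by (simp add: dot_def sum_three)

lemma dot_add_right: "dot u (v + w) = dot u v + dot u w"
  and dot_diff_right: "dot u (v - w) = dot u v - dot u w"
  and dot_smult_right: "dot u (c *s v) = c * dot u v"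
  and dot_commute: "dot u v = dot v u"
  by (simp_all add: dot_three algebra_simps)

lemma dot_cross_self [simp]: "dot u (cross u v) = 0" "dot v (cross u v) = 0"
  by (simp_all add: dot_three algebra_simps)

lemma dot_cross_swap: "dot w (cross u v) = - dot v (cross u w)"
  by (simp add: dot_three algebra_simps)

lemma cross_cross: "cross w (cross u v) = dot w v *s u - dot w u *s v"
  by (simp add: vec3_eq_iff dot_three algebra_simps)

lemma cross_cross_left: "cross (cross u v) w = dot u w *s v - dot v w *s u"
  by (simp add: vec3_eq_iff dot_three algebra_simps)

text \<open>Cramer's rule. With coefficient vectors of three lines and the Euler vector as
  \<open>x\<close>, it expresses variables through the three forms.\<close>

lemma cramer_three:
  "dot w (cross u v) *s x = dot u x *s cross v w + dot v x *s cross w u + dot w x *s cross u v"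
  by (simp add: vec3_eq_iff dot_three algebra_simps)

lemma cross_add_left: "cross (u + v) w = cross u w + cross v w"
  and cross_diff_left: "cross (u - v) w = cross u w - cross v w"
  and cross_smult_left: "cross (c *s u) w = c *s cross u w"
  and cross_self: "cross w w = 0"
  by (simp_all add: vec3_eq_iff algebra_simps)

text \<open>A 2 by 2 minor is zero or, up to sign, a component of the cross product. This spares
  later arguments the case distinction on indices.\<close>

lemma minor_eq_cross:
  "\<exists>c m. u $ i * v $ j - u $ j * v $ i = c * cross u v $ m"
proof -
  have "u $ i * v $ j - u $ j * v $ i = 0 \<or> (\<exists>m. u $ i * v $ j - u $ j * v $ i = cross u v $ m)
      \<or> (\<exists>m. u $ i * v $ j - u $ j * v $ i = - cross u v $ m)"
  proof -
    have "\<forall>i j. u $ i * v $ j - u $ j * v $ i \<in> {0, cross u v $ 0, cross u v $ 1, cross u v $ 2,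
        - cross u v $ 0, - cross u v $ 1, - cross u v $ 2}"
      by (simp add: all_three mult.commute)
    then have "u $ i * v $ j - u $ j * v $ i \<in> {0, cross u v $ 0, cross u v $ 1, cross u v $ 2,
        - cross u v $ 0, - cross u v $ 1, - cross u v $ 2}"
      by blast
    then show ?thesis by blast
  qed
  then show ?thesis
    by (metis mult_1 mult_minus1 mult_zero_left)
qed

lemma cross_divides_minors:
  assumes "\<And>m. d dvd cross u v $ m"
  shows "d dvd u $ i * v $ j - u $ j * v $ i"
  using minor_eq_cross[of u i v j] assms by (metis dvd_mult)

lemma cross_eq_0_minors:
  assumes "cross u v = 0"
  shows "u $ i * v $ j = u $ j * v $ i"
  using cross_divides_minors[of 0 u v i j] assms by simp

section \<open>Linear forms and reduction modulo a linear form\<close>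

definition cvec :: "'k::field_char_0 ^ 3 \<Rightarrow> 'k poly3 ^ 3" where
  "cvec a = (\<chi> i. const (a $ i))"

lemma cvec_nth [simp]: "cvec a $ i = const (a $ i)"
  by (simp add: cvec_def)

lemma dot_cvec: "dot (cvec a) (cvec b) = const (dot a b)"
  by (simp add: dot_three const_simps)

lemma cross_cvec: "cross (cvec a) (cvec b) = cvec (cross a b)"
  by (simp add: vec3_eq_iff const_simps)

definition euler :: "'k::field_char_0 poly3 ^ 3" where
  "euler = (\<chi> i. var i)"

lemma euler_nth [simp]: "euler $ i = var i"
  by (simp add: euler_def)

lemma homogeneous_vec_euler: "homogeneous_vec 1 euler"
  by (simp add: homogeneous_vec_def)

lemma linear_form_dot: "linear_form a = dot (cvec a) euler"
  by (simp add: linear_form_def dot_def)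

lemma homogeneous_linear_form [simp]: "homogeneous 1 (linear_form a)"
  unfolding linear_form_def by (intro homogeneous_sum homogeneous_const_mult homogeneous_var)

lemma partial_linear_form: "partial i (linear_form a) = const (a $ i)"
  by (simp add: linear_form_def partial_sum partial_const_mult partial_var if_distrib[of "\<lambda>x. _ * x"]
      cong: if_cong)

lemma linear_form_eq_0_iff [simp]: "linear_form a = 0 \<longleftrightarrow> a = 0"
proof
  assume "linear_form a = 0"
  then have "const (a $ i) = 0" for i
    using partial_linear_form[of i a] by simp
  then show "a = 0" by (simp add: vec_eq_iff)
qed (simp add: linear_form_def)

lemma linear_form_smult: "linear_form (c *s a) = const c * linear_form a"
  by (simp add: linear_form_def sum_distrib_left const_mult mult.assoc)

lemma linear_form_diff: "linear_form (a - b) = linear_form a - linear_form b"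
  by (simp add: linear_form_def sum_subtractf const_diff left_diff_distrib)

text \<open>The equation of the line is solved for x_k, where the k-th coefficient is nonzero; the
  values then involve only the other two variables, which serve as coordinates on the line.\<close>

definition eliminate :: "'k::field_char_0 ^ 3 \<Rightarrow> 3 \<Rightarrow> 3 \<Rightarrow> 'k poly3" where
  "eliminate a k i = (if i = k then var i - const (1 / a $ k) * linear_form a else var i)"

lemma subst_linear_form: "subst y (linear_form a) = (\<Sum>i\<in>UNIV. const (a $ i) * y i)"
  by (simp add: linear_form_def subst_sum subst_mult)

lemma subst_eliminate_linear_form:
  assumes "a $ k \<noteq> 0"
  shows "subst (eliminate a k) (linear_form b) = linear_form (b - (b $ k / a $ k) *s a)"
proof -
  have "subst (eliminate a k) (linear_form b)
      = (\<Sum>i\<in>UNIV. const (b $ i) * var i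
        - (if i = k then const (b $ k) * (const (1 / a $ k) * linear_form a) else 0))"
    unfolding subst_linear_form by (rule sum.cong) (auto simp: eliminate_def algebra_simps)
  also have "\<dots> = linear_form b - const (b $ k / a $ k) * linear_form a"
    by (simp add: sum_subtractf linear_form_def const_mult[symmetric] mult.assoc[symmetric])
  finally show ?thesis by (simp add: linear_form_diff linear_form_smult)
qed

lemma subst_eliminate_congruent:
  "linear_form a dvd p - subst (eliminate a k) p"
proof -
  have "\<exists>c d. var i - eliminate a k i = linear_form a * c + 0 * d" for i
    by (cases "i = k") (auto simp: eliminate_def intro: exI[of _ 0] exI[of _ "const (1 / a $ k)"])
  from subst_congruent[OF this, of p] show ?thesis by auto
qed

text \<open>The substitution kills the form and is congruent to the identity modulo it, so its
  kernel is the ideal generated by the form.\<close>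

lemma linear_form_dvd_iff:
  assumes "a $ k \<noteq> 0"
  shows "linear_form a dvd p \<longleftrightarrow> subst (eliminate a k) p = 0"
proof
  assume "linear_form a dvd p"
  then obtain q where "p = linear_form a * q" ..
  then show "subst (eliminate a k) p = 0"
    using assms by (simp add: subst_mult subst_eliminate_linear_form)
next
  assume "subst (eliminate a k) p = 0"
  then show "linear_form a dvd p"
    using subst_eliminate_congruent[of a p k] by simp
qed

lemma nonzero_component: "(a :: 'a::zero ^ 'n) \<noteq> 0 \<Longrightarrow> \<exists>k. a $ k \<noteq> 0"
  by (auto simp: vec_eq_iff)

text \<open>The form generates the kernel of a ring homomorphism into a domain, hence it is
  prime.\<close>

lemma linear_form_dvd_mult:
  assumes "a \<noteq> 0" "linear_form a dvd p * q"
  shows "linear_form a dvd p \<or> linear_form a dvd q"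
proof -
  obtain k where k: "a $ k \<noteq> 0" using nonzero_component[OF assms(1)] by blast
  show ?thesis using assms(2) by (simp add: linear_form_dvd_iff[OF k] subst_mult)
qed

lemma linear_form_dvd_prod:
  assumes "a \<noteq> 0" "finite S" "linear_form a dvd prod f S"
  shows "\<exists>i\<in>S. linear_form a dvd f i"
  using assms(2,3)
proof (induction S)
  case empty
  then obtain q where q: "linear_form a * q = 1" by (auto simp: dvd_def)
  obtain k where k: "a $ k \<noteq> 0" using nonzero_component[OF assms(1)] by blast
  have "subst (eliminate a k) 1 = 0"
    using linear_form_dvd_iff[OF k, of 1] q by (metis dvd_triv_left)
  then show ?case by simp
qed (use linear_form_dvd_mult[OF assms(1)] in auto)

lemma linear_form_dvd_linear_form:
  assumes "a \<noteq> 0" "linear_form a dvd linear_form b"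
  obtains c where "b = c *s a"
proof -
  obtain k where k: "a $ k \<noteq> 0" using nonzero_component[OF assms(1)] by blast
  have "b = (b $ k / a $ k) *s a"
    using assms(2) by (simp add: linear_form_dvd_iff[OF k] subst_eliminate_linear_form[OF k])
  then show ?thesis using that by blast
qed

section \<open>Derivations\<close>

definition deriv :: "'k::field_char_0 poly3 ^ 3 \<Rightarrow> 'k poly3 \<Rightarrow> 'k poly3" where
  "deriv f p = (\<Sum>i\<in>UNIV. f $ i * partial i p)"

lemma deriv_mult: "deriv f (p * q) = deriv f p * q + p * deriv f q"
  by (simp add: deriv_def partial_mult sum.distrib[symmetric] sum_distrib_left sum_distrib_right
      algebra_simps)

lemma deriv_add_left: "deriv (f + g) p = deriv f p + deriv g p"
  by (simp add: deriv_def sum.distrib distrib_right)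

lemma deriv_diff_left: "deriv (f - g) p = deriv f p - deriv g p"
  by (simp add: deriv_def sum_subtractf left_diff_distrib)

lemma deriv_smult_left: "deriv (q *s f) p = q * deriv f p"
  by (simp add: deriv_def sum_distrib_left mult.assoc)

lemma deriv_0_left [simp]: "deriv 0 p = 0"
  by (simp add: deriv_def)

lemma deriv_linear_form: "deriv f (linear_form a) = dot (cvec a) f"
  by (simp add: deriv_def partial_linear_form dot_def mult.commute)

lemma deriv_prod_eq_0:
  "(\<And>i. i \<in> S \<Longrightarrow> deriv f (g i) = 0) \<Longrightarrow> deriv f (prod g S) = 0"
  by (induction S rule: infinite_finite_induct) (auto simp: deriv_mult, simp_all add: deriv_def)

lemma homogeneous_deriv:
  assumes "homogeneous_vec m f" "homogeneous n p" "m + n - 1 = k"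
  shows "homogeneous k (deriv f p)"
  unfolding deriv_def
proof (rule homogeneous_sum)
  fix i
  have "homogeneous (m + (n - 1)) (f $ i * partial i p)"
    using assms by (intro homogeneous_mult homogeneous_partial) (simp_all add: homogeneous_vec_def)
  then show "homogeneous k (f $ i * partial i p)"
    using assms(3) by (simp add: algebra_simps)
qed

lemma deriv_euler: "homogeneous (int d) p \<Longrightarrow> deriv euler p = of_nat d * p"
  using euler_identity[of d p] by (simp add: deriv_def)

lemma D0_iff: "f \<in> D0 A \<longleftrightarrow> deriv f (defining_poly A) = 0"
  by (simp add: D0_def deriv_def)

lemma submodule_D0: "submodule (D0 A)"
  by (simp add: submodule_def D0_iff deriv_add_left deriv_smult_left)

section \<open>Lines, their forms, and the module \<open>D0\<close>\<close>

lemma line_coeffs: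
  assumes "is_line H"
  shows "line_coeffs H \<noteq> 0" "zero_plane (line_coeffs H) = H"
  using someI_ex[OF assms[unfolded is_line_def]] by (auto simp: line_coeffs_def)

lemma mem_zero_plane: "v \<in> zero_plane a \<longleftrightarrow> dot a v = 0"
  by (simp add: zero_plane_def dot_def)

abbreviation line_form :: "('k::field_char_0 ^ 3) set \<Rightarrow> 'k poly3" where
  "line_form H \<equiv> linear_form (line_coeffs H)"

lemma line_form_not_dvd:
  assumes "is_line H" "is_line K" "H \<noteq> K"
  shows "\<not> line_form H dvd line_form K"
proof
  assume "line_form H dvd line_form K"
  then obtain c where c: "line_coeffs K = c *s line_coeffs H"
    using linear_form_dvd_linear_form[OF line_coeffs(1)[OF assms(1)]] by blast
  then have "c \<noteq> 0" using line_coeffs(1)[OF assms(2)] by auto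
  then have "zero_plane (line_coeffs K) = zero_plane (line_coeffs H)"
    by (auto simp: mem_zero_plane c dot_commute[of "_ *s _"] dot_smult_right dot_commute)
  then show False using line_coeffs(2) assms by metis
qed

lemma homogeneous_prod_line_form:
  "homogeneous (int (card S)) (prod line_form S)"
  using homogeneous_prod[of S "\<lambda>_. 1" line_form] by simp

lemma prod_line_form_neq_0: "(\<And>K. K \<in> S \<Longrightarrow> is_line K) \<Longrightarrow> prod line_form S \<noteq> 0"
  using line_coeffs(1) by (cases "finite S") auto

lemma line_form_not_dvd_prod:
  assumes "is_line H" "finite S" "\<And>K. K \<in> S \<Longrightarrow> is_line K" "H \<notin> S"
  shows "\<not> line_form H dvd prod line_form S"
  using linear_form_dvd_prod[OF line_coeffs(1)[OF assms(1)] assms(2)] line_form_not_dvd[OF assms(1)]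
    assms(3,4) by metis

text \<open>E(Q) = d Q, where the number d of lines is invertible in characteristic zero.
  Subtracting (g / d) E therefore removes f(Q) = g Q.\<close>

lemma D0_correction:
  assumes A: "line_arrangement A" and "A \<noteq> {}" and g: "deriv f (defining_poly A) = defining_poly A * g"
  shows "f - (const (1 / of_nat (card A)) * g) *s euler \<in> D0 A"
proof -
  let ?d = "card A"
  have fin: "finite A" using A by (simp add: line_arrangement_def)
  then have d: "(of_nat ?d :: 'a) \<noteq> 0" using assms(2) by simp
  have "const (1 / of_nat ?d) * of_nat ?d = (1 :: 'a poly3)"
    using d by (simp add: const_of_nat[symmetric] const_mult[symmetric] del: of_nat_eq_0_iff)
  moreover have "deriv euler (defining_poly A) = of_nat ?d * defining_poly A"
    unfolding defining_poly_def by (intro deriv_euler homogeneous_prod_line_form)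
  ultimately show ?thesis
    by (simp add: D0_iff deriv_diff_left deriv_smult_left g ac_simps)
qed

lemma D0_euler_eq_0:
  assumes A: "line_arrangement A" and "A \<noteq> {}" and "p *s euler \<in> D0 A"
  shows "p = 0"
proof -
  have fin: "finite A" using A by (simp add: line_arrangement_def)
  have "defining_poly A \<noteq> 0"
    unfolding defining_poly_def using A by (intro prod_line_form_neq_0) (simp add: line_arrangement_def)
  moreover have "deriv euler (defining_poly A) = of_nat (card A) * defining_poly A"
    unfolding defining_poly_def by (intro deriv_euler homogeneous_prod_line_form)
  ultimately show ?thesis
    using assms(2,3) fin by (simp add: D0_iff deriv_smult_left)
qed

text \<open>By the product rule the form of \<open>K\<close> divides its own derivative times the
  product of the other forms, and it is coprime to that product. Geometrically, \<open>f\<close> is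
  tangent to each line.\<close>

lemma D0_line_dvd:
  assumes A: "line_arrangement A" and f: "f \<in> D0 A" and K: "K \<in> A"
  shows "line_form K dvd dot (cvec (line_coeffs K)) f"
proof -
  have fin: "finite A" and lines: "\<And>K. K \<in> A \<Longrightarrow> is_line K"
    using A by (simp_all add: line_arrangement_def)
  let ?P = "prod line_form (A - {K})"
  have "defining_poly A = line_form K * ?P"
    unfolding defining_poly_def by (rule prod.remove[OF fin K])
  then have "dot (cvec (line_coeffs K)) f * ?P + line_form K * deriv f ?P = 0"
    using f by (simp add: D0_iff deriv_mult deriv_linear_form)
  then have "line_form K dvd dot (cvec (line_coeffs K)) f * ?P"
    by (metis add_eq_0_iff dvd_minus_iff dvd_triv_left)
  moreover have "\<not> line_form K dvd ?P"
    by (rule line_form_not_dvd_prod) (use fin lines K in auto)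
  ultimately show ?thesis
    using linear_form_dvd_mult[OF line_coeffs(1)[OF lines[OF K]]] by blast
qed

lemma prod_line_form_dvd_cancel:
  assumes "is_line H" "finite S" "\<And>K. K \<in> S \<Longrightarrow> is_line K" "H \<notin> S"
    and "prod line_form S dvd line_form H * p"
  shows "prod line_form S dvd p"
proof -
  obtain q where q: "line_form H * p = prod line_form S * q" using assms(5) ..
  then have "line_form H dvd prod line_form S * q" by (metis dvd_triv_left)
  then have "line_form H dvd q"
    using linear_form_dvd_mult[OF line_coeffs(1)[OF assms(1)]] line_form_not_dvd_prod[OF assms(1-4)]
    by blast
  then obtain r where "q = line_form H * r" ..
  then have "line_form H * p = line_form H * (prod line_form S * r)" using q by (simp add: ac_simps)
  then have "p = prod line_form S * r" using line_coeffs(1)[OF assms(1)] by simp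
  then show ?thesis by simp
qed

text \<open>The Koszul syzygy of two partial derivatives, or a coordinate field if one of them is zero.\<close>

lemma D0_nonzero_element:
  assumes "line_arrangement A"
  obtains f n where "f \<in> D0 A" "homogeneous_vec n f" "f \<noteq> 0"
proof -
  let ?Q = "defining_poly A"
  let ?d = "int (card A)"
  have Q: "homogeneous ?d ?Q"
    unfolding defining_poly_def by (rule homogeneous_prod_line_form)
  show ?thesis
  proof (cases "partial 0 ?Q = 0")
    case True
    show ?thesis
    proof (rule that[of "axis 0 1" 0])
      show "axis 0 1 \<in> D0 A"
        using True by (simp add: D0_iff deriv_def sum_three axis_def)
    qed (simp_all add: homogeneous_vec_def axis_def vec_eq_iff)
  next
    case False
    let ?f = "(\<chi> i. if i = 0 then partial 1 ?Q else if i = 1 then - partial 0 ?Q else 0) :: 'a poly3 ^ 3"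
    show ?thesis
    proof (rule that[of ?f "?d - 1"])
      show "?f \<in> D0 A" by (simp add: D0_iff deriv_def sum_three)
      show "homogeneous_vec (?d - 1) ?f"
        using homogeneous_partial[OF Q] by (simp add: homogeneous_vec_def)
      have "?f $ 1 \<noteq> 0" using False by simp
      then show "?f \<noteq> 0" by (metis zero_index)
    qed
  qed
qed

section \<open>The addition of a line\<close>

text \<open>A homogeneous ideal given by its parts \<open>G n\<close> of degree n, so that each
  membership records a degree.\<close>

definition graded_ideal :: "(int \<Rightarrow> 'k::field_char_0 poly3 set) \<Rightarrow> bool" where
  "graded_ideal G \<longleftrightarrow> (\<forall>n. \<forall>s\<in>G n. \<forall>t\<in>G n. s + t \<in> G n)
    \<and> (\<forall>n m p. \<forall>s\<in>G n. homogeneous m p \<longrightarrow> p * s \<in> G (n + m))"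

lemma graded_ideal_add: "graded_ideal G \<Longrightarrow> s \<in> G n \<Longrightarrow> t \<in> G n \<Longrightarrow> s + t \<in> G n"
  and graded_ideal_mult:
    "graded_ideal G \<Longrightarrow> s \<in> G n \<Longrightarrow> homogeneous m p \<Longrightarrow> n + m = k \<Longrightarrow> p * s \<in> G k"
  unfolding graded_ideal_def by blast+

text \<open>The second line makes \<open>c0\<close> different from 1, on which the injectivity of
  \<open>Phi\<close> rests, and ensures that \<open>H\<close> carries at least one point of the
  restriction.\<close>

locale triple =
  fixes A :: "('k::field_char_0 ^ 3) set set" and H :: "('k ^ 3) set"
  assumes arrangement: "line_arrangement A" and H: "H \<in> A" and nonempty: "A - {H} \<noteq> {}"
begin

definition \<alpha> :: "'k ^ 3" where "\<alpha> = line_coeffs H"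
definition B :: "('k ^ 3) set set" where "B = A - {H}"
text \<open>A pivot: modulo \<open>l\<close> the variable x_k is a combination of the other
  two.\<close>

definition k :: 3 where "k = (SOME k. \<alpha> $ k \<noteq> 0)"
definition l :: "'k poly3" where "l = linear_form \<alpha>"

lemma finite_A: "finite A" and lines: "K \<in> A \<Longrightarrow> is_line K"
  using arrangement by (simp_all add: line_arrangement_def)

lemma arrangement_B: "line_arrangement B"
  using arrangement by (simp add: line_arrangement_def B_def)

lemma B_subset: "K \<in> B \<Longrightarrow> K \<in> A" and finite_B: "finite B" and H_notin_B: "H \<notin> B"
  and B_nonempty: "B \<noteq> {}" and A_nonempty: "A \<noteq> {}"
  using finite_A nonempty H by (auto simp: B_def)

lemma \<alpha>_neq_0: "\<alpha> \<noteq> 0"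
  using line_coeffs(1)[OF lines[OF H]] by (simp add: \<alpha>_def)

lemma \<alpha>_k: "\<alpha> $ k \<noteq> 0"
  unfolding k_def using nonzero_component[OF \<alpha>_neq_0] by (rule someI_ex)

lemma l_neq_0 [simp]: "l \<noteq> 0"
  using \<alpha>_neq_0 by (simp add: l_def)

lemma l_eq: "l = line_form H" and l_dot: "l = dot (cvec \<alpha>) euler"
  by (simp_all add: l_def \<alpha>_def linear_form_dot)

lemma homogeneous_l [simp]: "homogeneous 1 l"
  by (simp add: l_def)

lemma card_A: "card A = Suc (card B)"
  unfolding B_def by (rule card.remove[OF finite_A H])

lemma defining_poly_A: "defining_poly A = l * defining_poly B"
  unfolding defining_poly_def B_def l_eq by (rule prod.remove[OF finite_A H])

section \<open>The embedding of the smaller module and its cokernel\<close>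

definition c0 :: 'k where "c0 = 1 / of_nat (card A)"

definition phi :: "'k poly3 ^ 3 \<Rightarrow> 'k poly3 ^ 3" where
  "phi f = l *s f - (const c0 * dot (cvec \<alpha>) f) *s euler"

text \<open>Since f kills Q', applying l f to Q = l Q' gives f(l) Q, and the Euler correction
  removes this.\<close>

lemma phi_D0:
  assumes "f \<in> D0 B"
  shows "phi f \<in> D0 A"
proof -
  have "deriv (l *s f) (defining_poly A) = defining_poly A * dot (cvec \<alpha>) f"
    using assms
    by (simp add: D0_iff defining_poly_A deriv_smult_left deriv_mult l_def deriv_linear_form
        dot_smult_right ac_simps)
  from D0_correction[OF arrangement A_nonempty this] show ?thesis
    by (simp add: phi_def c0_def)
qed

lemma homogeneous_dot_cvec: "homogeneous_vec n f \<Longrightarrow> homogeneous n (dot (cvec a) f)"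
  by (simp add: dot_three homogeneous_vec_def homogeneous_add homogeneous_const_mult)

lemma homogeneous_phi:
  assumes "homogeneous_vec n f"
  shows "homogeneous_vec (n + 1) (phi f)"
proof -
  have "homogeneous_vec (n + 1) (l *s f)"
    by (rule homogeneous_vec_smult[OF homogeneous_l assms refl])
  moreover have "homogeneous_vec (n + 1) ((const c0 * dot (cvec \<alpha>) f) *s euler)"
    by (rule homogeneous_vec_smult[OF homogeneous_const_mult[OF homogeneous_dot_cvec[OF assms]]
          homogeneous_vec_euler]) simp
  ultimately show ?thesis
    by (simp add: phi_def homogeneous_vec_def homogeneous_diff)
qed

text \<open>On \<open>H\<close> both \<open>f\<close> and the Euler field are tangent, so their cross product is a multiple of
  \<open>\<alpha>\<close> there; \<open>w f\<close> is that multiple up to a constant.\<close>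

definition w :: "'k poly3 ^ 3 \<Rightarrow> 'k poly3" where
  "w f = cross f euler $ k"

lemma w_add: "w (f + g) = w f + w g" and w_diff: "w (f - g) = w f - w g"
  and w_smult: "w (p *s f) = p * w f" and w_euler: "w euler = 0"
  by (simp_all add: w_def cross_add_left cross_diff_left cross_smult_left cross_self)

lemma homogeneous_w:
  assumes "homogeneous_vec n f"
  shows "homogeneous (n + 1) (w f)"
proof -
  have h: "homogeneous (n + 1) (f $ i * var j)" for i j
    using assms by (intro homogeneous_mult) (simp_all add: homogeneous_vec_def)
  show ?thesis
    using h by (auto simp: w_def cross_def homogeneous_diff)
qed

lemma D0_dvd:
  assumes "f \<in> D0 A"
  shows "l dvd dot (cvec \<alpha>) f"
  using D0_line_dvd[OF arrangement assms H] by (simp add: l_def \<alpha>_def)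

lemma l_dvd_cancel: "l dvd p * q \<Longrightarrow> l dvd p \<or> l dvd q"
  unfolding l_def by (rule linear_form_dvd_mult[OF \<alpha>_neq_0])

lemma l_not_dvd_const_mult: "c \<noteq> 0 \<Longrightarrow> l dvd const c * p \<Longrightarrow> l dvd p"
proof -
  assume "c \<noteq> 0" "l dvd const c * p"
  then have "l dvd const (1 / c) * (const c * p)" by (simp add: dvd_mult)
  then show "l dvd p" using \<open>c \<noteq> 0\<close> by (simp add: mult.assoc[symmetric] const_mult[symmetric])
qed

text \<open>The cross product of \<alpha> with that of f and E is l f - f(l) E, which vanishes
  modulo \<open>l\<close>. So the cross product of f and E is parallel to \<alpha> there, and its
  component at the pivot controls the others.\<close>

lemma w_dvd_cross:
  assumes f: "f \<in> D0 A" and "l dvd w f"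
  shows "l dvd cross f euler $ m"
proof -
  have "l dvd (dot (cvec \<alpha>) euler *s f - dot (cvec \<alpha>) f *s euler) $ m" for m
    using D0_dvd[OF f] by (simp add: l_dot[symmetric] dvd_diff)
  then have "l dvd cross (cvec \<alpha>) (cross f euler) $ m" for m
    by (simp add: cross_cross)
  from cross_divides_minors[OF this, of k m]
  have "l dvd const (\<alpha> $ k) * cross f euler $ m - const (\<alpha> $ m) * w f"
    by (simp add: w_def)
  then have "l dvd const (\<alpha> $ k) * cross f euler $ m"
    using assms(2) by (metis dvd_diff_left_iff dvd_mult)
  then show ?thesis using l_not_dvd_const_mult[OF \<alpha>_k] by blast
qed

lemma other_indices:
  obtains i j :: 3 where "i \<noteq> k" "j \<noteq> k" "i \<noteq> j"
proof -
  have "\<exists>i j. i \<noteq> k \<and> j \<noteq> k \<and> i \<noteq> j"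
    by (metis three_distinct(1,2,3))
  then show ?thesis using that by blast
qed

text \<open>Modulo \<open>l\<close> the field is parallel to E. The two variables other than x_k
  remain coprime after elimination, so the factor of proportionality is a polynomial.\<close>

lemma kernel_form:
  assumes f: "f \<in> D0 A" "homogeneous_vec n f" and "l dvd w f"
  obtains q g where "homogeneous (n - 1) q" "homogeneous_vec (n - 1) g" "f = q *s euler + l *s g"
proof -
  obtain i j where ij: "i \<noteq> k" "j \<noteq> k" "i \<noteq> j" by (rule other_indices)
  let ?\<sigma> = "subst (eliminate \<alpha> k)"
  have \<sigma>: "l dvd p \<longleftrightarrow> ?\<sigma> p = 0" for p
    unfolding l_def by (rule linear_form_dvd_iff[OF \<alpha>_k])
  have \<sigma>_var: "eliminate \<alpha> k i = var i" "eliminate \<alpha> k j = var j"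
    using ij by (simp_all add: eliminate_def)
  have "l dvd f $ a * euler $ b - f $ b * euler $ a" for a b
    by (rule cross_divides_minors[OF w_dvd_cross[OF f(1) assms(3)]])
  then have minors: "?\<sigma> (f $ a) * ?\<sigma> (var b) = ?\<sigma> (f $ b) * ?\<sigma> (var a)" for a b
    by (simp add: \<sigma> subst_diff subst_mult)
  have var_axis: "var a = linear_form (axis a 1)" for a :: 3
    by (simp add: linear_form_def axis_def if_distrib[of const] if_distrib[of "\<lambda>x. x * _"] cong: if_cong)
  have "\<not> linear_form (axis i 1) dvd linear_form (axis j (1::'k))"
  proof
    assume "linear_form (axis i 1) dvd linear_form (axis j (1::'k))"
    then obtain c where "axis j (1::'k) = c *s axis i 1"
      using linear_form_dvd_linear_form[of "axis i (1::'k)" "axis j 1"] by (auto simp: axis_eq_0_iff)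
    then have "axis j (1::'k) $ j = (c *s axis i 1) $ j" by simp
    then show False using ij by (simp add: axis_def)
  qed
  moreover have "linear_form (axis i 1) dvd ?\<sigma> (f $ i) * linear_form (axis j (1::'k))"
    using minors[of i j] by (simp add: \<sigma>_var var_axis[symmetric])
  ultimately have "linear_form (axis i 1) dvd ?\<sigma> (f $ i)"
    using linear_form_dvd_mult[of "axis i 1"] by (auto simp: axis_eq_0_iff)
  then obtain q where q: "?\<sigma> (f $ i) = var i * q" by (auto simp: var_axis dvd_def)
  have f\<sigma>: "?\<sigma> (f $ m) = q * ?\<sigma> (var m)" for m
  proof -
    have "var i * ?\<sigma> (f $ m) = var i * (q * ?\<sigma> (var m))"
      using minors[of m i] by (simp add: \<sigma>_var q ac_simps)
    then show ?thesis by simp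
  qed
  have dvd: "l dvd p - ?\<sigma> p" for p
    unfolding l_def by (rule subst_eliminate_congruent)
  have "\<exists>h. f $ m = q * var m + l * h" for m
  proof -
    have "l dvd (f $ m - ?\<sigma> (f $ m)) - q * (var m - ?\<sigma> (var m))"
      by (intro dvd_diff dvd_mult dvd)
    then have "l dvd f $ m - q * var m"
      unfolding f\<sigma> by (simp add: algebra_simps)
    then obtain h where "f $ m - q * var m = l * h" ..
    then show ?thesis by (auto simp: diff_eq_eq add.commute)
  qed
  then obtain h where h: "\<And>m. f $ m = q * var m + l * h m" by metis
  show ?thesis
  proof (rule that[of "hcomp (n - 1) q" "\<chi> m. hcomp (n - 1) (h m)"])
    show "f = hcomp (n - 1) q *s euler + l *s (\<chi> m. hcomp (n - 1) (h m))"
    proof (simp add: vec_eq_iff, intro allI)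
      fix m
      have "f $ m = hcomp n (f $ m)"
        using f(2) by (simp add: homogeneous_vec_def hcomp_homogeneous)
      also have "\<dots> = hcomp n (var m * q) + hcomp n (l * h m)"
        by (simp add: h hcomp_add mult.commute)
      also have "\<dots> = var m * hcomp (n - 1) q + l * hcomp (n - 1) (h m)"
        by (simp add: hcomp_mult[OF homogeneous_var] hcomp_mult[OF homogeneous_l])
      finally show "f $ m = hcomp (n - 1) q * var m + l * hcomp (n - 1) (h m)"
        by (simp add: mult.commute)
    qed
  qed (simp_all add: homogeneous_vec_def)
qed

text \<open>Exactness in the middle. With f = q E + l g, dividing f(Q) = 0 by \<open>l\<close> shows
  that Q' divides l g(Q'). As \<open>l\<close> is coprime to Q', the field g preserves the ideal of
  Q' and can be corrected by a multiple of E.\<close>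

lemma kernel_phi:
  assumes f: "f \<in> D0 A" "homogeneous_vec n f" and "l dvd w f"
  obtains g where "g \<in> D0 B" "homogeneous_vec (n - 1) g" "phi g = f"
proof -
  obtain q g where q: "homogeneous (n - 1) q" and g: "homogeneous_vec (n - 1) g"
    and f_eq: "f = q *s euler + l *s g"
    by (rule kernel_form[OF assms])
  let ?P = "defining_poly B"
  have P: "?P = prod line_form B" by (simp add: defining_poly_def)
  have linesB: "K \<in> B \<Longrightarrow> is_line K" for K using lines B_subset by blast
  have homP: "homogeneous (int (card B)) ?P"
    unfolding P by (rule homogeneous_prod_line_form)
  have P0: "?P \<noteq> 0" unfolding P by (rule prod_line_form_neq_0[OF linesB])
  have "deriv euler (defining_poly A) = of_nat (card A) * defining_poly A"
    unfolding defining_poly_def by (intro deriv_euler homogeneous_prod_line_form)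
  then have "l * (q * of_nat (card A) * ?P + deriv g (defining_poly A)) = 0"
    using f(1)
    by (simp add: D0_iff f_eq deriv_add_left deriv_smult_left defining_poly_A[symmetric] algebra_simps)
      (simp add: defining_poly_A algebra_simps)
  then have "q * of_nat (card A) * ?P + (dot (cvec \<alpha>) g * ?P + l * deriv g ?P) = 0"
    by (simp add: defining_poly_A deriv_mult l_def deriv_linear_form \<alpha>_neq_0)
  then have "l * deriv g ?P = - (q * of_nat (card A) * ?P + dot (cvec \<alpha>) g * ?P)"
    unfolding eq_neg_iff_add_eq_0 by (simp add: ac_simps)
  also have "\<dots> = ?P * - (q * of_nat (card A) + dot (cvec \<alpha>) g)"
    by (simp add: algebra_simps)
  finally have "?P dvd l * deriv g ?P" by (rule dvdI)
  then have "?P dvd deriv g ?P"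
    unfolding P l_eq
    using prod_line_form_dvd_cancel[OF lines[OF H] finite_B _ H_notin_B] linesB by blast
  then obtain r where r: "deriv g ?P = ?P * r" ..
  have "homogeneous (n - 1 + int (card B) - 1) (?P * r)"
    unfolding r[symmetric] by (rule homogeneous_deriv[OF g homP refl])
  from homogeneous_cancel[OF homP P0 this] have homr: "homogeneous (n - 2) r" by simp
  define h where "h = g - (const (1 / of_nat (card B)) * r) *s euler"
  have hD: "h \<in> D0 B"
    unfolding h_def by (rule D0_correction[OF arrangement_B B_nonempty r])
  have "homogeneous_vec (n - 1) ((const (1 / of_nat (card B)) * r) *s euler)"
    by (rule homogeneous_vec_smult[OF homogeneous_const_mult[OF homr] homogeneous_vec_euler]) simp
  then have hh: "homogeneous_vec (n - 1) h"
    using g by (simp add: h_def homogeneous_vec_def homogeneous_diff)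
  \<comment> \<open>The coefficient itself does not matter: a multiple of E that lies in
    \<open>D0 A\<close> is zero.\<close>
  have "\<exists>p. phi h - f = p *s euler"
    by (rule exI[of _ "- q - l * (const (1 / of_nat (card B)) * r) - const c0 * dot (cvec \<alpha>) h"])
      (simp add: phi_def f_eq h_def[of] vec_eq_iff algebra_simps)
  then obtain p where p: "phi h - f = p *s euler" by blast
  have "p *s euler \<in> D0 A"
    using phi_D0[OF hD] f(1) by (simp add: p[symmetric] D0_iff deriv_diff_left)
  then have "p = 0"
    by (rule D0_euler_eq_0[OF arrangement A_nonempty])
  then have "phi h = f" using p by simp
  then show ?thesis by (rule that[OF hD hh])
qed

subsection \<open>The points on the line\<close>

text \<open>A representative vector of the point where \<open>H\<close> and \<open>K\<close> meet,
  being orthogonal to both coefficient vectors.\<close>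

definition pt :: "('k ^ 3) set \<Rightarrow> 'k ^ 3" where
  "pt K = cross \<alpha> (line_coeffs K)"

lemma mem_H: "v \<in> H \<longleftrightarrow> dot \<alpha> v = 0"
  using line_coeffs(2)[OF lines[OF H]] by (metis mem_zero_plane \<alpha>_def)

lemma mem_line: "K \<in> A \<Longrightarrow> v \<in> K \<longleftrightarrow> dot (line_coeffs K) v = 0"
  using line_coeffs(2)[OF lines] by (metis mem_zero_plane)

lemma pt_mem: "K \<in> B \<Longrightarrow> pt K \<in> H \<inter> K"
  by (simp add: mem_H mem_line[OF B_subset] pt_def)

lemma pt_neq_0:
  assumes "K \<in> B"
  shows "pt K \<noteq> 0"
proof
  assume "pt K = 0"
  then have "cross \<alpha> (line_coeffs K) = 0" by (simp add: pt_def)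
  then have "\<alpha> $ k * line_coeffs K $ m = \<alpha> $ m * line_coeffs K $ k" for m
    by (rule cross_eq_0_minors)
  then have "line_coeffs K = (line_coeffs K $ k / \<alpha> $ k) *s \<alpha>"
    using \<alpha>_k by (simp add: vec_eq_iff nonzero_eq_divide_eq ac_simps)
  then have "line_form K = const (line_coeffs K $ k / \<alpha> $ k) * l"
    by (metis l_def linear_form_smult)
  then have "line_form H dvd line_form K" by (simp add: l_eq)
  then show False
    using line_form_not_dvd[OF lines[OF H] lines[OF B_subset[OF assms]]] assms H_notin_B by blast
qed

lemma pt_span:
  assumes "K \<in> B" "v \<in> H \<inter> K"
  shows "v $ i * pt K $ j = v $ j * pt K $ i"
proof (rule cross_eq_0_minors)
  show "cross v (pt K) = 0"
    using assms by (simp add: pt_def cross_cross mem_H mem_line[OF B_subset] dot_commute)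
qed

lemma pt_mem_iff:
  assumes "K \<in> B" "L \<in> B"
  shows "dot (line_coeffs L) (pt K) = 0 \<longleftrightarrow> H \<inter> L = H \<inter> K"
proof
  have sub: "H \<inter> K \<subseteq> L" if K: "K \<in> B" and L: "L \<in> B" and 0: "dot (line_coeffs L) (pt K) = 0" for K L
  proof
    fix v assume v: "v \<in> H \<inter> K"
    obtain j where j: "pt K $ j \<noteq> 0" using nonzero_component[OF pt_neq_0[OF K]] by blast
    have "pt K $ j * dot (line_coeffs L) v = (\<Sum>i\<in>UNIV. line_coeffs L $ i * (v $ i * pt K $ j))"
      by (simp add: dot_def sum_distrib_left ac_simps)
    also have "\<dots> = v $ j * dot (line_coeffs L) (pt K)"
      unfolding pt_span[OF K v, of _ j] by (simp add: dot_def sum_distrib_left ac_simps)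
    finally show "v \<in> L" using j 0 by (simp add: mem_line[OF B_subset[OF L]])
  qed
  assume 0: "dot (line_coeffs L) (pt K) = 0"
  \<comment> \<open>The condition is the vanishing of a determinant, hence symmetric in
    \<open>K\<close> and \<open>L\<close>; this yields the reverse inclusion.\<close>
  then have "dot (line_coeffs K) (pt L) = 0"
    unfolding pt_def by (subst dot_cross_swap) simp
  then show "H \<inter> L = H \<inter> K"
    using sub[OF assms 0] sub[OF assms(2,1)] by blast
next
  assume "H \<inter> L = H \<inter> K"
  then show "dot (line_coeffs L) (pt K) = 0"
    using pt_mem[OF assms(1)] mem_line[OF B_subset[OF assms(2)]] by blast
qed

text \<open>\<open>H\<close>, \<open>K\<close>, \<open>L\<close> have no common point, so their
  forms are linearly independent and Cramer's rule applies.\<close>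

lemma var_combination:
  assumes "K \<in> B" "L \<in> B" "H \<inter> L \<noteq> H \<inter> K"
  obtains a b c where "var i = const a * l + const b * line_form K + const c * line_form L"
proof -
  let ?\<beta> = "line_coeffs K" and ?\<gamma> = "line_coeffs L"
  define D where "D = dot ?\<gamma> (cross \<alpha> ?\<beta>)"
  have D: "D \<noteq> 0" using pt_mem_iff[OF assms(1,2)] assms(3) by (simp add: D_def pt_def)
  have "(const D *s euler) $ i = (l *s cvec (cross ?\<beta> ?\<gamma>) + line_form K *s cvec (cross ?\<gamma> \<alpha>)
      + line_form L *s cvec (cross \<alpha> ?\<beta>)) $ i"
    using cramer_three[of "cvec ?\<gamma>" "cvec \<alpha>" "cvec ?\<beta>" euler]
    by (simp only: cross_cvec dot_cvec D_def l_dot linear_form_dot)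
  then have "const D * var i = const (cross ?\<beta> ?\<gamma> $ i) * l + const (cross ?\<gamma> \<alpha> $ i) * line_form K
      + const (cross \<alpha> ?\<beta> $ i) * line_form L"
    by (simp add: mult.commute)
  then have "const (1 / D) * (const D * var i) = const (1 / D) * (const (cross ?\<beta> ?\<gamma> $ i) * l
      + const (cross ?\<gamma> \<alpha> $ i) * line_form K + const (cross \<alpha> ?\<beta> $ i) * line_form L)"
    by simp
  then show ?thesis
    using D by (intro that) (simp add: distrib_left mult.assoc[symmetric] const_mult[symmetric])
qed

text \<open>The substitution restricts polynomials to the line through the point \<open>pt K\<close>, so it is
  the reduction modulo \<open>l\<close> and the form of \<open>K\<close>.\<close>

lemma point_substitution:
  assumes K: "K \<in> B"
  obtains y t where "t \<noteq> 0" "\<And>i. y i = const (pt K $ i) * t"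
    "\<And>p. subst y p = 0 \<Longrightarrow> \<exists>a b. p = l * a + line_form K * b"
proof -
  obtain m where m: "pt K $ m \<noteq> 0" using nonzero_component[OF pt_neq_0[OF K]] by blast
  define t where "t = const (1 / pt K $ m) * var m"
  define y where "y i = const (pt K $ i) * t" for i
  have "\<exists>a b. var i - y i = l * a + line_form K * b" for i
  proof -
    obtain c n where "euler $ i * cvec (pt K) $ m - euler $ m * cvec (pt K) $ i
        = c * cross euler (cvec (pt K)) $ n"
      using minor_eq_cross by blast
    also have "cross euler (cvec (pt K)) $ n
        = l * - const (line_coeffs K $ n) + line_form K * const (\<alpha> $ n)"
      by (simp add: pt_def cross_cvec[symmetric] cross_cross l_dot linear_form_dot
            dot_commute[of euler])
    finally obtain a b where "euler $ i * cvec (pt K) $ m - euler $ m * cvec (pt K) $ i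
        = l * a + line_form K * b"
      by (metis distrib_left mult.left_commute)
    then have "const (1 / pt K $ m) * (var i * const (pt K $ m) - var m * const (pt K $ i))
        = l * (const (1 / pt K $ m) * a) + line_form K * (const (1 / pt K $ m) * b)"
      by (simp add: distrib_left ac_simps)
    moreover have "const (1 / pt K $ m) * (var i * const (pt K $ m) - var m * const (pt K $ i))
        = const (1 / pt K $ m * pt K $ m) * var i - y i"
      unfolding y_def t_def const_mult by (simp add: algebra_simps)
    ultimately show ?thesis using m by auto
  qed
  from subst_congruent[OF this]
  have "subst y p = 0 \<Longrightarrow> \<exists>a b. p = l * a + line_form K * b" for p
    by (metis diff_zero)
  then show ?thesis
    using m by (intro that[of t y]) (simp_all add: t_def y_def)
qed

text \<open>One line through each point of the restriction. The forms of these lines stand in for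
  forms of the points, so everything stays in three variables.\<close>

definition C :: "('k ^ 3) set set" where
  "C = (SOME C. C \<subseteq> B \<and> inj_on ((\<inter>) H) C \<and> restriction A H = (\<inter>) H ` C)"

lemma C: "C \<subseteq> B" "inj_on ((\<inter>) H) C" "restriction A H = (\<inter>) H ` C"
proof -
  have "restriction A H \<subseteq> (\<inter>) H ` B"
    by (auto simp: restriction_def B_def)
  then have "\<exists>C. C \<subseteq> B \<and> inj_on ((\<inter>) H) C \<and> restriction A H = (\<inter>) H ` C"
    unfolding subset_image_inj by blast
  from someI_ex[OF this] show "C \<subseteq> B" "inj_on ((\<inter>) H) C" "restriction A H = (\<inter>) H ` C"
    by (simp_all add: C_def)
qed

lemma finite_C: "finite C"
  using C(1) finite_B finite_subset by blast

lemma representative: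
  assumes "K \<in> B"
  obtains L where "L \<in> C" "H \<inter> L = H \<inter> K"
proof -
  have "H \<inter> K \<in> restriction A H" using assms by (auto simp: restriction_def B_def)
  then show ?thesis using that by (auto simp: C(3))
qed

lemma C_nonempty: "C \<noteq> {}"
  using B_nonempty representative by blast

definition a :: int where "a = int (card (restriction A H)) - 1"

lemma a_eq: "a = int (card C) - 1"
  by (simp add: a_def C(3) card_image[OF C(2)])

text \<open>Modulo \<open>l\<close>, a defining polynomial of the set of points on
  \<open>H\<close>.\<close>

definition Q2 :: "'k poly3" where "Q2 = prod line_form C"

lemma lines_B: "K \<in> B \<Longrightarrow> is_line K"
  using lines B_subset by blast

lemma homogeneous_Q2: "homogeneous (a + 1) Q2"
  using homogeneous_prod_line_form[of C] by (simp add: Q2_def a_eq)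

lemma l_not_dvd_Q2: "\<not> l dvd Q2"
  unfolding Q2_def l_eq
  using C(1) H_notin_B lines_B by (intro line_form_not_dvd_prod[OF lines[OF H] finite_C]) auto

text \<open>At the point, f is tangent to \<open>H\<close> and to \<open>K\<close>, so its value is
  orthogonal to both coefficient vectors and thus parallel to \<open>pt K\<close>. So is the value
  of E, and the cross product vanishes.\<close>

lemma w_vanishes_at_points:
  assumes f: "f \<in> D0 A" and K: "K \<in> B" and y: "\<And>i. y i = const (pt K $ i) * t"
  shows "subst y (w f) = 0"
proof -
  let ?f = "\<chi> i. subst y (f $ i)"
  have dot: "subst y (dot (cvec b) f) = dot (cvec b) ?f" for b
    by (simp add: dot_three subst_add subst_mult)
  have form: "subst y (linear_form b) = const (dot b (pt K)) * t" for b
    by (simp add: subst_linear_form y dot_three sum_three const_simps algebra_simps)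
  have "dot (cvec b) ?f = 0" if b: "linear_form b dvd dot (cvec b) f" "dot b (pt K) = 0" for b
  proof -
    obtain g where "dot (cvec b) f = linear_form b * g" using b(1) unfolding dvd_def by blast
    then have "subst y (dot (cvec b) f) = 0" by (simp add: subst_mult form b(2))
    then show ?thesis by (simp add: dot)
  qed
  then have "dot (cvec \<alpha>) ?f = 0" "dot (cvec (line_coeffs K)) ?f = 0"
    using D0_dvd[OF f] D0_line_dvd[OF arrangement f B_subset[OF K]]
    by (simp_all add: l_def pt_def)
  then have "cross ?f (cvec (pt K)) = 0"
    by (simp add: pt_def cross_cvec[symmetric] cross_cross dot_commute[of ?f])
  then have "cross ?f (t *s cvec (pt K)) $ k = 0"
    by (simp add: vec3_eq_iff cross_def)
  moreover have "subst y (w f) = cross ?f (t *s cvec (pt K)) $ k"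
    by (simp add: w_def cross_def subst_diff subst_mult y ac_simps)
  ultimately show ?thesis by simp
qed

text \<open>One point is added at a time: the earlier forms do not vanish at the new point, so the
  cofactor \<open>b\<close> does, and it lies in the ideal of \<open>l\<close> and the new
  form.\<close>

lemma ideal_of_points:
  assumes "S \<subseteq> C" and p: "\<And>K y t. K \<in> C \<Longrightarrow> (\<And>i. y i = const (pt K $ i) * t) \<Longrightarrow> subst y p = 0"
  shows "\<exists>b e. p = prod line_form S * b + l * e"
  using finite_subset[OF assms(1) finite_C] assms(1)
proof (induction S)
  case empty
  show ?case by (intro exI[of _ p] exI[of _ 0]) simp
next
  case (insert K S)
  then obtain b e where be: "p = prod line_form S * b + l * e" by auto
  have K: "K \<in> C" "K \<in> B" using insert.prems C(1) by auto
  obtain y t where y: "t \<noteq> 0" "\<And>i. y i = const (pt K $ i) * t"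
    "\<And>p. subst y p = 0 \<Longrightarrow> \<exists>a b. p = l * a + line_form K * b"
    by (rule point_substitution[OF K(2)]) blast
  have form: "subst y (linear_form b) = const (dot b (pt K)) * t" for b
    by (simp add: subst_linear_form y(2) dot_three sum_three const_simps algebra_simps)
  have "dot (line_coeffs L) (pt K) \<noteq> 0" if "L \<in> S" for L
  proof -
    have "L \<in> C" "L \<noteq> K" using that insert by auto
    then have "H \<inter> L \<noteq> H \<inter> K" using C(2) K by (auto dest: inj_onD)
    then show ?thesis using pt_mem_iff[OF K(2)] \<open>L \<in> C\<close> C(1) by auto
  qed
  then have "subst y (prod line_form S) \<noteq> 0"
    using insert.hyps(1) y(1) by (simp add: subst_prod form)
  moreover have "subst y l = 0" by (simp add: l_def form pt_def)
  ultimately have "subst y b = 0"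
    using p[OF K(1) y(2)] by (simp add: be subst_add subst_mult)
  then obtain c d where "b = l * c + line_form K * d" using y(3) by blast
  then have "p = prod line_form (insert K S) * d + l * (e + prod line_form S * c)"
    using insert.hyps by (simp add: be algebra_simps)
  then show ?case by blast
qed

text \<open>The class of b modulo \<open>l\<close> is the image of f in the cokernel. Its degree is
  n - a because \<open>w f\<close> has degree n + 1 and \<open>Q2\<close> has degree a + 1.\<close>

lemma w_division:
  assumes f: "f \<in> D0 A" "homogeneous_vec n f"
  obtains b e where "homogeneous (n - a) b" "homogeneous n e" "w f = Q2 * b + l * e"
proof -
  have "\<exists>b e. w f = Q2 * b + l * e"
    unfolding Q2_def using C(1) by (intro ideal_of_points w_vanishes_at_points[OF f(1)]) auto
  then obtain b e where "w f = Q2 * b + l * e" by blast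
  from homogeneous_combination[OF homogeneous_Q2 homogeneous_l homogeneous_w[OF f(2)] this]
  show ?thesis using that by (metis add_diff_cancel_right add.commute add_diff_cancel_right')
qed

subsection \<open>Local surjectivity\<close>

text \<open>Forms of \<open>F\<close> are moved into \<open>s\<close> one by one. Since x_i is a
  combination of \<open>l\<close> and the forms of \<open>K\<close> and \<open>L\<close>, one
  further power of x_i removes the form of \<open>L\<close> again.\<close>

lemma ideal_coprime_lines:
  assumes G: "graded_ideal G" and lG: "\<And>n s. homogeneous n s \<Longrightarrow> l * s \<in> G (n + 1)"
    and K: "K \<in> B" and "finite F"
    and F: "\<And>L. L \<in> F \<Longrightarrow> L \<in> B \<and> H \<inter> L \<noteq> H \<inter> K"
    and s: "homogeneous n s" "line_form K * s \<in> G (n + 1)"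
      "prod line_form F * s \<in> G (n + int (card F))"
  shows "\<exists>M. var i ^ M * s \<in> G (n + int M)"
  using assms(4) F s
proof (induction F arbitrary: s n)
  case empty
  then show ?case by (intro exI[of _ 0]) simp
next
  case (insert L F)
  let ?s = "line_form L * s"
  have L: "L \<in> B" "H \<inter> L \<noteq> H \<inter> K" using insert.prems(1) by auto
  have hs: "homogeneous (n + 1) ?s"
    using homogeneous_mult[OF homogeneous_linear_form insert.prems(2)] by (simp add: add.commute)
  have "line_form K * ?s \<in> G (n + 1 + 1)"
    using graded_ideal_mult[OF G insert.prems(3), of 1 "line_form L"] by (simp add: mult.left_commute)
  moreover have "prod line_form F * ?s \<in> G (n + 1 + int (card F))"
    using insert.prems(4) insert.hyps by (simp add: ac_simps)
  ultimately obtain M where M: "var i ^ M * ?s \<in> G (n + 1 + int M)"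
    using insert.IH[OF _ hs] insert.prems(1) by blast
  have hx: "homogeneous (int M) (var i ^ M)"
    using homogeneous_power[OF homogeneous_var, of M] by simp
  let ?x = "var i ^ M * s"
  obtain c1 c2 c3 where c: "var i = const c1 * l + const c2 * line_form K + const c3 * line_form L"
    by (rule var_combination[OF K L])
  have "l * ?x \<in> G (n + int M + 1)"
    by (rule lG) (use homogeneous_mult[OF hx insert.prems(2)] in \<open>simp add: add.commute\<close>)
  then have "const c1 * (l * ?x) \<in> G (n + int M + 1)"
    using graded_ideal_mult[OF G _ homogeneous_const] by simp
  moreover have "const c2 * (var i ^ M * (line_form K * s)) \<in> G (n + int M + 1)"
    by (rule graded_ideal_mult[OF G graded_ideal_mult[OF G insert.prems(3) hx refl] homogeneous_const])
      simp
  moreover have "const c3 * (var i ^ M * ?s) \<in> G (n + int M + 1)"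
    by (rule graded_ideal_mult[OF G M homogeneous_const]) simp
  ultimately have "const c1 * (l * ?x) + const c2 * (var i ^ M * (line_form K * s))
      + const c3 * (var i ^ M * ?s) \<in> G (n + int M + 1)"
    by (intro graded_ideal_add[OF G])
  also have "const c1 * (l * ?x) + const c2 * (var i ^ M * (line_form K * s))
      + const c3 * (var i ^ M * ?s) = var i * ?x"
    by (subst c) (simp add: algebra_simps)
  finally show ?case
    by (intro exI[of _ "Suc M"]) (simp add: ac_simps)
qed

text \<open>When \<open>K\<close> leaves \<open>S\<close> and its form moves into \<open>s\<close>,
  the hypothesis persists at every point. The hypothesis at the point of \<open>K\<close> itself
  involves only lines meeting \<open>H\<close> elsewhere, so \<open>ideal_coprime_lines\<close> then
  removes the form of \<open>K\<close>.\<close>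

lemma ideal_lines_avoiding_points:
  assumes G: "graded_ideal G" and lG: "\<And>n s. homogeneous n s \<Longrightarrow> l * s \<in> G (n + 1)"
    and "finite S" "S \<subseteq> B" and s: "homogeneous n s"
      "\<And>p. p \<in> C \<Longrightarrow> prod line_form {L\<in>S. H \<inter> L \<noteq> H \<inter> p} * s
        \<in> G (n + int (card {L\<in>S. H \<inter> L \<noteq> H \<inter> p}))"
  shows "\<exists>M. var i ^ M * s \<in> G (n + int M)"
  using assms(3,4) s
proof (induction S arbitrary: s n)
  case empty
  then show ?case using C_nonempty by (intro exI[of _ 0]) auto
next
  case (insert K S)
  let ?F = "\<lambda>S p. {L\<in>S. H \<inter> L \<noteq> H \<inter> p}"
  have K: "K \<in> B" using insert.prems(1) by simp
  obtain p0 where p0: "p0 \<in> C" "H \<inter> p0 = H \<inter> K" by (rule representative[OF K])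
  have F_in: "?F (insert K S) p = ?F S p" if "H \<inter> p = H \<inter> K" for p using that by auto
  have F_out: "?F (insert K S) p = insert K (?F S p)" if "H \<inter> p \<noteq> H \<inter> K" for p using that by auto
  have fin: "finite (?F S p)" "K \<notin> ?F S p" for p using insert.hyps by auto
  let ?s = "line_form K * s"
  have hs: "homogeneous (n + 1) ?s"
    using homogeneous_mult[OF homogeneous_linear_form insert.prems(2)] by (simp add: add.commute)
  have "prod line_form (?F S p) * ?s \<in> G (n + 1 + int (card (?F S p)))" if p: "p \<in> C" for p
  proof (cases "H \<inter> p = H \<inter> K")
    case True
    have "prod line_form (?F S p) * s \<in> G (n + int (card (?F S p)))"
      using insert.prems(3)[OF p] by (simp only: F_in[OF True])
    from graded_ideal_mult[OF G this homogeneous_linear_form refl]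
    show ?thesis by (simp only: mult_ac add_ac)
  next
    case False
    have "prod line_form (insert K (?F S p)) * s = prod line_form (?F S p) * ?s"
      by (simp only: prod.insert[OF fin] mult_ac)
    moreover have "int (card (insert K (?F S p))) = 1 + int (card (?F S p))"
      by (simp only: card_insert_disjoint[OF fin] of_nat_Suc)
    ultimately show ?thesis
      using insert.prems(3)[OF p] by (simp only: F_out[OF False] add.assoc)
  qed
  then obtain M where M: "var i ^ M * ?s \<in> G (n + 1 + int M)"
    using insert.IH[OF _ hs] insert.prems(1) by blast
  have hx: "homogeneous (int M) (var i ^ M)"
    using homogeneous_power[OF homogeneous_var, of M] by simp
  let ?x = "var i ^ M * s"
  have "prod line_form (?F S p0) * s \<in> G (n + int (card (?F S p0)))"
    using insert.prems(3)[OF p0(1)] by (simp only: F_in[OF p0(2)])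
  from graded_ideal_mult[OF G this hx refl]
  have "prod line_form (?F S p0) * ?x \<in> G (n + int M + int (card (?F S p0)))"
    by (simp only: mult_ac add_ac)
  moreover have "line_form K * ?x \<in> G (n + int M + 1)"
    using M by (simp only: mult_ac add_ac)
  moreover have "homogeneous (n + int M) ?x"
    using homogeneous_mult[OF hx insert.prems(2)] by (simp add: add.commute)
  ultimately obtain M' where "var i ^ M' * ?x \<in> G (n + int M + int M')"
    using ideal_coprime_lines[OF G lG K fin(1)[of p0], of "n + int M" ?x i] insert.prems(1) p0(2) by auto
  then show ?case
    by (intro exI[of _ "M' + M"]) (simp add: power_add ac_simps)
qed

text \<open>The ideal of all s whose restriction to \<open>H\<close> is attained by a field defined
  on the whole plane. Surjectivity on the chart of x_i follows once it contains a power of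
  x_i.\<close>

definition hit :: "int \<Rightarrow> 'k poly3 set" where
  "hit n = {s. homogeneous n s
    \<and> (\<exists>f\<in>D0 A. homogeneous_vec (n + a) f \<and> (\<exists>e. w f = Q2 * s + l * e))}"

lemma graded_ideal_hit: "graded_ideal hit"
  unfolding graded_ideal_def
proof (intro conjI allI ballI impI)
  fix n s t assume "s \<in> hit n" "t \<in> hit n"
  then obtain f e g d where f: "f \<in> D0 A" "homogeneous_vec (n + a) f" "w f = Q2 * s + l * e"
    and g: "g \<in> D0 A" "homogeneous_vec (n + a) g" "w g = Q2 * t + l * d"
    and st: "homogeneous n s" "homogeneous n t"
    by (auto simp: hit_def)
  have "w (f + g) = Q2 * (s + t) + l * (e + d)" by (simp add: w_add f g algebra_simps)
  then show "s + t \<in> hit n"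
    unfolding hit_def using submodule_add[OF submodule_D0 f(1) g(1)]
      homogeneous_vec_add[OF f(2) g(2)] homogeneous_add[OF st] by blast
next
  fix n m s and p :: "'k poly3" assume "s \<in> hit n" and p: "homogeneous m p"
  then obtain f e where f: "f \<in> D0 A" "homogeneous_vec (n + a) f" "w f = Q2 * s + l * e"
    and s: "homogeneous n s"
    by (auto simp: hit_def)
  have "w (p *s f) = Q2 * (p * s) + l * (p * e)" by (simp add: w_smult f algebra_simps)
  moreover have "homogeneous_vec (n + m + a) (p *s f)"
    by (rule homogeneous_vec_smult[OF p f(2)]) simp
  moreover have "homogeneous (n + m) (p * s)"
    using homogeneous_mult[OF p s] by (simp add: add.commute)
  ultimately show "p * s \<in> hit (n + m)"
    unfolding hit_def using submodule_smult[OF submodule_D0 f(1)] by blast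
qed

text \<open>Multiples of \<open>l\<close> restrict to zero on \<open>H\<close>, so the zero field
  attains them.\<close>

lemma hit_l: "homogeneous n s \<Longrightarrow> l * s \<in> hit (n + 1)"
proof -
  assume "homogeneous n s"
  then have "homogeneous (n + 1) (l * s)"
    using homogeneous_mult[OF homogeneous_l, of n s] by (simp add: add.commute)
  moreover have "w 0 = Q2 * (l * s) + l * (- Q2 * s)"
    using w_smult[of 0 0] by (simp add: ac_simps)
  ultimately show ?thesis
    unfolding hit_def using submodule_0[OF submodule_D0] homogeneous_vec_0 by blast
qed

text \<open>The constant field in the direction of the point \<open>pt p\<close>, multiplied by the forms of the
  lines that miss this point, is tangent to the whole arrangement.\<close>

lemma hit_point:
  assumes p: "p \<in> C"
  shows "prod line_form {L \<in> B - C. H \<inter> L \<noteq> H \<inter> p} \<in> hit (int (card {L \<in> B - C. H \<inter> L \<noteq> H \<inter> p}))"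
proof -
  let ?q = "pt p" and ?F = "{L \<in> B. H \<inter> L \<noteq> H \<inter> p}" and ?F' = "{L \<in> B - C. H \<inter> L \<noteq> H \<inter> p}"
  have pB: "p \<in> B" using p C(1) by blast
  define P where "P = prod line_form ?F"
  define P2 where "P2 = l * prod line_form {L \<in> B. H \<inter> L = H \<inter> p}"
  define g where "g = deriv (cvec ?q) P"
  have Q: "defining_poly A = P * P2"
  proof -
    have "B = ?F \<union> {L \<in> B. H \<inter> L = H \<inter> p}" by blast
    then have "prod line_form B = P * prod line_form {L \<in> B. H \<inter> L = H \<inter> p}"
      unfolding P_def using finite_B
      by (subst prod.union_disjoint[symmetric]) (auto intro: finite_subset)
    then show ?thesis by (simp add: defining_poly_A P2_def ac_simps) (simp add: defining_poly_def ac_simps)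
  qed
  have "deriv (cvec ?q) (prod line_form {L \<in> B. H \<inter> L = H \<inter> p}) = 0"
    by (rule deriv_prod_eq_0) (use pt_mem_iff[OF pB] in \<open>simp add: deriv_linear_form dot_cvec\<close>)
  then have "deriv (cvec ?q) P2 = 0"
    by (simp add: P2_def deriv_mult l_def deriv_linear_form dot_cvec pt_def)
  then have "deriv (P *s cvec ?q) (defining_poly A) = defining_poly A * g"
    by (simp add: Q deriv_smult_left deriv_mult g_def ac_simps)
  note D = D0_correction[OF arrangement A_nonempty this]
  define f where "f = P *s cvec ?q - (const (1 / of_nat (card A)) * g) *s euler"
  have f: "f \<in> D0 A" unfolding f_def by (rule D)
  have hP: "homogeneous (int (card ?F)) P"
    unfolding P_def by (rule homogeneous_prod_line_form)
  have "homogeneous_vec 0 (cvec ?q)" by (simp add: homogeneous_vec_def)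
  then have "homogeneous_vec (int (card ?F)) (P *s cvec ?q)"
    and "homogeneous (int (card ?F) - 1) g"
    unfolding g_def by (auto intro!: homogeneous_vec_smult[OF hP] homogeneous_deriv[OF _ hP])
  then have "homogeneous_vec (int (card ?F)) (P *s cvec ?q)"
    and "homogeneous_vec (int (card ?F)) ((const (1 / of_nat (card A)) * g) *s euler)"
    by (auto intro!: homogeneous_vec_smult[OF homogeneous_const_mult homogeneous_vec_euler])
  then have hf: "homogeneous_vec (int (card ?F)) f"
    by (simp add: f_def homogeneous_vec_def homogeneous_diff)
  \<comment> \<open>By the choice of \<open>C\<close>, all its lines except p miss the point of p.
    Hence the lines missing that point, together with p, include all of \<open>C\<close>; this
    produces the factor \<open>Q2\<close> and the degree shift \<open>a\<close>.\<close>
  have "L = p" if "L \<in> C" "H \<inter> L = H \<inter> p" for L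
    using inj_onD[OF C(2)] that p by blast
  then have sets: "insert p ?F = C \<union> ?F'" "C \<inter> ?F' = {}" "p \<notin> ?F"
    using p pB C(1) by blast+
  have fin: "finite ?F" "finite ?F'" by (rule finite_subset[OF _ finite_B], blast)+
  have card: "int (card ?F) = int (card ?F') + a"
  proof -
    have "Suc (card ?F) = card C + card ?F'"
      using card_insert_disjoint[OF fin(1) sets(3)] card_Un_disjoint[OF finite_C fin(2) sets(2)]
      by (simp only: sets(1))
    then show ?thesis by (simp add: a_eq)
  qed
  have prod: "line_form p * P = Q2 * prod line_form ?F'"
    unfolding P_def Q2_def
    using prod.insert[OF fin(1) sets(3), of line_form]
      prod.union_disjoint[OF finite_C fin(2) sets(2), of line_form]
    by (simp only: sets(1))
  have "w f = P * cross (cvec ?q) euler $ k"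
    by (simp add: f_def w_diff w_smult w_euler w_def[of "cvec _"])
  \<comment> \<open>As \<open>pt p\<close> is itself a cross product, only a constant times the form
    of p survives modulo \<open>l\<close>, and this form completes \<open>P\<close> to a multiple of
    \<open>Q2\<close>.\<close>
  also have "cross (cvec ?q) euler $ k
      = l * const (line_coeffs p $ k) - line_form p * const (\<alpha> $ k)"
    by (simp add: pt_def cross_cvec[symmetric] cross_cross_left l_dot linear_form_dot)
  also have "P * \<dots> = Q2 * (- const (\<alpha> $ k) * prod line_form ?F') + l * (P * const (line_coeffs p $ k))"
  proof -
    have "P * (l * const (line_coeffs p $ k) - line_form p * const (\<alpha> $ k))
        = - const (\<alpha> $ k) * (line_form p * P) + l * (P * const (line_coeffs p $ k))"
      by (simp add: algebra_simps)
    then show ?thesis unfolding prod by (simp add: ac_simps)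
  qed
  finally have "w f = Q2 * (- const (\<alpha> $ k) * prod line_form ?F') + l * (P * const (line_coeffs p $ k))" .
  then have "(- const (\<alpha> $ k)) * prod line_form ?F' \<in> hit (int (card ?F'))"
    unfolding hit_def using f hf card homogeneous_const_mult[OF homogeneous_prod_line_form, of ?F' "- \<alpha> $ k"]
    by (auto simp: const_uminus)
  from graded_ideal_mult[OF graded_ideal_hit this homogeneous_const, of _ "- 1 / \<alpha> $ k"]
  have "const (- 1 / \<alpha> $ k) * ((- const (\<alpha> $ k)) * prod line_form ?F') \<in> hit (int (card ?F'))"
    by simp
  also have "const (- 1 / \<alpha> $ k) * ((- const (\<alpha> $ k)) * prod line_form ?F')
      = const (- 1 / \<alpha> $ k * - \<alpha> $ k) * prod line_form ?F'"
    unfolding const_mult const_uminus[of "\<alpha> $ k"] by (simp add: ac_simps const_uminus)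
  finally show ?thesis using \<alpha>_k by simp
qed

text \<open>Only lines outside \<open>C\<close> have to be treated, since those in \<open>C\<close>
  are already absorbed into \<open>Q2\<close>.\<close>

lemma hit_var_power: "\<exists>M. var i ^ M \<in> hit (int M)"
proof -
  have "\<exists>M. var i ^ M * 1 \<in> hit (0 + int M)"
    by (rule ideal_lines_avoiding_points[OF graded_ideal_hit hit_l, of "B - C"])
      (use finite_B hit_point in auto)
  then show ?thesis by simp
qed

subsection \<open>Second cohomology\<close>

abbreviation L :: "'k poly3 fract" where "L \<equiv> to_fract l"

text \<open>Modulo \<open>l\<close>, a section over the triple intersection can be rewritten with smaller powers of
  \<open>x\<^sub>i\<close> and \<open>x\<^sub>j\<close> in the denominator at the expense of \<open>x\<^sub>k\<close>: the line \<open>H\<close> is covered by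
  the two open sets where \<open>x\<^sub>i\<close>, respectively \<open>x\<^sub>j\<close>, does not vanish.\<close>

definition split_mod_l :: "('k poly3 ^ 3) set \<Rightarrow> int \<Rightarrow> ('k poly3 fract ^ 3) set" where
  "split_mod_l M m = {v. \<exists>e\<in>twisted_sections M (m - 1) {0,1,2}. \<exists>a\<in>twisted_sections M m {0,1}.
    \<exists>b\<in>twisted_sections M m {0,2}. \<exists>c\<in>twisted_sections M m {1,2}. v = L *s e + a + b + c}"

lemma split_mod_l_add:
  assumes M: "submodule M" and "u \<in> split_mod_l M m" "v \<in> split_mod_l M m"
  shows "u + v \<in> split_mod_l M m"
proof -
  obtain e a b c where u: "e \<in> twisted_sections M (m - 1) {0,1,2}" "a \<in> twisted_sections M m {0,1}"
    "b \<in> twisted_sections M m {0,2}" "c \<in> twisted_sections M m {1,2}" "u = L *s e + a + b + c"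
    using assms(2) unfolding split_mod_l_def by blast
  obtain e' a' b' c' where v: "e' \<in> twisted_sections M (m - 1) {0,1,2}" "a' \<in> twisted_sections M m {0,1}"
    "b' \<in> twisted_sections M m {0,2}" "c' \<in> twisted_sections M m {1,2}" "v = L *s e' + a' + b' + c'"
    using assms(3) unfolding split_mod_l_def by blast
  have "u + v = L *s (e + e') + (a + a') + (b + b') + (c + c')"
    by (simp add: u v vector_add_ldistrib)
  then show ?thesis
    unfolding split_mod_l_def using u v twisted_sections_add[OF M] by blast
qed

lemma split_mod_l_const:
  assumes M: "submodule M" and "u \<in> split_mod_l M m"
  shows "to_fract (const r) *s u \<in> split_mod_l M m"
proof -
  obtain e a b c where u: "e \<in> twisted_sections M (m - 1) {0,1,2}" "a \<in> twisted_sections M m {0,1}"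
    "b \<in> twisted_sections M m {0,2}" "c \<in> twisted_sections M m {1,2}" "u = L *s e + a + b + c"
    using assms(2) unfolding split_mod_l_def by blast
  let ?r = "to_fract (const r)"
  have "?r *s u = L *s (?r *s e) + ?r *s a + ?r *s b + ?r *s c"
    by (simp add: u vector_add_ldistrib vector_smult_assoc mult.commute)
  then show ?thesis
    unfolding split_mod_l_def using u twisted_sections_const_smult[OF M] by blast
qed

lemma split_mod_l_pair:
  assumes M: "submodule M" and "i \<noteq> j" "v \<in> twisted_sections M m {i, j}"
  shows "v \<in> split_mod_l M m"
proof -
  have 0: "0 \<in> twisted_sections M n S" for n S by (rule twisted_sections_0[OF M])
  have "\<forall>i j::3. i \<noteq> j \<longrightarrow> {i, j} = {0,1} \<or> {i, j} = {0,2} \<or> {i, j} = {1,2}"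
    by (simp add: all_three insert_commute)
  then consider "{i, j} = {0,1}" | "{i, j} = {0,2}" | "{i, j} = {1,2}"
    using assms(2) by blast
  then show ?thesis
  proof cases
    case 1
    then have "v \<in> twisted_sections M m {0,1}" "v = L *s 0 + v + 0 + 0" using assms(3) by simp_all
    then show ?thesis using 0 unfolding split_mod_l_def by blast
  next
    case 2
    then have "v \<in> twisted_sections M m {0,2}" "v = L *s 0 + 0 + v + 0" using assms(3) by simp_all
    then show ?thesis using 0 unfolding split_mod_l_def by blast
  next
    case 3
    then have "v \<in> twisted_sections M m {1,2}" "v = L *s 0 + 0 + 0 + v" using assms(3) by simp_all
    then show ?thesis using 0 unfolding split_mod_l_def by blast
  qed
qed

lemma twisted_sections_cancel_power:
  fixes M :: "('k poly3 ^ 'n) set"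
  assumes M: "submodule M" and "i \<in> S"
    and "to_fract (var i) ^ n *s v \<in> twisted_sections M (m + int n) S"
  shows "v \<in> twisted_sections M m S"
  using assms(3)
proof (induction n arbitrary: m)
  case (Suc n)
  let ?x = "to_fract (var i) :: 'k poly3 fract"
  have x: "?x \<noteq> 0" by simp
  have "inverse ?x *s (?x ^ Suc n *s v) = ?x ^ n *s v"
    by (simp only: vector_smult_assoc power_Suc mult.assoc[symmetric] left_inverse[OF x] mult_1_left)
  then have "?x ^ n *s v \<in> twisted_sections M (m + int (Suc n) - 1) S"
    using twisted_sections_divide_var[OF M Suc.prems assms(2)] by (simp only:)
  then have "?x ^ n *s v \<in> twisted_sections M (m + int n) S"
    by simp
  then show ?case by (rule Suc.IH)
qed simp

lemma twisted_sections_split_mod_l: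
  assumes M: "submodule M" and ij: "i \<noteq> k" "j \<noteq> k" "i \<noteq> j"
  shows "v \<in> twisted_sections M m {0,1,2} \<Longrightarrow>
    to_fract (var i) ^ b *s (to_fract (var j) ^ c *s v) \<in> twisted_sections M (m + int b + int c) {k}
    \<Longrightarrow> v \<in> split_mod_l M m"
proof (induction "b + c" arbitrary: b c v rule: less_induct)
  case less
  let ?x = "\<lambda>i. to_fract (var i) :: 'k poly3 fract"
  have U: "{0,1,2} = (UNIV :: 3 set)" by (rule UNIV_three[symmetric])
  consider "b = 0" | "c = 0" | "b \<noteq> 0" "c \<noteq> 0" by blast
  then show ?case
  proof cases
    case 1
    have "?x j ^ c *s v \<in> twisted_sections M (m + int c) {k, j}"
      using less.prems(2) 1 twisted_sections_mono[OF M, of "{k}" "{k, j}"] by auto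
    then have "v \<in> twisted_sections M m {k, j}"
      by (rule twisted_sections_cancel_power[OF M, where i = j, rotated]) simp
    then show ?thesis using split_mod_l_pair[OF M, of k j v m] ij by auto
  next
    case 2
    have "?x i ^ b *s v \<in> twisted_sections M (m + int b) {k, i}"
      using less.prems(2) 2 twisted_sections_mono[OF M, of "{k}" "{k, i}"] by auto
    then have "v \<in> twisted_sections M m {k, i}"
      by (rule twisted_sections_cancel_power[OF M, where i = i, rotated]) simp
    then show ?thesis using split_mod_l_pair[OF M, of k i v m] ij by auto
  next
    case 3
    obtain b' c' where bc: "b = Suc b'" "c = Suc c'"
      using not0_implies_Suc[OF 3(1)] not0_implies_Suc[OF 3(2)] by blast
    define u where "u = inverse (?x k) *s v"
    have xk: "?x k *s u = v" by (simp add: u_def vector_smult_assoc)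
    have u: "u \<in> twisted_sections M (m - 1) {0,1,2}"
      unfolding u_def U using twisted_sections_divide_var[OF M less.prems(1)[unfolded U]] by simp
    have xu: "?x n *s u \<in> twisted_sections M m {0,1,2}" for n
      using twisted_sections_var_smult[OF M u] by simp
    have pow: "?x i ^ b *s (?x j ^ c *s u) \<in> twisted_sections M (m + int b + int c - 1) {k}"
      using twisted_sections_divide_var[OF M less.prems(2), of k]
      by (simp add: u_def vector_smult_assoc mult_ac)
    have "?x i ^ b' *s (?x j ^ c *s (?x i *s u)) \<in> twisted_sections M (m + int b' + int c) {k}"
      using pow by (simp add: bc vector_smult_assoc ac_simps)
    then have i: "?x i *s u \<in> split_mod_l M m"
      using less.hyps[OF _ xu, of b' c i] bc by simp
    have "?x i ^ b *s (?x j ^ c' *s (?x j *s u)) \<in> twisted_sections M (m + int b + int c') {k}"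
      using pow by (simp add: bc vector_smult_assoc ac_simps)
    then have j: "?x j *s u \<in> split_mod_l M m"
      using less.hyps[OF _ xu, of b c' j] bc by simp
    let ?r = "\<lambda>n. to_fract (const (- (\<alpha> $ n / \<alpha> $ k)))"
    have 0: "0 \<in> twisted_sections M n S" for n S by (rule twisted_sections_0[OF M])
    have "to_fract (const (1 / \<alpha> $ k)) *s u \<in> twisted_sections M (m - 1) {0,1,2}"
      by (rule twisted_sections_const_smult[OF M u])
    then have "L *s (to_fract (const (1 / \<alpha> $ k)) *s u) + 0 + 0 + 0 \<in> split_mod_l M m"
      unfolding split_mod_l_def using 0 by blast
    then have "L *s (to_fract (const (1 / \<alpha> $ k)) *s u) + ?r i *s (?x i *s u) + ?r j *s (?x j *s u)
        \<in> split_mod_l M m"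
      using split_mod_l_const[OF M i] split_mod_l_const[OF M j] by (auto intro!: split_mod_l_add[OF M])
    also have "L *s (to_fract (const (1 / \<alpha> $ k)) *s u) + ?r i *s (?x i *s u) + ?r j *s (?x j *s u)
        = to_fract (l * const (1 / \<alpha> $ k) + const (- (\<alpha> $ i / \<alpha> $ k)) * var i
            + const (- (\<alpha> $ j / \<alpha> $ k)) * var j) *s u"
      by (simp add: vector_smult_assoc vector_sadd_rdistrib)
    also have "l * const (1 / \<alpha> $ k) + const (- (\<alpha> $ i / \<alpha> $ k)) * var i
            + const (- (\<alpha> $ j / \<alpha> $ k)) * var j = var k"
    proof -
      have UNIV_ijk: "UNIV = {i, j, k}"
        by (rule card_subset_eq[symmetric]) (use ij in auto)
      then have l: "l = const (\<alpha> $ i) * var i + const (\<alpha> $ j) * var j + const (\<alpha> $ k) * var k"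
        using ij unfolding l_def linear_form_def UNIV_ijk by (simp add: add.assoc)
      have "l * const (1 / \<alpha> $ k) = const (\<alpha> $ i * (1 / \<alpha> $ k)) * var i
          + const (\<alpha> $ j * (1 / \<alpha> $ k)) * var j + const (\<alpha> $ k * (1 / \<alpha> $ k)) * var k"
        unfolding l const_mult by (simp add: algebra_simps)
      then show ?thesis using \<alpha>_k by (simp add: const_uminus)
    qed
    finally show ?thesis by (simp add: xk)
  qed
qed

lemma in_split_mod_l:
  assumes M: "submodule M" and v: "v \<in> twisted_sections M m {0,1,2}"
  shows "v \<in> split_mod_l M m"
proof -
  obtain i j where ij: "i \<noteq> k" "j \<noteq> k" "i \<noteq> j" by (rule other_indices)
  have U: "{0,1,2} = {k, i, j}"
    unfolding UNIV_three[symmetric] by (rule card_subset_eq[symmetric]) (use ij in auto)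
  have d: "denom {0,1,2} = var k * (var i * var j)" "denom {k} = var k"
    unfolding U using ij by (simp_all add: denom_def)
  obtain g N where g: "g \<in> M" "homogeneous_vec (m + int (N * card {0,1,2::3})) g"
      "to_fract (denom {0,1,2} ^ N) *s v = embv g"
    using v unfolding twisted_sections_iff by blast
  have "to_fract (var i) ^ N *s (to_fract (var j) ^ N *s v) \<in> twisted_sections M (m + int N + int N) {k}"
  proof (rule twisted_sectionsI[OF g(1)])
    show "homogeneous_vec (m + int N + int N + int (N * card {k})) g"
      using g(2) by (simp add: algebra_simps)
    show "to_fract (denom {k} ^ N) *s (to_fract (var i) ^ N *s (to_fract (var j) ^ N *s v)) = embv g"
      using g(3) by (simp add: d to_fract_power power_mult_distrib vector_smult_assoc mult.assoc)
  qed
  then show ?thesis by (rule twisted_sections_split_mod_l[OF M ij v])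
qed

section \<open>The exact sequence on sections over the charts\<close>

definition W :: "'k poly3 fract ^ 3 \<Rightarrow> 'k poly3 fract" where
  "W v = cross v (embv euler) $ k"

definition Phi :: "'k poly3 fract ^ 3 \<Rightarrow> 'k poly3 fract ^ 3" where
  "Phi v = L *s v - (to_fract (const c0) * dot (embv (cvec \<alpha>)) v) *s embv euler"

lemma W_add: "W (u + v) = W u + W v" and W_diff: "W (u - v) = W u - W v"
  and W_smult: "W (c *s v) = c * W v"
  by (simp_all add: W_def cross_add_left cross_diff_left cross_smult_left)

lemma cross_embv: "cross (embv f) (embv g) = embv (cross f g)"
  by (simp add: vec3_eq_iff)

lemma dot_embv: "dot (embv f) (embv g) = to_fract (dot f g)"
  by (simp add: dot_three)

lemma W_embv: "W (embv f) = to_fract (w f)"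
  by (simp add: W_def w_def cross_embv)

lemma Phi_embv: "Phi (embv f) = embv (phi f)"
  by (simp add: Phi_def phi_def dot_embv embv_diff embv_smult)

lemma Phi_add: "Phi (u + v) = Phi u + Phi v" and Phi_diff: "Phi (u - v) = Phi u - Phi v"
  and Phi_smult: "Phi (c *s v) = c *s Phi v"
  by (simp_all add: Phi_def dot_add_right dot_diff_right dot_smult_right vec_eq_iff algebra_simps)

text \<open>Pairing with \<alpha> shows that the pairing of v and \<alpha> equals \<open>c0\<close>
  times itself. There are at least two lines, so \<open>c0\<close> is not 1, the pairing is zero,
  and \<open>L\<close> v = 0 remains.\<close>

lemma Phi_eq_0:
  assumes "Phi v = 0"
  shows "v = 0"
proof -
  define \<mu> where "\<mu> = to_fract (const c0) * dot (embv (cvec \<alpha>)) v"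
  have eq: "L *s v = \<mu> *s embv euler" using assms by (simp add: Phi_def \<mu>_def)
  have "L * dot (embv (cvec \<alpha>)) v = dot (embv (cvec \<alpha>)) (L *s v)" by (simp add: dot_smult_right)
  also have "\<dots> = \<mu> * L"
    unfolding eq by (simp add: dot_smult_right dot_embv l_dot[symmetric])
  finally have "dot (embv (cvec \<alpha>)) v = \<mu>" by simp
  then have "to_fract (1 - const c0) * \<mu> = 0" by (simp add: \<mu>_def left_diff_distrib)
  moreover have "1 - const c0 \<noteq> 0"
  proof -
    have "(of_nat (card A) :: 'k) \<noteq> 1"
      using card_A B_nonempty finite_B by (simp add: card_eq_0_iff)
    then have "c0 \<noteq> 1" by (simp add: c0_def)
    then have "const (1 - c0) \<noteq> 0" by simp
    then show ?thesis by (simp add: const_diff)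
  qed
  ultimately have "\<mu> = 0" by (metis mult_eq_0_iff to_fract_eq_0_iff)
  then show ?thesis using eq by simp
qed

lemma Phi_inject: "Phi u = Phi v \<Longrightarrow> u = v"
  using Phi_eq_0[of "u - v"] by (simp add: Phi_diff)

lemma Phi_sections:
  assumes "v \<in> twisted_sections (D0 B) (m - 1) S"
  shows "Phi v \<in> twisted_sections (D0 A) m S"
proof -
  have "Phi v \<in> twisted_sections (D0 A) (m - 1 + 1) S"
    using assms phi_D0 homogeneous_phi Phi_embv Phi_smult
    by (intro twisted_sections_map[of v "D0 B"]) auto
  then show ?thesis by simp
qed

lemma W_sections:
  assumes "v \<in> twisted_sections M m S"
  shows "W v \<in> sections (m + 1) S"
proof -
  obtain g N where g: "homogeneous_vec (m + int (N * card S)) g"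
      "to_fract (denom S ^ N) *s v = embv g"
    using assms unfolding twisted_sections_iff by blast
  show ?thesis
  proof (rule sectionsI)
    show "homogeneous (m + 1 + int (N * card S)) (w g)"
      using homogeneous_w[OF g(1)] by (simp add: algebra_simps)
    show "to_fract (denom S ^ N) * W v = to_fract (w g)"
      using arg_cong[OF g(2), of W] by (simp only: W_smult W_embv)
  qed
qed

lemma W_division:
  assumes "v \<in> twisted_sections (D0 A) m S"
  obtains s e where "s \<in> sections (m - a) S" "e \<in> sections m S" "W v = to_fract Q2 * s + L * e"
proof -
  obtain g N where g: "g \<in> D0 A" "homogeneous_vec (m + int (N * card S)) g"
      "to_fract (denom S ^ N) *s v = embv g"
    using assms unfolding twisted_sections_iff by blast
  obtain b e where be: "homogeneous (m + int (N * card S) - a) b" "homogeneous (m + int (N * card S)) e"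
    "w g = Q2 * b + l * e"
    by (rule w_division[OF g(1,2)])
  let ?D = "to_fract (denom S ^ N) :: 'k poly3 fract"
  have D: "?D \<noteq> 0" by simp
  show ?thesis
  proof (rule that[of "to_fract b / ?D" "to_fract e / ?D"])
    show "to_fract b / ?D \<in> sections (m - a) S"
      by (rule sectionsI[of _ N _ b]) (use be(1) D in \<open>simp_all add: algebra_simps\<close>)
    show "to_fract e / ?D \<in> sections m S"
      by (rule sectionsI[OF be(2)]) (use D in simp)
    have "?D * W v = to_fract Q2 * to_fract b + L * to_fract e"
      using arg_cong[OF g(3), of W] by (simp only: W_smult W_embv be(3) to_fract_mult to_fract_add)
    then have "W v = (to_fract Q2 * to_fract b + L * to_fract e) / ?D"
      using D by (simp add: nonzero_eq_divide_eq mult.commute)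
    then show "W v = to_fract Q2 * (to_fract b / ?D) + L * (to_fract e / ?D)"
      by (simp add: add_divide_distrib)
  qed
qed

text \<open>Localized exactness in the middle. It is essential that e is a section over the same
  open set: in the fraction field everything is a multiple of \<open>L\<close>.\<close>

lemma kernel_sections:
  assumes v: "v \<in> twisted_sections (D0 A) m S" and e: "e \<in> sections m S" and "W v = L * e"
  obtains u where "u \<in> twisted_sections (D0 B) (m - 1) S" "Phi u = v"
proof -
  obtain N1 where N1: "\<And>n. n \<ge> N1 \<Longrightarrow> \<exists>g\<in>D0 A. homogeneous_vec (m + int (n * card S)) g
      \<and> to_fract (denom S ^ n) *s v = embv g"
    using twisted_sections_raise[OF submodule_D0 v] by blast
  obtain N2 where N2: "\<And>n. n \<ge> N2 \<Longrightarrow> \<exists>p. homogeneous (m + int (n * card S)) p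
      \<and> to_fract (denom S ^ n) * e = to_fract p"
    using sections_raise[OF e] by blast
  define N where "N = N1 + N2"
  obtain g where g: "g \<in> D0 A" "homogeneous_vec (m + int (N * card S)) g"
      "to_fract (denom S ^ N) *s v = embv g"
    using N1[of N] unfolding N_def by auto
  obtain p where p: "to_fract (denom S ^ N) * e = to_fract p"
    using N2[of N] unfolding N_def by auto
  let ?D = "to_fract (denom S ^ N) :: 'k poly3 fract"
  have D: "?D \<noteq> 0" by simp
  have "to_fract (w g) = ?D * W v"
    using arg_cong[OF g(3), of W] by (simp only: W_smult W_embv)
  also have "\<dots> = L * (?D * e)" by (simp add: assms(3) del: to_fract_mult)
  also have "\<dots> = to_fract (l * p)" by (simp only: p to_fract_mult)
  finally have "l dvd w g" by (simp only: to_fract_eq_iff) simp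
  then obtain h where h: "h \<in> D0 B" "homogeneous_vec (m + int (N * card S) - 1) h" "phi h = g"
    by (rule kernel_phi[OF g(1,2)])
  show ?thesis
  proof (rule that[of "inverse ?D *s embv h"])
    show "inverse ?D *s embv h \<in> twisted_sections (D0 B) (m - 1) S"
    proof (rule twisted_sectionsI[OF h(1)])
      show "homogeneous_vec (m - 1 + int (N * card S)) h" using h(2) by (simp add: algebra_simps)
      show "?D *s (inverse ?D *s embv h) = embv h"
        using right_inverse[OF D] by (simp only: vector_smult_assoc vector_smult_lid)
    qed
    have "Phi (inverse ?D *s embv h) = inverse ?D *s (?D *s v)"
      by (simp only: Phi_smult Phi_embv h(3) g(3))
    then show "Phi (inverse ?D *s embv h) = v"
      using left_inverse[OF D] by (simp only: vector_smult_assoc vector_smult_lid)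
  qed
qed

text \<open>After multiplication by a power of x_i the numerator is attained by a field on the whole
  plane; the power is a unit on the chart of x_i and is divided out again.\<close>

lemma sections_lift:
  assumes r: "r \<in> sections (m - a) {i}"
  obtains v e where "v \<in> twisted_sections (D0 A) m {i}" "e \<in> sections m {i}"
    "W v = to_fract Q2 * r + L * e"
proof -
  obtain p N where p: "homogeneous (m - a + int (N * card {i})) p"
    "to_fract (denom {i} ^ N) * r = to_fract p"
    using r unfolding sections_iff by blast
  obtain M where "var i ^ M \<in> hit (int M)" using hit_var_power by blast
  from graded_ideal_mult[OF graded_ideal_hit this p(1) refl]
  obtain f e where f: "f \<in> D0 A" "homogeneous_vec (int M + (m - a + int (N * card {i})) + a) f"
    "w f = Q2 * (p * var i ^ M) + l * e"
    by (auto simp: hit_def)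
  let ?D = "to_fract (denom {i} ^ (N + M)) :: 'k poly3 fract"
  have D: "?D \<noteq> 0" by simp
  have Dr: "?D * r = to_fract (p * var i ^ M)"
    using p(2) by (simp add: denom_def power_add to_fract_power ac_simps)
  show ?thesis
  proof (rule that[of "inverse ?D *s embv f" "(W (inverse ?D *s embv f) - to_fract Q2 * r) / L"])
    show v: "inverse ?D *s embv f \<in> twisted_sections (D0 A) m {i}"
    proof (rule twisted_sectionsI[OF f(1)])
      show "homogeneous_vec (m + int ((N + M) * card {i})) f" using f(2) by (simp add: algebra_simps)
      show "?D *s (inverse ?D *s embv f) = embv f"
        using right_inverse[OF D] by (simp only: vector_smult_assoc vector_smult_lid)
    qed
    have L0: "L \<noteq> 0" by simp
    then show "W (inverse ?D *s embv f)
        = to_fract Q2 * r + L * ((W (inverse ?D *s embv f) - to_fract Q2 * r) / L)"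
      by simp
    have "homogeneous (m + int ((N + M) * card {i})) e"
    proof -
      have "homogeneous (m + int ((N + M) * card {i}) + 1) (w f)"
        by (rule homogeneous_cong[OF homogeneous_w[OF f(2)]]) (simp add: algebra_simps)
      moreover have "homogeneous (m + int ((N + M) * card {i}) + 1) (Q2 * (p * var i ^ M))"
        by (rule homogeneous_cong[OF homogeneous_mult[OF homogeneous_Q2
              homogeneous_mult[OF p(1) homogeneous_power[OF homogeneous_var]]]])
          (simp add: algebra_simps)
      ultimately have "homogeneous (m + int ((N + M) * card {i}) + 1) (l * e)"
        using homogeneous_diff[of _ "w f" "Q2 * (p * var i ^ M)"] f(3) by simp
      from homogeneous_cancel[OF homogeneous_l l_neq_0 this] show ?thesis by simp
    qed
    moreover have "?D * ((W (inverse ?D *s embv f) - to_fract Q2 * r) / L) = to_fract e"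
    proof -
      have "?D * W (inverse ?D *s embv f) = to_fract (w f)"
        using right_inverse[OF D] by (simp only: W_smult W_embv mult.assoc[symmetric] mult_1_left)
      then have "?D * (W (inverse ?D *s embv f) - to_fract Q2 * r)
          = to_fract (w f) - to_fract Q2 * (?D * r)"
        by (simp only: right_diff_distrib mult.left_commute)
      also have "\<dots> = L * to_fract e" by (simp only: Dr f(3)) simp
      finally show ?thesis using L0 by (simp add: nonzero_divide_eq_eq mult.commute del: to_fract_mult)
    qed
    ultimately show "(W (inverse ?D *s embv f) - to_fract Q2 * r) / L \<in> sections m {i}"
      by (rule sectionsI)
  qed
qed

text \<open>\<open>Q2\<close> is not a zero divisor modulo \<open>l\<close>, since \<open>l\<close>
  is prime and \<open>H\<close> is not among the lines of \<open>C\<close>.\<close>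

lemma sections_cancel_Q2:
  assumes f: "f \<in> sections n S" and h: "h \<in> sections n' S" and eq: "to_fract Q2 * f = L * h"
  obtains f' where "f' \<in> sections (n - 1) S" "f = L * f'"
proof -
  obtain N1 where N1: "\<And>N. N \<ge> N1 \<Longrightarrow> \<exists>p. homogeneous (n + int (N * card S)) p
      \<and> to_fract (denom S ^ N) * f = to_fract p" using sections_raise[OF f] by blast
  obtain N2 where N2: "\<And>N. N \<ge> N2 \<Longrightarrow> \<exists>p. homogeneous (n' + int (N * card S)) p
      \<and> to_fract (denom S ^ N) * h = to_fract p" using sections_raise[OF h] by blast
  define N where "N = N1 + N2"
  obtain p where p: "homogeneous (n + int (N * card S)) p" "to_fract (denom S ^ N) * f = to_fract p"
    using N1[of N] unfolding N_def by auto
  obtain q where q: "to_fract (denom S ^ N) * h = to_fract q"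
    using N2[of N] unfolding N_def by auto
  let ?D = "to_fract (denom S ^ N) :: 'k poly3 fract"
  have D: "?D \<noteq> 0" by simp
  have "to_fract (Q2 * p) = ?D * (to_fract Q2 * f)" by (simp only: p(2)[symmetric] to_fract_mult mult.left_commute)
  also have "\<dots> = to_fract (l * q)" by (simp only: eq q[symmetric] to_fract_mult mult.left_commute)
  finally have "Q2 * p = l * q" by (simp only: to_fract_eq_iff)
  then have "l dvd Q2 * p" by simp
  then have "l dvd p" using l_dvd_cancel l_not_dvd_Q2 by blast
  then obtain p' where p': "p = l * p'" by (auto simp: dvd_def)
  have hp': "homogeneous (n + int (N * card S) - 1) p'"
    using homogeneous_cancel[OF homogeneous_l l_neq_0] p(1) p' by blast
  show ?thesis
  proof (rule that[of "to_fract p' / ?D"])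
    show "to_fract p' / ?D \<in> sections (n - 1) S"
      by (rule sectionsI[of _ N _ p']) (use hp' D in \<open>simp_all add: algebra_simps\<close>)
    have "f = to_fract p / ?D" using p(2) D by (simp add: nonzero_eq_divide_eq mult.commute)
    then show "f = L * (to_fract p' / ?D)" by (simp add: p')
  qed
qed

text \<open>Modulo sections over the pairwise intersections, every section is \<open>L\<close> e.
  Since \<open>W\<close> sends it to \<open>L\<close> times a section, it comes through
  \<open>Phi\<close> from the smaller arrangement, where it splits by hypothesis.\<close>

lemma H2_vanishes_addition:
  assumes van: "H2_vanishes (D0 B) (m - 1)"
  shows "H2_vanishes (D0 A) m"
  unfolding H2_vanishes_def
proof
  fix v assume "v \<in> twisted_sections (D0 A) m {0,1,2}"
  then have "v \<in> split_mod_l (D0 A) m" by (rule in_split_mod_l[OF submodule_D0])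
  then obtain e x y z where v: "e \<in> twisted_sections (D0 A) (m - 1) {0,1,2}"
    "x \<in> twisted_sections (D0 A) m {0,1}" "y \<in> twisted_sections (D0 A) m {0,2}"
    "z \<in> twisted_sections (D0 A) m {1,2}" "v = L *s e + x + y + z"
    unfolding split_mod_l_def by blast
  have "L *s e \<in> twisted_sections (D0 A) (m - 1 + 1) {0,1,2}"
    by (rule twisted_sections_smult[OF submodule_D0 v(1) homogeneous_l])
  then have Le: "L *s e \<in> twisted_sections (D0 A) m {0,1,2}" by simp
  have We: "W e \<in> sections m {0,1,2}" using W_sections[OF v(1)] by simp
  obtain u where u: "u \<in> twisted_sections (D0 B) (m - 1) {0,1,2}" "Phi u = L *s e"
    by (rule kernel_sections[OF Le We W_smult])
  obtain x' y' z' where u': "x' \<in> twisted_sections (D0 B) (m - 1) {0,1}"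
    "y' \<in> twisted_sections (D0 B) (m - 1) {0,2}" "z' \<in> twisted_sections (D0 B) (m - 1) {1,2}"
    "u = x' + y' + z'"
    by (rule H2_vanishesE[OF van u(1)])
  have "v = (Phi x' + x) + (Phi y' + y) + (Phi z' + z)"
    by (simp add: v(5) u(2)[symmetric] u'(4) Phi_add algebra_simps)
  then show "\<exists>a\<in>twisted_sections (D0 A) m {0,1}. \<exists>b\<in>twisted_sections (D0 A) m {0,2}.
      \<exists>c\<in>twisted_sections (D0 A) m {1,2}. v = a + b + c"
    using v(2-4) u'(1-3) Phi_sections twisted_sections_add[OF submodule_D0] by blast
qed

subsection \<open>First cohomology\<close>

text \<open>The diagram chase of the long exact sequence, with the vanishing of H^1(O_H(m - a))
  unfolded into that of H^2(O(m - a - 1)) and H^1(O(m - a)). The former requires m - a - 1 \<ge>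
  -2.\<close>

lemma H1_vanishes_addition:
  assumes van: "H1_vanishes (D0 B) (m - 1)" and m: "m \<ge> a - 1"
  shows "H1_vanishes (D0 A) m"
  unfolding H1_vanishes_def
proof (intro ballI impI)
  fix x y z assume x: "x \<in> twisted_sections (D0 A) m {0,1}" and y: "y \<in> twisted_sections (D0 A) m {0,2}"
    and z: "z \<in> twisted_sections (D0 A) m {1,2}" and xyz: "x + z = y"
  let ?Q = "to_fract Q2"
  obtain sx ex where sx: "sx \<in> sections (m - a) {0,1}" "ex \<in> sections m {0,1}" "W x = ?Q * sx + L * ex"
    by (rule W_division[OF x])
  obtain sy ey where sy: "sy \<in> sections (m - a) {0,2}" "ey \<in> sections m {0,2}" "W y = ?Q * sy + L * ey"
    by (rule W_division[OF y])
  obtain sz ez where sz: "sz \<in> sections (m - a) {1,2}" "ez \<in> sections m {1,2}" "W z = ?Q * sz + L * ez"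
    by (rule W_division[OF z])
  have up: "sx \<in> sections (m - a) {0,1,2}" "ex \<in> sections m {0,1,2}"
    "sy \<in> sections (m - a) {0,1,2}" "ey \<in> sections m {0,1,2}"
    "sz \<in> sections (m - a) {0,1,2}" "ez \<in> sections m {0,1,2}"
    using sx sy sz sections_mono[of "{0,1}" "{0,1,2}"] sections_mono[of "{0,2}" "{0,1,2}"]
      sections_mono[of "{1,2}" "{0,1,2}"] by blast+
  have "?Q * (sx + sz - sy) = L * (ey - ex - ez)"
    using arg_cong[OF xyz, of W] by (simp add: W_add sx(3) sy(3) sz(3) algebra_simps)
  moreover have "sx + sz - sy \<in> sections (m - a) {0,1,2}" "ey - ex - ez \<in> sections m {0,1,2}"
    by (intro sections_add sections_diff up)+
  ultimately obtain f where f: "f \<in> sections (m - a - 1) {0,1,2}" "sx + sz - sy = L * f"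
    using sections_cancel_Q2 by metis
  \<comment> \<open>The images form a cocycle only up to \<open>L\<close> f. Splitting f over the
    pairwise intersections lets each component absorb its share, which makes the condition
    exact.\<close>
  obtain fx fy fz where fxyz: "fx \<in> sections (m - a - 1) {0,1}" "fy \<in> sections (m - a - 1) {0,2}"
    "fz \<in> sections (m - a - 1) {1,2}" "f = fx + fy + fz"
    by (rule sections_H2_vanishes[OF _ f(1)]) (use m in auto)
  have Lf: "L * c \<in> sections (m - a) S" if "c \<in> sections (m - a - 1) S" for c S
    using sections_mult[OF that homogeneous_l] by simp
  have cocycle: "(sx - L * fx) + (sz - L * fz) = sy + L * fy"
    using f(2) by (simp add: fxyz(4) algebra_simps)
  have "sx - L * fx \<in> sections (m - a) {0,1}" "sy + L * fy \<in> sections (m - a) {0,2}"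
    "sz - L * fz \<in> sections (m - a) {1,2}"
    using sx sy sz fxyz by (auto intro!: sections_add sections_diff Lf)
  from sections_H1_vanishes[OF this cocycle]
  obtain r0 r1 r2 where r: "r0 \<in> sections (m - a) {0}" "r1 \<in> sections (m - a) {1}"
    "r2 \<in> sections (m - a) {2}" "sx - L * fx = r1 - r0" "sy + L * fy = r2 - r0" "sz - L * fz = r2 - r1"
    by metis
  obtain b0 e0 where b0: "b0 \<in> twisted_sections (D0 A) m {0}" "e0 \<in> sections m {0}" "W b0 = ?Q * r0 + L * e0"
    by (rule sections_lift[OF r(1)])
  obtain b1 e1 where b1: "b1 \<in> twisted_sections (D0 A) m {1}" "e1 \<in> sections m {1}" "W b1 = ?Q * r1 + L * e1"
    by (rule sections_lift[OF r(2)])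
  obtain b2 e2 where b2: "b2 \<in> twisted_sections (D0 A) m {2}" "e2 \<in> sections m {2}" "W b2 = ?Q * r2 + L * e2"
    by (rule sections_lift[OF r(3)])
  have Q2f: "?Q * c \<in> sections m S" if "c \<in> sections (m - a - 1) S" for c S
    using sections_mult[OF that homogeneous_Q2] by simp
  \<comment> \<open>Subtracting the coboundary of the lifts leaves a section that \<open>W\<close>
    sends to a multiple of \<open>L\<close>, hence one coming from the smaller arrangement. The term
    \<open>?Q * g\<close> accounts for the share of f absorbed before.\<close>
  have lift: "\<exists>u\<in>twisted_sections (D0 B) (m - 1) {i,j}. Phi u = v - (bj - bi)"
    if v: "v \<in> twisted_sections (D0 A) m {i,j}" "e \<in> sections m {i,j}" "W v = ?Q * s + L * e"
      and g: "g \<in> sections (m - a - 1) {i,j}" "s - L * g = rj - ri"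
      and bi: "bi \<in> twisted_sections (D0 A) m {i}" "ei \<in> sections m {i}" "W bi = ?Q * ri + L * ei"
      and bj: "bj \<in> twisted_sections (D0 A) m {j}" "ej \<in> sections m {j}" "W bj = ?Q * rj + L * ej"
    for v e s g ri rj bi bj ei ej and i j :: 3
  proof -
    have 1: "bi \<in> twisted_sections (D0 A) m {i,j}" "bj \<in> twisted_sections (D0 A) m {i,j}"
      using bi(1) bj(1) twisted_sections_mono[OF submodule_D0, of "{i}" "{i,j}"]
        twisted_sections_mono[OF submodule_D0, of "{j}" "{i,j}"] by blast+
    have 2: "ei \<in> sections m {i,j}" "ej \<in> sections m {i,j}"
      using bi(2) bj(2) sections_mono[of "{i}" "{i,j}"] sections_mono[of "{j}" "{i,j}"] by blast+
    have "v - (bj - bi) \<in> twisted_sections (D0 A) m {i,j}"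
      using 1 v(1) by (intro twisted_sections_diff[OF submodule_D0])
    moreover have "e + ?Q * g - (ej - ei) \<in> sections m {i,j}"
      using 2 v(2) Q2f[OF g(1)] by (intro sections_diff sections_add)
    moreover have "W (v - (bj - bi)) = L * (e + ?Q * g - (ej - ei))"
    proof -
      have s: "s = rj - ri + L * g" using g(2) by (simp add: algebra_simps)
      show ?thesis by (simp only: W_diff v(3) bi(3) bj(3) s) (simp add: algebra_simps)
    qed
    ultimately show ?thesis using kernel_sections by metis
  qed
  obtain x' where x': "x' \<in> twisted_sections (D0 B) (m - 1) {0,1}" "Phi x' = x - (b1 - b0)"
    using lift[OF x sx(2,3) fxyz(1) r(4) b0 b1] by blast
  \<comment> \<open>The middle component stands on the other side of the cocycle condition, so its
    share of f has the opposite sign.\<close>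
  have "- fy \<in> sections (m - a - 1) {0,2}" "sy - L * (- fy) = r2 - r0"
    using fxyz(2) r(5) by (simp_all add: sections_uminus)
  then obtain y' where y': "y' \<in> twisted_sections (D0 B) (m - 1) {0,2}" "Phi y' = y - (b2 - b0)"
    using lift[OF y sy(2,3) _ _ b0 b2] by blast
  obtain z' where z': "z' \<in> twisted_sections (D0 B) (m - 1) {1,2}" "Phi z' = z - (b2 - b1)"
    using lift[OF z sz(2,3) fxyz(3) r(6) b1 b2] by blast
  \<comment> \<open>Injectivity of \<open>Phi\<close> carries the cocycle condition back to the
    smaller arrangement.\<close>
  have "x' + z' = y'"
    by (rule Phi_inject) (simp add: Phi_add x'(2) y'(2) z'(2) xyz[symmetric])
  then obtain u0 u1 u2 where u: "u0 \<in> twisted_sections (D0 B) (m - 1) {0}"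
    "u1 \<in> twisted_sections (D0 B) (m - 1) {1}" "u2 \<in> twisted_sections (D0 B) (m - 1) {2}"
    "x' = u1 - u0" "y' = u2 - u0" "z' = u2 - u1"
    by (rule H1_vanishesE[OF van x'(1) y'(1) z'(1)])
  have "x = (b1 + Phi u1) - (b0 + Phi u0)" "y = (b2 + Phi u2) - (b0 + Phi u0)"
    "z = (b2 + Phi u2) - (b1 + Phi u1)"
    using x'(2) y'(2) z'(2) by (simp_all add: u(4-6) Phi_diff algebra_simps)
  then show "\<exists>u\<in>twisted_sections (D0 A) m {0}. \<exists>v\<in>twisted_sections (D0 A) m {1}.
      \<exists>w\<in>twisted_sections (D0 A) m {2}. x = v - u \<and> y = w - u \<and> z = w - v"
    using u(1-3) b0(1) b1(1) b2(1) Phi_sections twisted_sections_add[OF submodule_D0] by blast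
qed

text \<open>Both conditions have to hold at one integer, so the regularity of the smaller
  arrangement is first raised to one less than the maximum. The entry \<open>a\<close> is what H^1
  in twist \<open>?n - 1\<close> demands.\<close>

lemma regular_sheaf_addition:
  assumes "regular_sheaf (D0 B) m"
  shows "regular_sheaf (D0 A) (max (m + 1) a)"
proof -
  let ?n = "max (m + 1) a"
  have "regular_sheaf (D0 B) (?n - 1)"
    by (rule regular_sheaf_mono[OF submodule_D0 assms]) simp
  then have van: "H1_vanishes (D0 B) (?n - 1 - 1)" "H2_vanishes (D0 B) (?n - 1 - 2)"
    by (simp_all add: regular_sheaf_iff[OF submodule_D0])
  have "?n - 2 - 1 = ?n - 1 - 2" by simp
  then have "H2_vanishes (D0 A) (?n - 2)"
    using van(2) by (intro H2_vanishes_addition) (simp only:)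
  moreover have "H1_vanishes (D0 A) (?n - 1)"
    by (rule H1_vanishes_addition[OF van(1)]) simp
  ultimately show ?thesis by (simp add: regular_sheaf_iff[OF submodule_D0])
qed

end

text \<open>Start of the induction on lines: \<open>D0 {H}\<close> is the kernel of a surjection
  from the free module of rank three onto the ring with constant coefficients. It is a direct
  summand and inherits the vanishing known for O.\<close>

lemma regular_sheaf_single_line:
  assumes "is_line (H :: ('k::field_char_0 ^ 3) set)"
  shows "regular_sheaf (D0 {H}) 0"
proof -
  define \<alpha> where "\<alpha> = line_coeffs H"
  obtain k where k: "\<alpha> $ k \<noteq> 0"
    using nonzero_component[OF line_coeffs(1)[OF assms]] by (auto simp: \<alpha>_def)
  let ?M = "D0 {H}"
  let ?\<alpha> = "embv (cvec \<alpha>)" and ?b = "embv (cvec (axis k (1 / \<alpha> $ k)))"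
  have M_iff: "f \<in> ?M \<longleftrightarrow> dot (cvec \<alpha>) f = 0" for f
    by (simp add: D0_iff defining_poly_def deriv_linear_form \<alpha>_def)
  have dot_embv: "dot ?\<alpha> (embv f) = to_fract (dot (cvec \<alpha>) f)" for f
    by (simp add: dot_three)
  have b: "dot (cvec \<alpha>) (cvec (axis k (1 / \<alpha> $ k))) = 1"
  proof -
    have "dot \<alpha> (axis k (1 / \<alpha> $ k)) = 1"
      using k by (simp add: dot_def axis_def if_distrib[of "\<lambda>x. _ * x"] cong: if_cong)
    then show ?thesis by (simp add: dot_cvec)
  qed
  text \<open>A retraction of the free module onto \<open>D0 {H}\<close>.\<close>
  define p where "p v = v - dot ?\<alpha> v *s ?b" for v
  have p_diff: "p (u - v) = p u - p v" and p_add: "p (u + v) = p u + p v" for u v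
    by (simp_all add: p_def dot_diff_right dot_add_right vec_eq_iff algebra_simps)
  have p_sections: "p v \<in> twisted_sections ?M m S" if "v \<in> twisted_sections UNIV m S" for v m S
  proof -
    have "p v \<in> twisted_sections ?M (m + 0) S"
    proof (rule twisted_sections_map[OF that])
      fix g :: "'k poly3 ^ 3" and n assume g: "homogeneous_vec n g"
      let ?g = "g - dot (cvec \<alpha>) g *s cvec (axis k (1 / \<alpha> $ k))"
      have "homogeneous n (dot (cvec \<alpha>) g)"
        using g by (simp add: dot_three homogeneous_vec_def homogeneous_add homogeneous_const_mult)
      then have "homogeneous_vec n (dot (cvec \<alpha>) g *s cvec (axis k (1 / \<alpha> $ k)))"
        by (rule homogeneous_vec_smult[of _ _ 0]) (simp_all add: homogeneous_vec_def)
      then have "homogeneous_vec (n + 0) ?g"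
        using g by (simp add: homogeneous_vec_def homogeneous_diff)
      moreover have "?g \<in> ?M"
        by (simp add: M_iff dot_diff_right dot_smult_right b)
      moreover have "p (embv g) = embv ?g"
        by (simp add: p_def dot_embv embv_diff embv_smult)
      ultimately show "\<exists>g'\<in>?M. homogeneous_vec (n + 0) g' \<and> p (embv g) = embv g'" by blast
    qed (simp add: p_def dot_smult_right vec_eq_iff algebra_simps)
    then show ?thesis by simp
  qed
  have p_id: "p v = v" if v: "v \<in> twisted_sections ?M m S" for v m S
  proof -
    obtain g N where g: "g \<in> ?M" "to_fract (denom S ^ N) *s v = embv g"
      using v unfolding twisted_sections_iff by blast
    have "to_fract (denom S ^ N) * dot ?\<alpha> v = 0"
      using g by (simp add: dot_smult_right[symmetric] dot_embv M_iff del: to_fract_mult)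
    then have "dot ?\<alpha> v = 0" by simp
    then show ?thesis by (simp add: p_def)
  qed
  have "H1_vanishes ?M (- 1)"
    unfolding H1_vanishes_def
  proof (intro ballI impI)
    fix a b c assume abc: "a \<in> twisted_sections ?M (- 1) {0,1}" "b \<in> twisted_sections ?M (- 1) {0,2}"
      "c \<in> twisted_sections ?M (- 1) {1,2}" "a + c = b"
    have "\<exists>u v w. u \<in> sections (- 1) {0} \<and> v \<in> sections (- 1) {1} \<and> w \<in> sections (- 1) {2}
      \<and> a $ j = v - u \<and> b $ j = w - u \<and> c $ j = w - v" for j
      using sections_H1_vanishes[OF abc(1-3)[THEN twisted_sections_nth, of j]]
        arg_cong[OF abc(4), of "\<lambda>v. v $ j"] by (metis vector_add_component)
    then obtain u v w where uvw: "\<And>j. u j \<in> sections (- 1) {0}" "\<And>j. v j \<in> sections (- 1) {1}"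
      "\<And>j. w j \<in> sections (- 1) {2}" "\<And>j. a $ j = v j - u j" "\<And>j. b $ j = w j - u j"
      "\<And>j. c $ j = w j - v j"
      by metis
    let ?u = "\<chi> j. u j" and ?v = "\<chi> j. v j" and ?w = "\<chi> j. w j"
    have "a = p (?v - ?u)" "b = p (?w - ?u)" "c = p (?w - ?v)"
      using p_id[OF abc(1)] p_id[OF abc(2)] p_id[OF abc(3)] uvw(4-6)
      by (metis (no_types, lifting) vec_eq_iff vec_lambda_beta vector_minus_component)+
    moreover have "p ?u \<in> twisted_sections ?M (- 1) {0}" "p ?v \<in> twisted_sections ?M (- 1) {1}"
      "p ?w \<in> twisted_sections ?M (- 1) {2}"
      by (auto intro!: p_sections twisted_sections_UNIV simp: uvw)
    ultimately show "\<exists>u\<in>twisted_sections ?M (- 1) {0}. \<exists>v\<in>twisted_sections ?M (- 1) {1}.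
        \<exists>w\<in>twisted_sections ?M (- 1) {2}. a = v - u \<and> b = w - u \<and> c = w - v"
      unfolding p_diff by blast
  qed
  moreover have "H2_vanishes ?M (- 2)"
    unfolding H2_vanishes_def
  proof
    fix x assume x: "x \<in> twisted_sections ?M (- 2) {0,1,2}"
    have "\<exists>a b c. a \<in> sections (- 2) {0,1} \<and> b \<in> sections (- 2) {0,2} \<and> c \<in> sections (- 2) {1,2}
      \<and> x $ j = a + b + c" for j
      using sections_H2_vanishes[OF _ twisted_sections_nth[OF x, of j]] by (metis order_refl)
    then obtain a b c where abc: "\<And>j. a j \<in> sections (- 2) {0,1}" "\<And>j. b j \<in> sections (- 2) {0,2}"
      "\<And>j. c j \<in> sections (- 2) {1,2}" "\<And>j. x $ j = a j + b j + c j"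
      by metis
    let ?a = "\<chi> j. a j" and ?b = "\<chi> j. b j" and ?c = "\<chi> j. c j"
    have "x = ?a + ?b + ?c" by (simp add: vec_eq_iff abc(4))
    then have "x = p ?a + p ?b + p ?c" using p_id[OF x] by (metis p_add)
    moreover have "p ?a \<in> twisted_sections ?M (- 2) {0,1}" "p ?b \<in> twisted_sections ?M (- 2) {0,2}"
      "p ?c \<in> twisted_sections ?M (- 2) {1,2}"
      by (auto intro!: p_sections twisted_sections_UNIV simp: abc)
    ultimately show "\<exists>a\<in>twisted_sections ?M (- 2) {0,1}. \<exists>b\<in>twisted_sections ?M (- 2) {0,2}.
        \<exists>c\<in>twisted_sections ?M (- 2) {1,2}. x = a + b + c"
      by blast
  qed
  ultimately show ?thesis by (simp add: regular_sheaf_iff[OF submodule_D0])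
qed

section \<open>Existence and minimality of the regularity, and the bound\<close>

lemma regular_sheaf_exists:
  fixes A :: "('k::field_char_0 ^ 3) set set"
  assumes "finite A" "A \<noteq> {}" "\<And>H. H \<in> A \<Longrightarrow> is_line H"
  shows "\<exists>m. regular_sheaf (D0 A) m"
  using assms
proof (induction A rule: finite_ne_induct)
  case (singleton H)
  then show ?case using regular_sheaf_single_line by blast
next
  case (insert H A)
  interpret triple "insert H A" H
    by unfold_locales (use insert in \<open>auto simp: line_arrangement_def\<close>)
  have "B = A" unfolding B_def using insert by auto
  then show ?case using insert regular_sheaf_addition by auto
qed

lemma reg_properties:
  fixes A :: "('k::field_char_0 ^ 3) set set"
  assumes "line_arrangement A" "A \<noteq> {}"
  shows "regular_sheaf (D0 A) (reg (D0 A))" and "regular_sheaf (D0 A) m \<Longrightarrow> reg (D0 A) \<le> m"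
proof -
  obtain f n where f: "f \<in> D0 A" "homogeneous_vec n f" "f \<noteq> 0"
    by (rule D0_nonzero_element[OF assms(1)])
  obtain t where t: "\<And>m. regular_sheaf (D0 A) m \<Longrightarrow> t < m"
    using regular_sheaf_bounded_below[OF submodule_D0 f] by blast
  obtain m0 where m0: "regular_sheaf (D0 A) m0"
    using regular_sheaf_exists assms unfolding line_arrangement_def by blast
  show "regular_sheaf (D0 A) (reg (D0 A))" "regular_sheaf (D0 A) m \<Longrightarrow> reg (D0 A) \<le> m"
    unfolding reg_def using Least_int_exists[of "regular_sheaf (D0 A)", OF m0 t] by blast+
qed

theorem theorem3p4:
  fixes A :: "('k::field_char_0 ^ 3) set set" and H :: "('k ^ 3) set"
  assumes "line_arrangement A" and "essential A" and "H \<in> A"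
  shows "reg (D0 A) \<le> max (reg (D0 (A - {H})) + 1) (int (card (restriction A H)) - 1)"
proof -
  have ne: "A - {H} \<noteq> {}"
  proof
    assume "A - {H} = {}"
    then have A: "A = {H}" using assms(3) by blast
    obtain b where b: "b \<noteq> 0" "H = zero_plane b"
      using assms(1,3) by (auto simp: line_arrangement_def is_line_def)
    \<comment> \<open>A cross product with b lies in \<open>H\<close>. A nonzero one would be a
      common point of all lines if \<open>H\<close> were the only one, contradicting that the
      arrangement is essential.\<close>
    obtain c :: "'k ^ 3" where c: "cross b c \<noteq> 0"
    proof -
      obtain j where j: "b $ j \<noteq> 0" using nonzero_component[OF b(1)] by blast
      obtain i where i: "i \<noteq> j" using three_distinct(1) by metis
      have "b $ j * axis i (1::'k) $ i \<noteq> b $ i * axis i 1 $ j"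
        using i j by (simp add: axis_def)
      then have "cross b (axis i 1) \<noteq> 0" using cross_eq_0_minors by metis
      then show ?thesis using that by blast
    qed
    have "cross b c \<in> H" by (simp add: b(2) mem_zero_plane)
    then show False using assms(2) c by (auto simp: essential_def A)
  qed
  interpret triple A H
    by unfold_locales (use assms ne in auto)
  have "regular_sheaf (D0 (A - {H})) (reg (D0 (A - {H})))"
    by (rule reg_properties(1)) (use arrangement_B ne in \<open>simp_all add: B_def\<close>)
  then have "regular_sheaf (D0 A) (max (reg (D0 (A - {H})) + 1) a)"
    using regular_sheaf_addition by (simp add: B_def)
  then show ?thesis
    unfolding a_def by (rule reg_properties(2)[OF assms(1) A_nonempty])
qed

end
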